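(* Assume $p_n=n$ and $\epsilon_1,\dots,\epsilon_n$ are i.i.d. $N(0,\sigma^2)$, and let the MMA estimator $\hat{\mathbf f}_{\hat{\mathbf w}|\mathcal M_{G1}}$ use $\hat\sigma^2=\hat\sigma^2_{m_n}=\|\mathbf y-\mathbf P_{m_n}\mathbf y\|^2/(n-m_n)$ with $m_n=\lfloor\kappa n\rfloor$ for a constant $0<\kappa<1$. Then: (i) for every $\alpha>0$ and $R>0$, with $\mathcal F=\mathcal F_{\Theta(\alpha,R)}$, $$\sup_{\mathbf f\in\mathcal F}n^{-1}\mathbb E\|\hat{\mathbf f}_{\hat{\mathbf w}|\mathcal M_{G1}}-\mathbf f\|^2=[1+o(1)]R_M(\mathcal F);$$ (ii) for every $c>0$ and $q>1/2$, with $\mathcal F=\mathcal F_{\Theta^H(c,q)}$, $$\sup_{\mathbf f\in\mathcal F}n^{-1}\mathbb E\|\hat{\mathbf f}_{\hat{\mathbf w}|\mathcal M_{G1}}-\mathbf f\|^2=[1+o(1)]R_L(\mathcal F).$$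
   Context: Setup. We observe $\mathbf y=\mathbf f+\boldsymbol\epsilon\in\mathbb R^n$ with $\mathbf f=\mathbf X\boldsymbol\beta$, $\mathbf X\in\mathbb R^{n\times n}$ nonstochastic of full rank. Let $\mathbf P_j$ be the orthogonal projection onto the span of the first $j$ columns of $\mathbf X$ ($\mathbf P_0=\mathbf 0$); $\mathbf P_j-\mathbf P_{j-1}=\boldsymbol\phi_j\boldsymbol\phi_j^\top$ with $\{\boldsymbol\phi_1,\dots,\boldsymbol\phi_n\}$ an orthonormal basis, and $\theta_j=\boldsymbol\phi_j^\top\mathbf f/\sqrt n$. A nested candidate set is $\mathcal M=\{\{1,\dots,k_m\}:m=1,\dots,M_n\}$, $1\le k_1<\dots<k_{M_n}\le n$, model $m$ giving $\hat{\mathbf f}_m=\mathbf P_{k_m}\mathbf y$; $\mathcal M_A=\{\{1,\dots,j\}:1\le j\le n\}$. For $\mathbf w\in\mathcal W_{M_n}$ (unit simplex), $\hat{\mathbf f}_{\mathbf w|\mathcal M}=\sum_mw_m\hat{\mathbf f}_m$. MMA: $C_n(\mathbf w|\mathcal M,\mathbf y)=n^{-1}\|\mathbf y-\hat{\mathbf f}_{\mathbf w|\mathcal M}\|^2+2\hat\sigma^2n^{-1}\sum_mk_mw_m$, and $\hat{\mathbf w}|\mathcal M$ minimizes $C_n$ over $\mathcal W_{M_n}$. $\mathcal M_{G1}$: for constants $t_1,t_2>0$, $\zeta_n=t_1/(\log n)^{t_2}$, $k_1=\lceil\zeta_n^{-1}\rceil$, $k_m=k_{m-1}+\lfloor k_1(1+\zeta_n)^{m-1}\rfloor$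 for $m=2,\dots,M_n-1$, $k_{M_n}=n$, with $M_n=\min\{m\in\mathbb N:k_1+\sum_{j=2}^m\lfloor k_1(1+\zeta_n)^{j-1}\rfloor\ge n\}$. Classes: ellipsoid $\Theta(\alpha,R)=\{\boldsymbol\theta\in\mathbb R^n:\sum_{j=1}^nj^{2\alpha}\theta_j^2\le R\}$; hyperrectangle $\Theta^H(c,q)=\{\boldsymbol\theta\in\mathbb R^n:|\theta_j|\le cj^{-q},\ j=1,\dots,n\}$; for $\Theta\subseteq\mathbb R^n$, $\mathcal F_\Theta=\{\sqrt n\sum_{j=1}^n\theta_j\boldsymbol\phi_j:\boldsymbol\theta\in\Theta\}$. Minimax risk $R_M(\mathcal F)=\inf_{\hat{\mathbf f}}\sup_{\mathbf f\in\mathcal F}n^{-1}\mathbb E\|\hat{\mathbf f}-\mathbf f\|^2$ (infimum over all estimators). Linear-combined minimax risk $R_L(\mathcal F)=\inf_{\mathbf w\in\mathbb R^n}\sup_{\mathbf f\in\mathcal F}R_n(\mathbf w|\mathcal M_A,\mathbf f)$, where for any $\mathbf w\in\mathbb R^n$, $R_n(\mathbf w|\mathcal M_A,\mathbf f)=\sum_{j=1}^n[(1-\gamma_j)^2\theta_j^2+\sigma^2\gamma_j^2/n]$ with $\gamma_j=\sum_{m=j}^nw_m$ (the risk of $\sum_mw_m\mathbf P_m\mathbf y$). $o(1)$ refers to $n\to\infty$ with the class fixed. *)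

theory Defs
  imports "HOL-Probability.Probability"
begin

(* Conventions: for sample size n, vectors in R^n are functions nat => real of which
   only the indices 0..n-1 matter; index i corresponds to the paper's index i+1.
   Phi j (j < n) is the paper's phi_{j+1}.  *)

definition sqn :: "nat \<Rightarrow> (nat \<Rightarrow> real) \<Rightarrow> real" where
  "sqn n v = (\<Sum>i<n. (v i)\<^sup>2)"

definition Pk :: "(nat \<Rightarrow> nat \<Rightarrow> real) \<Rightarrow> nat \<Rightarrow> nat \<Rightarrow> (nat \<Rightarrow> real) \<Rightarrow> nat \<Rightarrow> real" where
  "Pk Phi n k y = (\<lambda>i. \<Sum>j<k. (\<Sum>l<n. Phi j l * y l) * Phi j i)"

definition thetaOf :: "(nat \<Rightarrow> nat \<Rightarrow> real) \<Rightarrow> nat \<Rightarrow> (nat \<Rightarrow> real) \<Rightarrow> nat \<Rightarrow> real" where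
  "thetaOf Phi n f j = (\<Sum>l<n. Phi j l * f l) / sqrt (real n)"

definition FTheta :: "(nat \<Rightarrow> nat \<Rightarrow> real) \<Rightarrow> nat \<Rightarrow> (nat \<Rightarrow> real) set \<Rightarrow> (nat \<Rightarrow> real) set" where
  "FTheta Phi n Th = {f. \<exists>\<theta>\<in>Th. f = (\<lambda>i. sqrt (real n) * (\<Sum>j<n. \<theta> j * Phi j i))}"

definition Ell :: "real \<Rightarrow> real \<Rightarrow> nat \<Rightarrow> (nat \<Rightarrow> real) set" where
  "Ell \<alpha> R n = {\<theta>. (\<Sum>j<n. real (j+1) powr (2*\<alpha>) * (\<theta> j)\<^sup>2) \<le> R}"

definition Hyp :: "real \<Rightarrow> real \<Rightarrow> nat \<Rightarrow> (nat \<Rightarrow> real) set" where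
  "Hyp c q n = {\<theta>. \<forall>j<n. \<bar>\<theta> j\<bar> \<le> c * real (j+1) powr (-q)}"

(* candidate set M_G1 (models indexed m = 1..Mn) *)
definition zetaG :: "real \<Rightarrow> real \<Rightarrow> nat \<Rightarrow> real" where
  "zetaG t1 t2 n = t1 / (ln (real n)) powr t2"

definition k1G :: "real \<Rightarrow> real \<Rightarrow> nat \<Rightarrow> nat" where
  "k1G t1 t2 n = nat \<lceil>1 / zetaG t1 t2 n\<rceil>"

definition cumG :: "real \<Rightarrow> real \<Rightarrow> nat \<Rightarrow> nat \<Rightarrow> nat" where
  "cumG t1 t2 n m = k1G t1 t2 n +
     (\<Sum>j\<in>{2..m}. nat \<lfloor>real (k1G t1 t2 n) * (1 + zetaG t1 t2 n) ^ (j - 1)\<rfloor>)"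

definition MG :: "real \<Rightarrow> real \<Rightarrow> nat \<Rightarrow> nat" where
  "MG t1 t2 n = (LEAST m. 1 \<le> m \<and> n \<le> cumG t1 t2 n m)"

definition kG :: "real \<Rightarrow> real \<Rightarrow> nat \<Rightarrow> nat \<Rightarrow> nat" where
  "kG t1 t2 n m = (if m = MG t1 t2 n then n else cumG t1 t2 n m)"

definition sigmahat2 :: "(nat \<Rightarrow> nat \<Rightarrow> real) \<Rightarrow> nat \<Rightarrow> real \<Rightarrow> (nat \<Rightarrow> real) \<Rightarrow> real" where
  "sigmahat2 Phi n \<kappa> y =
     (let m = nat \<lfloor>\<kappa> * real n\<rfloor> in sqn n (\<lambda>i. y i - Pk Phi n m y i) / real (n - m))"

definition simplexG :: "nat \<Rightarrow> (nat \<Rightarrow> real) set" where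
  "simplexG M = {w. (\<forall>m\<in>{1..M}. 0 \<le> w m) \<and> (\<Sum>m=1..M. w m) = 1}"

definition fhatG :: "(nat \<Rightarrow> nat \<Rightarrow> real) \<Rightarrow> nat \<Rightarrow> real \<Rightarrow> real \<Rightarrow> (nat \<Rightarrow> real)
    \<Rightarrow> (nat \<Rightarrow> real) \<Rightarrow> nat \<Rightarrow> real" where
  "fhatG Phi n t1 t2 w y = (\<lambda>i. \<Sum>m=1..MG t1 t2 n. w m * Pk Phi n (kG t1 t2 n m) y i)"

definition CnG :: "(nat \<Rightarrow> nat \<Rightarrow> real) \<Rightarrow> nat \<Rightarrow> real \<Rightarrow> real \<Rightarrow> real
    \<Rightarrow> (nat \<Rightarrow> real) \<Rightarrow> (nat \<Rightarrow> real) \<Rightarrow> real" where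
  "CnG Phi n \<kappa> t1 t2 w y =
     sqn n (\<lambda>i. y i - fhatG Phi n t1 t2 w y i) / real n
     + 2 * sigmahat2 Phi n \<kappa> y / real n * (\<Sum>m=1..MG t1 t2 n. real (kG t1 t2 n m) * w m)"

definition whatG :: "(nat \<Rightarrow> nat \<Rightarrow> real) \<Rightarrow> nat \<Rightarrow> real \<Rightarrow> real \<Rightarrow> real
    \<Rightarrow> (nat \<Rightarrow> real) \<Rightarrow> (nat \<Rightarrow> real)" where
  "whatG Phi n \<kappa> t1 t2 y = (SOME w. w \<in> simplexG (MG t1 t2 n) \<and>
      (\<forall>v\<in>simplexG (MG t1 t2 n). CnG Phi n \<kappa> t1 t2 w y \<le> CnG Phi n \<kappa> t1 t2 v y))"

definition mmaG :: "(nat \<Rightarrow> nat \<Rightarrow> real) \<Rightarrow> nat \<Rightarrow> real \<Rightarrow> real \<Rightarrow> real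
    \<Rightarrow> (nat \<Rightarrow> real) \<Rightarrow> nat \<Rightarrow> real" where
  "mmaG Phi n \<kappa> t1 t2 y = fhatG Phi n t1 t2 (whatG Phi n \<kappa> t1 t2 y) y"

definition noise :: "real \<Rightarrow> nat \<Rightarrow> (nat \<Rightarrow> real) measure" where
  "noise \<sigma> n = PiM {..<n} (\<lambda>_. density lborel (normal_density 0 \<sigma>))"

definition risk :: "real \<Rightarrow> nat \<Rightarrow> ((nat \<Rightarrow> real) \<Rightarrow> nat \<Rightarrow> real) \<Rightarrow> (nat \<Rightarrow> real) \<Rightarrow> ennreal" where
  "risk \<sigma> n g f = (\<integral>\<^sup>+ e. ennreal (sqn n (\<lambda>i. g (restrict (\<lambda>i. f i + e i) {..<n}) i - f i) / real n)
      \<partial>noise \<sigma> n)"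

definition estimators :: "nat \<Rightarrow> ((nat \<Rightarrow> real) \<Rightarrow> nat \<Rightarrow> real) set" where
  "estimators n = {g. \<forall>i<n. (\<lambda>y. g y i) \<in> borel_measurable (PiM {..<n} (\<lambda>_. borel))}"

definition RM :: "real \<Rightarrow> nat \<Rightarrow> (nat \<Rightarrow> real) set \<Rightarrow> ennreal" where
  "RM \<sigma> n F = (INF g\<in>estimators n. SUP f\<in>F. risk \<sigma> n g f)"

definition RnA :: "real \<Rightarrow> (nat \<Rightarrow> nat \<Rightarrow> real) \<Rightarrow> nat \<Rightarrow> (nat \<Rightarrow> real) \<Rightarrow> (nat \<Rightarrow> real) \<Rightarrow> real" where
  "RnA \<sigma> Phi n w f = (\<Sum>j<n. (1 - (\<Sum>m\<in>{j..<n}. w m))\<^sup>2 * (thetaOf Phi n f j)\<^sup>2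
        + \<sigma>\<^sup>2 * (\<Sum>m\<in>{j..<n}. w m)\<^sup>2 / real n)"

definition RL :: "real \<Rightarrow> (nat \<Rightarrow> nat \<Rightarrow> real) \<Rightarrow> nat \<Rightarrow> (nat \<Rightarrow> real) set \<Rightarrow> ennreal" where
  "RL \<sigma> Phi n F = (INF w\<in>UNIV. SUP f\<in>F. ennreal (RnA \<sigma> Phi n w f))"

definition supRiskMMA :: "real \<Rightarrow> (nat \<Rightarrow> nat \<Rightarrow> real) \<Rightarrow> nat \<Rightarrow> real \<Rightarrow> real \<Rightarrow> real
    \<Rightarrow> (nat \<Rightarrow> real) set \<Rightarrow> ennreal" where
  "supRiskMMA \<sigma> Phi n \<kappa> t1 t2 F = (SUP f\<in>F. risk \<sigma> n (mmaG Phi n \<kappa> t1 t2) f)"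

end

theory Submission
  imports Defs "HOL-Real_Asymp.Real_Asymp"
begin

text \<open>In the orthonormal basis the model is a Gaussian sequence model, and averaging nested projections
  shrinks coordinate \<open>j\<close> by a factor that is constant on the blocks of the candidate set and decreases
  along them. Pointwise in the noise, criterion, loss and risk of such a blockwise estimator differ by noise terms
  which the elementary bound \<open>2xa \<le> \<delta>x\<^sup>2b + a\<^sup>2/(\<delta>b)\<close> absorbs into \<open>\<delta>\<close> times the risk plus
  \<open>1/\<delta>\<close> times a fluctuation not depending on the weights; its expectation is of the order of the number of
  blocks, hence polylogarithmic in \<open>n\<close>. So the minimiser of the criterion is as good as the best
  monotone weights, up to a factor tending to 1: the ratio of neighbouring block sizes tends to 1, and the
  minimax risks are of polynomial order \<open>n powr \<beta>\<close> after scaling by \<open>n\<close>. For both classes the optimal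
  linear weights are monotone and form a saddle point with a least favourable sequence. Since the lower bound for
  the loss is pointwise, no measurability of the selected weights is needed. For the ellipsoid, Pinsker's theorem
  (a Gaussian prior slightly inside the ellipsoid) shows that the linear and the full minimax risk agree
  asymptotically.\<close>

section \<open>Orthonormal bases and rotation invariance of Gaussian noise\<close>

text \<open>The obstacle is that the weights are chosen with the noise that also enters the loss, so
  nothing can be averaged for fixed weights. Working pointwise moves all randomness into
  \<open>fluctuation\<close>. Its mean is at most \<open>3 * \<sigma>\<^sup>2\<close> per block,
  whatever the size and the signal of the block, plus the cost of the variance estimate. Since block
  sizes grow by the factor \<open>1 + zetaG\<close>, there are only about
  \<open>ln n / zetaG\<close> blocks. The variance estimate is biased by the signal energy
  \<open>b n\<close> left beyond coordinate \<open>\<kappa> * n\<close>. The bias enters squared and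
  costs about \<open>(b n)\<^sup>2 / n\<close>, which has to be small against
  \<open>n powr \<beta>\<close>. On ellipsoids this holds for every \<alpha> > 0; on hyperrectangles
  the condition on the exponents is \<open>(4 * q - 1) * (2 * q - 1) > 0\<close>, which q > 1/2
  guarantees. Weights in the simplex leave the first block unshrunk. This costs one block of length
  about \<open>1 / zetaG\<close>, again polylogarithmic. The saddle value divided by n is exactly
  the linear minimax risk, whereas it is only an upper bound for the full one; the matching lower
  bound needs the prior.\<close>

definition coord :: "(nat \<Rightarrow> nat \<Rightarrow> real) \<Rightarrow> nat \<Rightarrow> (nat \<Rightarrow> real) \<Rightarrow> nat \<Rightarrow> real" where
  "coord Phi n v j = (\<Sum>l<n. Phi j l * v l)"

locale orthonormal_rows =
  fixes Phi :: "nat \<Rightarrow> nat \<Rightarrow> real" and n :: nat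
  assumes rows: "\<And>j l. j < n \<Longrightarrow> l < n \<Longrightarrow> (\<Sum>i<n. Phi j i * Phi l i) = (if j = l then 1 else 0)"
begin

text \<open>Expanding the square, the cross term is the coefficient sum by definition of
  \<open>coord\<close>, and the quadratic term is the same sum by orthonormality. That the rows span
  is not known yet, so the gap may still be positive; \<open>columns\<close> makes it
  vanish.\<close>

lemma bessel_gap:
  "sqn n v - (\<Sum>j<n. (coord Phi n v j)\<^sup>2) = sqn n (\<lambda>i. v i - (\<Sum>j<n. coord Phi n v j * Phi j i))"
proof -
  let ?c = "coord Phi n v"
  have 1: "(\<Sum>i<n. v i * (\<Sum>j<n. ?c j * Phi j i)) = (\<Sum>j<n. (?c j)\<^sup>2)"
  proof -
    have "(\<Sum>i<n. v i * (\<Sum>j<n. ?c j * Phi j i)) = (\<Sum>i<n. \<Sum>j<n. ?c j * (Phi j i * v i))"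
      by (simp add: sum_distrib_left mult_ac)
    also have "\<dots> = (\<Sum>j<n. \<Sum>i<n. ?c j * (Phi j i * v i))" by (rule sum.swap)
    also have "\<dots> = (\<Sum>j<n. (?c j)\<^sup>2)"
      by (simp add: coord_def power2_eq_square flip: sum_distrib_left)
    finally show ?thesis .
  qed
  have 2: "(\<Sum>i<n. (\<Sum>j<n. ?c j * Phi j i)\<^sup>2) = (\<Sum>j<n. (?c j)\<^sup>2)"
  proof -
    have "(\<Sum>i<n. (\<Sum>j<n. ?c j * Phi j i)\<^sup>2) = (\<Sum>i<n. \<Sum>j<n. \<Sum>l<n. ?c j * ?c l * (Phi j i * Phi l i))"
      by (simp add: power2_eq_square sum_product mult_ac)
    also have "\<dots> = (\<Sum>j<n. \<Sum>i<n. \<Sum>l<n. ?c j * ?c l * (Phi j i * Phi l i))" by (rule sum.swap)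
    also have "\<dots> = (\<Sum>j<n. \<Sum>l<n. \<Sum>i<n. ?c j * ?c l * (Phi j i * Phi l i))"
      by (intro sum.cong refl sum.swap)
    also have "\<dots> = (\<Sum>j<n. \<Sum>l<n. ?c j * ?c l * (if j = l then 1 else 0))"
      by (intro sum.cong refl) (simp add: rows flip: sum_distrib_left)
    also have "\<dots> = (\<Sum>j<n. (?c j)\<^sup>2)"
      by (intro sum.cong refl) (simp add: power2_eq_square if_distrib cong: if_cong)
    finally show ?thesis .
  qed
  have "sqn n (\<lambda>i. v i - (\<Sum>j<n. ?c j * Phi j i)) =
     (\<Sum>i<n. (v i)\<^sup>2 - 2 * (v i * (\<Sum>j<n. ?c j * Phi j i)) + (\<Sum>j<n. ?c j * Phi j i)\<^sup>2)"
    unfolding sqn_def by (intro sum.cong refl) (simp add: power2_eq_square algebra_simps)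
  also have "\<dots> = sqn n v - 2 * (\<Sum>j<n. (?c j)\<^sup>2) + (\<Sum>j<n. (?c j)\<^sup>2)"
    by (simp only: sum.distrib sum_subtractf sum_distrib_left[symmetric] 1 2 sqn_def)
  finally show ?thesis by simp
qed

text \<open>Bessel's inequality for the unit vectors, summed over all of them, is an equality of traces.\<close>
lemma columns:
  assumes "i < n" "k < n"
  shows "(\<Sum>j<n. Phi j i * Phi j k) = (if i = k then 1 else 0)"
proof -
  define e where "e = (\<lambda>(i::nat) l. if l = i then 1 else 0 :: real)"
  have ce: "coord Phi n (e i) j = Phi j i" if "i < n" for i j
    using that by (simp add: coord_def e_def if_distrib cong: if_cong)
  have se: "sqn n (e i) = 1" if "i < n" for i
    using that by (simp add: sqn_def e_def power2_eq_square mult_if_delta)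
  define r where "r i = sqn n (\<lambda>l. e i l - (\<Sum>j<n. coord Phi n (e i) j * Phi j l))" for i
  have r: "r i = 1 - (\<Sum>j<n. (Phi j i)\<^sup>2)" if "i < n" for i
    using bessel_gap[of "e i"] that by (simp add: r_def se ce)
  have "(\<Sum>i<n. r i) = real n - (\<Sum>i<n. \<Sum>j<n. (Phi j i)\<^sup>2)"
    by (simp add: r sum_subtractf)
  also have "(\<Sum>i<n. \<Sum>j<n. (Phi j i)\<^sup>2) = (\<Sum>j<n. \<Sum>i<n. (Phi j i)\<^sup>2)" by (rule sum.swap)
  also have "\<dots> = real n" using rows by (simp add: power2_eq_square)
  finally have "(\<Sum>i<n. r i) = 0" by simp
  moreover have "r i \<ge> 0" for i by (simp add: r_def sqn_def sum_nonneg)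
  ultimately have "r i = 0" using assms(1) by (subst (asm) sum_nonneg_eq_0_iff) auto
  then have "e i k - (\<Sum>j<n. coord Phi n (e i) j * Phi j k) = 0"
    using assms(2) unfolding r_def sqn_def by (subst (asm) sum_nonneg_eq_0_iff) auto
  then have "e i k = (\<Sum>j<n. Phi j i * Phi j k)" by (simp add: ce[OF assms(1)])
  then show ?thesis by (simp add: e_def eq_commute)
qed

lemma synth_coord:
  assumes "i < n"
  shows "(\<Sum>j<n. coord Phi n v j * Phi j i) = v i"
proof -
  have "(\<Sum>j<n. coord Phi n v j * Phi j i) = (\<Sum>j<n. \<Sum>l<n. v l * (Phi j l * Phi j i))"
    by (simp add: coord_def sum_distrib_right sum_distrib_left mult_ac)
  also have "\<dots> = (\<Sum>l<n. \<Sum>j<n. v l * (Phi j l * Phi j i))" by (rule sum.swap)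
  also have "\<dots> = (\<Sum>l<n. v l * (if l = i then 1 else 0))"
    by (intro sum.cong refl) (simp add: assms columns flip: sum_distrib_left)
  finally show ?thesis using assms by (simp add: if_distrib cong: if_cong)
qed

lemma parseval: "sqn n v = (\<Sum>j<n. (coord Phi n v j)\<^sup>2)"
  using bessel_gap[of v] by (simp add: sqn_def synth_coord)

lemma coord_synth:
  assumes "j < n"
  shows "coord Phi n (\<lambda>i. \<Sum>l<n. a l * Phi l i) j = a j"
proof -
  have "coord Phi n (\<lambda>i. \<Sum>l<n. a l * Phi l i) j = (\<Sum>i<n. \<Sum>l<n. a l * (Phi j i * Phi l i))"
    by (simp add: coord_def sum_distrib_left mult_ac)
  also have "\<dots> = (\<Sum>l<n. \<Sum>i<n. a l * (Phi j i * Phi l i))" by (rule sum.swap)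
  also have "\<dots> = (\<Sum>l<n. a l * (if j = l then 1 else 0))"
    by (intro sum.cong refl) (simp add: assms rows flip: sum_distrib_left)
  finally show ?thesis using assms by (simp add: if_distrib cong: if_cong)
qed

end

lemma coord_add: "coord Phi n (\<lambda>i. u i + v i) j = coord Phi n u j + coord Phi n v j"
  by (simp add: coord_def sum.distrib distrib_left)

lemma coord_diff: "coord Phi n (\<lambda>i. u i - v i) j = coord Phi n u j - coord Phi n v j"
  by (simp add: coord_def sum_subtractf right_diff_distrib)

lemma coord_restrict [simp]: "coord Phi n (restrict u {..<n}) j = coord Phi n u j"
  by (simp add: coord_def)

section \<open>Gaussian noise as a density with respect to Lebesgue measure on R^n\<close>

definition gauss :: "real \<Rightarrow> real measure" where
  "gauss \<sigma> = density lborel (normal_density 0 \<sigma>)"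

lemma noise_gauss: "noise \<sigma> n = PiM {..<n} (\<lambda>_. gauss \<sigma>)"
  by (simp add: noise_def gauss_def)

lemma sets_gauss [measurable_cong]: "sets (gauss \<sigma>) = sets borel"
  by (simp add: gauss_def)

lemma space_gauss [simp]: "space (gauss \<sigma>) = UNIV"
  by (simp add: gauss_def)

lemma prob_gauss: "\<sigma> > 0 \<Longrightarrow> prob_space (gauss \<sigma>)"
  unfolding gauss_def by (rule prob_space_normal_density)

lemma sets_noise [measurable_cong]: "sets (noise \<sigma> n) = sets (PiM {..<n} (\<lambda>_. borel))"
  unfolding noise_gauss by (intro sets_PiM_cong refl sets_gauss)

lemma space_noise: "space (noise \<sigma> n) = extensional {..<n}"
  by (simp add: noise_def space_PiM PiE_def)

lemma prob_noise: "\<sigma> > 0 \<Longrightarrow> prob_space (noise \<sigma> n)"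
  unfolding noise_gauss by (intro prob_space_PiM prob_gauss)

text \<open>Lebesgue measure on R^n in the encoding of \<open>noise\<close>: its points are
  functions that are \<open>undefined\<close> outside the index range. This is why sums of vectors
  are wrapped in \<open>restrict\<close> below.\<close>

definition cleb :: "nat \<Rightarrow> (nat \<Rightarrow> real) measure" where
  "cleb n = PiM {..<n} (\<lambda>_. lborel)"

lemma sets_cleb [measurable_cong]: "sets (cleb n) = sets (PiM {..<n} (\<lambda>_. borel))"
  unfolding cleb_def by (intro sets_PiM_cong refl) simp

lemma space_cleb: "space (cleb n) = extensional {..<n}"
  by (simp add: cleb_def space_PiM PiE_def)

lemma sigma_finite_cleb: "sigma_finite_measure (cleb n)"
proof -
  interpret product_sigma_finite "\<lambda>_::nat. lborel :: real measure"
    by standard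
  interpret finite_product_sigma_finite "\<lambda>_::nat. lborel :: real measure" "{..<n}"
    by standard simp
  show ?thesis unfolding cleb_def by unfold_locales
qed

text \<open>A product measure is determined by boxes, and the preimage of a box under a translation
  is the box of translated factors, so invariance in one dimension suffices.\<close>

lemma nn_integral_cleb_translate:
  assumes f: "f \<in> borel_measurable (PiM {..<n} (\<lambda>_. borel))"
  shows "(\<integral>\<^sup>+x. f (restrict (\<lambda>i. x i + a i) {..<n}) \<partial>cleb n) = (\<integral>\<^sup>+x. f x \<partial>cleb n)"
proof -
  interpret product_sigma_finite "\<lambda>_::nat. lborel :: real measure"
    by standard
  let ?T = "\<lambda>x::nat\<Rightarrow>real. restrict (\<lambda>i. x i + a i) {..<n}"
  have T: "?T \<in> measurable (cleb n) (cleb n)"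
    unfolding cleb_def by measurable
  have "distr (cleb n) (cleb n) ?T = PiM {..<n} (\<lambda>_. lborel)"
  proof (rule PiM_eqI)
    fix A :: "nat \<Rightarrow> real set" assume A: "\<And>i. i \<in> {..<n} \<Longrightarrow> A i \<in> sets lborel"
    have "?T -` Pi\<^sub>E {..<n} A \<inter> space (cleb n) = Pi\<^sub>E {..<n} (\<lambda>i. (+) (a i) -` A i)"
      by (auto simp: space_cleb PiE_def Pi_def add.commute extensional_def)
    note eq = this
    have m: "(+) (a i) -` A i \<in> sets lborel" if "i < n" for i
      using measurable_sets[of "(+) (a i)" lborel borel "A i"] A that by simp
    have "emeasure (distr (cleb n) (cleb n) ?T) (Pi\<^sub>E {..<n} A) = emeasure (cleb n) (Pi\<^sub>E {..<n} (\<lambda>i. (+) (a i) -` A i))"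
      unfolding eq[symmetric] using A
      by (intro emeasure_distr T) (auto simp: cleb_def intro!: sets_PiM_I_finite)
    also have "\<dots> = (\<Prod>i<n. emeasure lborel ((+) (a i) -` A i))"
      unfolding cleb_def using m by (subst emeasure_PiM) auto
    also have "\<dots> = (\<Prod>i<n. emeasure lborel (A i))"
    proof (rule prod.cong[OF refl])
      fix i assume "i \<in> {..<n}"
      then have "emeasure lborel (A i) = emeasure (distr lborel borel ((+) (a i))) (A i)"
        by (simp add: lborel_distr_plus)
      also have "\<dots> = emeasure lborel ((+) (a i) -` A i)"
        using A \<open>i \<in> {..<n}\<close> by (subst emeasure_distr) auto
      finally show "emeasure lborel ((+) (a i) -` A i) = emeasure lborel (A i)" by simp
    qed
    finally show "emeasure (distr (cleb n) (cleb n) ?T) (Pi\<^sub>E {..<n} A) = (\<Prod>i<n. emeasure lborel (A i))" .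
  qed (auto simp: cleb_def)
  then have d: "distr (cleb n) (cleb n) ?T = cleb n" by (simp add: cleb_def)
  have f': "f \<in> borel_measurable (cleb n)" using f by (simp cong: measurable_cong_sets add: sets_cleb)
  have "(\<integral>\<^sup>+x. f x \<partial>cleb n) = (\<integral>\<^sup>+x. f x \<partial>distr (cleb n) (cleb n) ?T)" by (simp add: d)
  also have "\<dots> = (\<integral>\<^sup>+x. f (?T x) \<partial>cleb n)"
    by (intro nn_integral_distr T) (use f' in simp)
  finally show ?thesis by simp
qed

definition gdens :: "real \<Rightarrow> nat \<Rightarrow> (nat \<Rightarrow> real) \<Rightarrow> real" where
  "gdens \<sigma> n x = (\<Prod>i<n. normal_density 0 \<sigma> (x i))"

text \<open>The constant stays existential because only its independence of \<open>x\<close>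
  matters: points of equal norm have equal density.\<close>

lemma gdens_sqn:
  "\<exists>c. \<forall>x. gdens \<sigma> n x = c * exp (- sqn n x / (2 * \<sigma>\<^sup>2))"
proof -
  have "gdens \<sigma> n x = (1 / sqrt (2 * pi * \<sigma>\<^sup>2)) ^ n * exp (- sqn n x / (2 * \<sigma>\<^sup>2))" for x
  proof -
    have "gdens \<sigma> n x = (\<Prod>i<n. (1 / sqrt (2 * pi * \<sigma>\<^sup>2)) * exp (- (x i)\<^sup>2 / (2 * \<sigma>\<^sup>2)))"
      by (simp add: gdens_def normal_density_def)
    also have "\<dots> = (1 / sqrt (2 * pi * \<sigma>\<^sup>2)) ^ n * (\<Prod>i<n. exp (- (x i)\<^sup>2 / (2 * \<sigma>\<^sup>2)))"
      by (simp only: prod.distrib prod_constant card_lessThan)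
    also have "(\<Prod>i<n. exp (- (x i)\<^sup>2 / (2 * \<sigma>\<^sup>2))) = exp (- sqn n x / (2 * \<sigma>\<^sup>2))"
      by (subst exp_sum[symmetric]) (simp_all add: sqn_def sum_negf sum_divide_distrib)
    finally show ?thesis .
  qed
  then show ?thesis by blast
qed

lemma gdens_cong_sqn: "sqn n x = sqn n y \<Longrightarrow> gdens \<sigma> n x = gdens \<sigma> n y"
  using gdens_sqn[of \<sigma> n] by auto

lemma measurable_gdens [measurable]: "gdens \<sigma> n \<in> borel_measurable (PiM {..<n} (\<lambda>_. borel))"
  unfolding gdens_def by measurable

lemma noise_density: "\<sigma> > 0 \<Longrightarrow> noise \<sigma> n = density (cleb n) (gdens \<sigma> n)"
proof -
  assume s: "\<sigma> > 0"
  interpret l: product_sigma_finite "\<lambda>_::nat. lborel :: real measure"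
    by standard
  interpret g: prob_space "gauss \<sigma>" by (rule prob_gauss[OF s])
  interpret g: product_sigma_finite "\<lambda>_::nat. gauss \<sigma>"
    by standard
  have "density (cleb n) (gdens \<sigma> n) = PiM {..<n} (\<lambda>_. gauss \<sigma>)"
  proof (rule g.PiM_eqI)
    show "sets (density (cleb n) (gdens \<sigma> n)) = sets (PiM {..<n} (\<lambda>_. gauss \<sigma>))"
      using sets_noise[of \<sigma> n] by (simp add: sets_cleb noise_gauss)
    fix A :: "nat \<Rightarrow> real set" assume A: "\<And>i. i \<in> {..<n} \<Longrightarrow> A i \<in> sets (gauss \<sigma>)"
    then have A': "\<And>i. i \<in> {..<n} \<Longrightarrow> A i \<in> sets borel" by (simp add: sets_gauss)
    have P: "Pi\<^sub>E {..<n} A \<in> sets (cleb n)" unfolding cleb_def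
      using A' by (intro sets_PiM_I_finite) auto
    have "emeasure (density (cleb n) (gdens \<sigma> n)) (Pi\<^sub>E {..<n} A)
       = (\<integral>\<^sup>+x. ennreal (gdens \<sigma> n x) * indicator (Pi\<^sub>E {..<n} A) x \<partial>cleb n)"
      using P by (subst emeasure_density) auto
    also have "\<dots> = (\<integral>\<^sup>+x. (\<Prod>i<n. ennreal (normal_density 0 \<sigma> (x i)) * indicator (A i) (x i)) \<partial>cleb n)"
    proof (intro nn_integral_cong)
      fix x assume "x \<in> space (cleb n)"
      then have "(indicator (Pi\<^sub>E {..<n} A) x :: ennreal) = (\<Prod>i<n. indicator (A i) (x i))"
        by (auto simp: space_cleb PiE_def indicator_def Pi_def)
      then show "ennreal (gdens \<sigma> n x) * indicator (Pi\<^sub>E {..<n} A) x = (\<Prod>i<n. ennreal (normal_density 0 \<sigma> (x i)) * indicator (A i) (x i))"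
        by (simp add: gdens_def prod.distrib prod_ennreal)
    qed
    also have "\<dots> = (\<Prod>i<n. \<integral>\<^sup>+y. ennreal (normal_density 0 \<sigma> y) * indicator (A i) y \<partial>lborel)"
      unfolding cleb_def using A' by (intro l.product_nn_integral_prod) auto
    also have "\<dots> = (\<Prod>i<n. emeasure (gauss \<sigma>) (A i))"
      using A' by (intro prod.cong refl) (simp add: gauss_def emeasure_density)
    finally show "emeasure (density (cleb n) (gdens \<sigma> n)) (Pi\<^sub>E {..<n} A) = (\<Prod>i<n. emeasure (gauss \<sigma>) (A i))" .
  qed simp
  then show ?thesis by (simp add: noise_gauss)
qed

section \<open>Invariance of Lebesgue measure and of the noise under the change of basis\<close>

definition rot :: "(nat \<Rightarrow> nat \<Rightarrow> real) \<Rightarrow> nat \<Rightarrow> (nat \<Rightarrow> real) \<Rightarrow> nat \<Rightarrow> real" where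
  "rot Phi n v = restrict (coord Phi n v) {..<n}"

lemma measurable_coord [measurable]:
  "(\<lambda>v. coord Phi n v j) \<in> borel_measurable (PiM {..<n} (\<lambda>_. borel))"
  unfolding coord_def by measurable

lemma measurable_rot [measurable]:
  "rot Phi n \<in> measurable (PiM {..<n} (\<lambda>_. borel)) (PiM {..<n} (\<lambda>_. borel))"
  unfolding rot_def by measurable

lemma nn_integral_gdens: "\<sigma> > 0 \<Longrightarrow> (\<integral>\<^sup>+x. gdens \<sigma> n x \<partial>cleb n) = 1"
proof -
  assume s: "\<sigma> > 0"
  interpret prob_space "noise \<sigma> n" by (rule prob_noise[OF s])
  have "(\<integral>\<^sup>+x. gdens \<sigma> n x \<partial>cleb n) = emeasure (density (cleb n) (gdens \<sigma> n)) (space (cleb n))"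
    by (subst emeasure_density) (auto intro!: nn_integral_cong)
  also have "\<dots> = 1" using emeasure_space_1 unfolding noise_density[OF s, symmetric]
    by (simp add: space_noise space_cleb)
  finally show ?thesis .
qed

text \<open>Both \<open>cleb n\<close> and its image under the rotation are translation invariant; integrating
  \<open>f x * gdens (x - y)\<close> over the product of the two measures, in both orders, shows that they agree,
  because the density has the same mass under both.\<close>
lemma (in orthonormal_rows) nn_integral_cleb_rot:
  assumes f[measurable]: "f \<in> borel_measurable (PiM {..<n} (\<lambda>_. borel))"
  shows "(\<integral>\<^sup>+x. f (rot Phi n x) \<partial>cleb n) = (\<integral>\<^sup>+x. f x \<partial>cleb n)"
proof -
  interpret sigma_finite_measure "cleb n" by (rule sigma_finite_cleb)
  interpret pair_sigma_finite "cleb n" "cleb n" by unfold_locales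
  let ?h = "gdens 1 n"
  let ?pl = "\<lambda>x y::nat\<Rightarrow>real. restrict (\<lambda>i. x i + y i) {..<n}"
  let ?mi = "\<lambda>x y::nat\<Rightarrow>real. restrict (\<lambda>i. x i + - y i) {..<n}"
  have [measurable]: "(\<lambda>p. ?pl (fst p) (snd p)) \<in> measurable (cleb n \<Otimes>\<^sub>M cleb n) (PiM {..<n} (\<lambda>_. borel))"
    by measurable
  have [measurable]: "(\<lambda>p. ?mi (fst p) (snd p)) \<in> measurable (cleb n \<Otimes>\<^sub>M cleb n) (PiM {..<n} (\<lambda>_. borel))"
    by measurable
  have [simp]: "restrict (rot Phi n y) {..<n} = rot Phi n y" for y by (simp add: rot_def restrict_def fun_eq_iff)
  have add_rot: "?pl x (rot Phi n y) = rot Phi n (?pl (\<lambda>i. \<Sum>l<n. x l * Phi l i) y)" for x y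
    by (auto simp: rot_def fun_eq_iff coord_synth coord_add)
  \<comment> \<open>By Parseval, subtracting \<open>x\<close> after the rotation has the same norm
    as subtracting the vector \<open>?a\<close> with coefficients \<open>x\<close> before it. Hence
    the Gaussian bump centred at \<open>x\<close> has mass one under the rotated Lebesgue measure as
    well.\<close>
  have g1: "(\<integral>\<^sup>+y. ?h (?mi x (rot Phi n y)) \<partial>cleb n) = 1" for x
  proof -
    let ?a = "\<lambda>i. \<Sum>l<n. x l * Phi l i"
    have "?h (?mi x (rot Phi n y)) = ?h (?pl y (\<lambda>i. - ?a i))" for y
    proof (rule gdens_cong_sqn)
      have "sqn n (?pl y (\<lambda>i. - ?a i)) = (\<Sum>j<n. (coord Phi n y j - x j)\<^sup>2)"
        unfolding parseval by (simp add: coord_diff coord_synth)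
      also have "\<dots> = sqn n (?mi x (rot Phi n y))"
        by (simp add: sqn_def rot_def power2_commute)
      finally show "sqn n (?mi x (rot Phi n y)) = sqn n (?pl y (\<lambda>i. - ?a i))" by simp
    qed
    then have "(\<integral>\<^sup>+y. ?h (?mi x (rot Phi n y)) \<partial>cleb n) = (\<integral>\<^sup>+y. ?h (?pl y (\<lambda>i. - ?a i)) \<partial>cleb n)"
      by simp
    also have "\<dots> = (\<integral>\<^sup>+y. ?h y \<partial>cleb n)" by (rule nn_integral_cleb_translate) measurable
    finally show ?thesis by (simp add: nn_integral_gdens)
  qed
  have g2: "(\<integral>\<^sup>+x. ?h x \<partial>cleb n) = 1" by (simp add: nn_integral_gdens)
  have [measurable]: "(\<lambda>p. f (?pl (fst p) (rot Phi n (snd p)))) \<in> borel_measurable (cleb n \<Otimes>\<^sub>M cleb n)"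
    "(\<lambda>p. f (?pl (fst p) (snd p))) \<in> borel_measurable (cleb n \<Otimes>\<^sub>M cleb n)"
    "(\<lambda>p. ?h (?mi (fst p) (rot Phi n (snd p)))) \<in> borel_measurable (cleb n \<Otimes>\<^sub>M cleb n)"
    by measurable
  \<comment> \<open>A factor one, the mass of \<open>?h\<close>, is inserted. Its variable
    \<open>x\<close> then serves as a translation, under which the inner integral does not
    change.\<close>
  have "(\<integral>\<^sup>+x. f (rot Phi n x) \<partial>cleb n) = (\<integral>\<^sup>+x. ?h x * (\<integral>\<^sup>+y. f (rot Phi n y) \<partial>cleb n) \<partial>cleb n)"
    by (subst nn_integral_multc) (auto simp: g2)
  also have "\<dots> = (\<integral>\<^sup>+x. ?h x * (\<integral>\<^sup>+y. f (?pl x (rot Phi n y)) \<partial>cleb n) \<partial>cleb n)"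
  proof (rule nn_integral_cong, rule arg_cong2[where f="(*)"], rule refl)
    fix x
    have "(\<integral>\<^sup>+y. f (?pl x (rot Phi n y)) \<partial>cleb n)
      = (\<integral>\<^sup>+y. f (rot Phi n (?pl y (\<lambda>i. \<Sum>l<n. x l * Phi l i))) \<partial>cleb n)"
      unfolding add_rot by (simp add: add.commute)
    also have "\<dots> = (\<integral>\<^sup>+y. f (rot Phi n y) \<partial>cleb n)"
      by (rule nn_integral_cleb_translate[where f="\<lambda>y. f (rot Phi n y)"]) measurable
    finally show "(\<integral>\<^sup>+y. f (rot Phi n y) \<partial>cleb n) = (\<integral>\<^sup>+y. f (?pl x (rot Phi n y)) \<partial>cleb n)" by simp
  qed
  also have "\<dots> = (\<integral>\<^sup>+x. (\<integral>\<^sup>+y. ?h x * f (?pl x (rot Phi n y)) \<partial>cleb n) \<partial>cleb n)"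
    by (subst nn_integral_cmult) auto
  also have "\<dots> = (\<integral>\<^sup>+y. (\<integral>\<^sup>+x. ?h x * f (?pl x (rot Phi n y)) \<partial>cleb n) \<partial>cleb n)"
    by (rule Fubini') measurable
  \<comment> \<open>Translating \<open>x\<close> by the rotated \<open>y\<close> moves the offset
    from \<open>f\<close> to the density. After one more exchange of the integrals,
    \<open>g1\<close> integrates the density away and only \<open>f\<close> is left.\<close>
  also have "\<dots> = (\<integral>\<^sup>+y. (\<integral>\<^sup>+x. ?h (?mi x (rot Phi n y)) * f x \<partial>cleb n) \<partial>cleb n)"
  proof (rule nn_integral_cong)
    fix y
    let ?r = "rot Phi n y"
    have "(\<integral>\<^sup>+x. ?h (?mi x ?r) * f x \<partial>cleb n) = (\<integral>\<^sup>+x. ?h (?mi (?pl x ?r) ?r) * f (?pl x ?r) \<partial>cleb n)"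
      by (rule nn_integral_cleb_translate[symmetric, where f="\<lambda>x. ?h (?mi x ?r) * f x"]) measurable
    also have "\<dots> = (\<integral>\<^sup>+x. ?h x * f (?pl x ?r) \<partial>cleb n)"
      by (intro nn_integral_cong arg_cong2[where f="(*)"] arg_cong[where f=ennreal] refl gdens_cong_sqn) (simp add: sqn_def)
    finally show "(\<integral>\<^sup>+x. ?h x * f (?pl x ?r) \<partial>cleb n) = (\<integral>\<^sup>+x. ?h (?mi x ?r) * f x \<partial>cleb n)" ..
  qed
  also have "\<dots> = (\<integral>\<^sup>+x. (\<integral>\<^sup>+y. ?h (?mi x (rot Phi n y)) * f x \<partial>cleb n) \<partial>cleb n)"
    by (rule Fubini') measurable
  also have "\<dots> = (\<integral>\<^sup>+x. f x \<partial>cleb n)"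
    by (intro nn_integral_cong) (simp add: nn_integral_multc g1[simplified])
  finally show ?thesis .
qed

lemma (in orthonormal_rows) nn_integral_noise_rot:
  assumes s: "\<sigma> > 0" and f[measurable]: "f \<in> borel_measurable (PiM {..<n} (\<lambda>_. borel))"
  shows "(\<integral>\<^sup>+x. f (rot Phi n x) \<partial>noise \<sigma> n) = (\<integral>\<^sup>+x. f x \<partial>noise \<sigma> n)"
proof -
  have "gdens \<sigma> n (rot Phi n x) = gdens \<sigma> n x" for x
    by (rule gdens_cong_sqn) (simp add: parseval[of x], simp add: sqn_def rot_def)
  then have "(\<integral>\<^sup>+x. f (rot Phi n x) \<partial>noise \<sigma> n) = (\<integral>\<^sup>+x. gdens \<sigma> n (rot Phi n x) * f (rot Phi n x) \<partial>cleb n)"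
    unfolding noise_density[OF s] by (subst nn_integral_density) auto
  also have "\<dots> = (\<integral>\<^sup>+x. gdens \<sigma> n x * f x \<partial>cleb n)"
    by (rule nn_integral_cleb_rot[where f="\<lambda>x. gdens \<sigma> n x * f x"]) measurable
  also have "\<dots> = (\<integral>\<^sup>+x. f x \<partial>noise \<sigma> n)"
    unfolding noise_density[OF s] by (subst nn_integral_density) auto
  finally show ?thesis .
qed

section \<open>Gaussian moments and Bayes risk\<close>

text \<open>Degree four covers both squares that are needed: that of a linear form in the noise, and
  that of the centred \<open>z\<^sup>2 - \<sigma>\<^sup>2\<close> with an offset.\<close>

lemma gauss_quartic:
  assumes s[arith]: "\<sigma> > 0"
  shows "has_bochner_integral (gauss \<sigma>) (\<lambda>z. p0 + p1 * z + p2 * z\<^sup>2 + p3 * z ^ 3 + p4 * z ^ 4)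
     (p0 + p2 * \<sigma>\<^sup>2 + 3 * p4 * \<sigma> ^ 4)"
proof -
  let ?d = "normal_density 0 \<sigma>"
  have m0: "has_bochner_integral lborel (\<lambda>z. ?d z * z ^ 0) 1"
    using normal_moment_even[OF s, of 0 0] by simp
  have m2: "has_bochner_integral lborel (\<lambda>z. ?d z * z ^ 2) (\<sigma>\<^sup>2)"
    using normal_moment_even[OF s, of 0 1] by simp
  have m4: "has_bochner_integral lborel (\<lambda>z. ?d z * z ^ 4) (3 * \<sigma> ^ 4)"
    using normal_moment_even[OF s, of 0 2] by (simp add: fact_numeral field_simps power_divide)
  have m1: "has_bochner_integral lborel (\<lambda>z. ?d z * z) 0"
    using normal_moment_odd[OF s, of 0 0] by simp
  have m3: "has_bochner_integral lborel (\<lambda>z. ?d z * z ^ 3) 0"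
    using normal_moment_odd[OF s, of 0 1] by (simp add: numeral_3_eq_3)
  have "has_bochner_integral lborel
     (\<lambda>z. p0 * (?d z * z ^ 0) + p1 * (?d z * z) + p2 * (?d z * z ^ 2) + p3 * (?d z * z ^ 3) + p4 * (?d z * z ^ 4))
     (p0 * 1 + p1 * 0 + p2 * \<sigma>\<^sup>2 + p3 * 0 + p4 * (3 * \<sigma> ^ 4))"
    by (intro has_bochner_integral_add has_bochner_integral_mult_right m0 m1 m2 m3 m4)
  then show ?thesis
    unfolding gauss_def
    by (subst has_bochner_integral_density) (auto simp: algebra_simps)
qed

lemma nn_gauss_lin_sq:
  assumes s: "\<sigma> > 0"
  shows "(\<integral>\<^sup>+z. ennreal ((m * z + c)\<^sup>2) \<partial>gauss \<sigma>) = ennreal (m\<^sup>2 * \<sigma>\<^sup>2 + c\<^sup>2)"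
proof -
  have "has_bochner_integral (gauss \<sigma>) (\<lambda>z. (m * z + c)\<^sup>2) (m\<^sup>2 * \<sigma>\<^sup>2 + c\<^sup>2)"
    using gauss_quartic[OF s, of "c\<^sup>2" "2 * m * c" "m\<^sup>2" 0 0]
    by (simp add: power2_eq_square algebra_simps)
  then show ?thesis by (auto simp: has_bochner_integral_iff nn_integral_eq_integral)
qed

lemma nn_gauss_quad_sq:
  assumes s: "\<sigma> > 0"
  shows "(\<integral>\<^sup>+z. ennreal ((z\<^sup>2 - \<sigma>\<^sup>2 + c)\<^sup>2) \<partial>gauss \<sigma>) = ennreal (2 * \<sigma> ^ 4 + c\<^sup>2)"
proof -
  have "has_bochner_integral (gauss \<sigma>) (\<lambda>z. (z\<^sup>2 - \<sigma>\<^sup>2 + c)\<^sup>2) (2 * \<sigma> ^ 4 + c\<^sup>2)"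
    using gauss_quartic[OF s, of "(c - \<sigma>\<^sup>2)\<^sup>2" 0 "2 * (c - \<sigma>\<^sup>2)" 0 1]
    by (simp add: power2_eq_square power4_eq_xxxx algebra_simps)
  then show ?thesis by (auto simp: has_bochner_integral_iff nn_integral_eq_integral)
qed

text \<open>Variances of independent centred variables add. A nonnegative integral cannot say that a
  mean is zero; having the hypothesis for every offset \<open>c\<close> expresses exactly that. It
  also drives the induction, where the sum over the other coordinates is an offset for the new
  one.\<close>

lemma nn_integral_sum_sq:
  assumes "finite I" and M: "prob_space M" and h: "\<And>i. i \<in> I \<Longrightarrow> h i \<in> borel_measurable M"
    and v: "\<And>i. i \<in> I \<Longrightarrow> v i \<ge> (0::real)"
    and sq: "\<And>i c. i \<in> I \<Longrightarrow> (\<integral>\<^sup>+z. ennreal ((h i z + c)\<^sup>2) \<partial>M) = ennreal (v i + c\<^sup>2)"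
  shows "(\<integral>\<^sup>+x. ennreal (((\<Sum>i\<in>I. h i (x i)) + c)\<^sup>2) \<partial>PiM I (\<lambda>_. M)) = ennreal ((\<Sum>i\<in>I. v i) + c\<^sup>2)"
  using assms(1) h v sq
proof (induction I arbitrary: c)
  case empty
  then show ?case by (simp add: space_PiM)
next
  case (insert i I)
  interpret M: prob_space M by fact
  interpret product_sigma_finite "\<lambda>_. M" by standard
  interpret P: prob_space "PiM I (\<lambda>_. M)" by (rule prob_space_PiM) (rule M)
  note insert.prems(1)[measurable]
  have "(\<integral>\<^sup>+x. ennreal (((\<Sum>i\<in>insert i I. h i (x i)) + c)\<^sup>2) \<partial>PiM (insert i I) (\<lambda>_. M))
    = (\<integral>\<^sup>+x. \<integral>\<^sup>+y. ennreal (((\<Sum>j\<in>insert i I. h j ((x(i := y)) j)) + c)\<^sup>2) \<partial>M \<partial>PiM I (\<lambda>_. M))"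
    using insert.hyps by (intro product_nn_integral_insert) measurable
  also have "\<dots> = (\<integral>\<^sup>+x. \<integral>\<^sup>+y. ennreal ((h i y + ((\<Sum>j\<in>I. h j (x j)) + c))\<^sup>2) \<partial>M \<partial>PiM I (\<lambda>_. M))"
  proof -
    have "(\<Sum>j\<in>insert i I. h j ((x(i := y)) j)) = h i y + (\<Sum>j\<in>I. h j (x j))" for x y
      using insert.hyps by (simp add: sum.insert) (intro sum.cong refl, auto)
    then show ?thesis by (simp add: add.assoc)
  qed
  also have "\<dots> = (\<integral>\<^sup>+x. ennreal (v i) + ennreal (((\<Sum>j\<in>I. h j (x j)) + c)\<^sup>2) \<partial>PiM I (\<lambda>_. M))"
    using insert.prems by (simp add: ennreal_plus)
  also have "\<dots> = ennreal (v i) + (\<integral>\<^sup>+x. ennreal (((\<Sum>j\<in>I. h j (x j)) + c)\<^sup>2) \<partial>PiM I (\<lambda>_. M))"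
    by (subst nn_integral_add) (auto simp: P.emeasure_space_1)
  also have "(\<integral>\<^sup>+x. ennreal (((\<Sum>j\<in>I. h j (x j)) + c)\<^sup>2) \<partial>PiM I (\<lambda>_. M)) = ennreal ((\<Sum>i\<in>I. v i) + c\<^sup>2)"
    using insert.prems by (intro insert.IH) auto
  also have "ennreal (v i) + \<dots> = ennreal ((\<Sum>i\<in>insert i I. v i) + c\<^sup>2)"
    using insert by (subst ennreal_plus[symmetric]) (auto simp: sum_nonneg algebra_simps)
  finally show ?case .
qed

lemma nn_noise_lin_sq:
  assumes s: "\<sigma> > 0" and J: "J \<subseteq> {..<n}"
  shows "(\<integral>\<^sup>+z. ennreal ((\<Sum>j\<in>J. m j * z j)\<^sup>2) \<partial>noise \<sigma> n) = ennreal (\<sigma>\<^sup>2 * (\<Sum>j\<in>J. (m j)\<^sup>2))"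
proof -
  interpret prob_space "gauss \<sigma>" by (rule prob_gauss[OF s])
  let ?m = "\<lambda>j. if j \<in> J then m j else 0"
  have J': "{..<n} \<inter> J = J" using J by auto
  have "(\<integral>\<^sup>+z. ennreal (((\<Sum>j<n. ?m j * z j) + 0)\<^sup>2) \<partial>noise \<sigma> n) = ennreal ((\<Sum>j<n. (?m j)\<^sup>2 * \<sigma>\<^sup>2) + 0\<^sup>2)"
    unfolding noise_gauss
    by (rule nn_integral_sum_sq) (auto simp: prob_gauss s nn_gauss_lin_sq)
  moreover have "(\<Sum>j<n. ?m j * z j) = (\<Sum>j\<in>J. m j * z j)" for z :: "nat \<Rightarrow> real"
    by (simp add: if_distrib[where f="\<lambda>x. x * _"] J' flip: sum.inter_restrict cong: if_cong)
  moreover have "(\<Sum>j<n. (?m j)\<^sup>2 * \<sigma>\<^sup>2) = (\<Sum>j\<in>J. (m j)\<^sup>2 * \<sigma>\<^sup>2)"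
    using J by (intro sum.mono_neutral_cong_right) auto
  ultimately show ?thesis by (simp add: sum_distrib_left mult.commute)
qed

lemma nn_noise_quad_sq:
  assumes s: "\<sigma> > 0" and J: "J \<subseteq> {..<n}"
  shows "(\<integral>\<^sup>+z. ennreal ((\<Sum>j\<in>J. (z j)\<^sup>2 - \<sigma>\<^sup>2)\<^sup>2) \<partial>noise \<sigma> n) = ennreal (2 * \<sigma> ^ 4 * real (card J))"
proof -
  interpret prob_space "gauss \<sigma>" by (rule prob_gauss[OF s])
  let ?h = "\<lambda>j z. if j \<in> J then z\<^sup>2 - \<sigma>\<^sup>2 else 0"
  let ?v = "\<lambda>j. if j \<in> J then 2 * \<sigma> ^ 4 else 0"
  have "(\<integral>\<^sup>+z. ennreal (((\<Sum>j<n. ?h j (z j)) + 0)\<^sup>2) \<partial>noise \<sigma> n) = ennreal ((\<Sum>j<n. ?v j) + 0\<^sup>2)"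
    unfolding noise_gauss
    by (rule nn_integral_sum_sq) (use emeasure_space_1 in \<open>auto simp: prob_gauss s nn_gauss_quad_sq\<close>)
  moreover have "(\<Sum>j<n. ?h j (z j)) = (\<Sum>j\<in>J. (z j)\<^sup>2 - \<sigma>\<^sup>2)" for z :: "nat \<Rightarrow> real"
    using J by (intro sum.mono_neutral_cong_right) auto
  moreover have "(\<Sum>j<n. ?v j) = (\<Sum>j\<in>J. 2 * \<sigma> ^ 4)"
    using J by (intro sum.mono_neutral_cong_right) auto
  ultimately show ?thesis by (simp add: mult.commute)
qed

section \<open>Bayes risk of a Gaussian prior\<close>

lemma normal_density_mult:
  "normal_density 0 a x * normal_density 0 c y
     = 1 / (sqrt (2 * pi * a\<^sup>2) * sqrt (2 * pi * c\<^sup>2)) * exp (- (x\<^sup>2 / a\<^sup>2 + y\<^sup>2 / c\<^sup>2) / 2)"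
proof -
  have "- (x\<^sup>2 / a\<^sup>2 + y\<^sup>2 / c\<^sup>2) / 2 = - x\<^sup>2 / (2 * a\<^sup>2) + - y\<^sup>2 / (2 * c\<^sup>2)"
    by (simp add: add_divide_distrib diff_divide_distrib)
  then have "exp (- (x\<^sup>2 / a\<^sup>2 + y\<^sup>2 / c\<^sup>2) / 2) = exp (- x\<^sup>2 / (2 * a\<^sup>2)) * exp (- y\<^sup>2 / (2 * c\<^sup>2))"
    by (simp only: exp_add)
  then show ?thesis by (simp add: normal_density_def)
qed

text \<open>The joint density of the parameter and the observation
  \<open>x = \<tau> * \<xi> + z\<close> factors into marginal times posterior: \<open>v\<close> is
  the marginal standard deviation, \<open>b * x\<close> the posterior mean of \<xi> and
  \<open>w\<close> its posterior standard deviation. The identity of the exponents is a completed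
  square.\<close>

lemma gauss_product_density:
  fixes \<tau> s x \<xi> :: real
  assumes s: "s > 0"
  defines "v \<equiv> sqrt (\<tau>\<^sup>2 + s\<^sup>2)" and "w \<equiv> s / sqrt (\<tau>\<^sup>2 + s\<^sup>2)" and "b \<equiv> \<tau> / (\<tau>\<^sup>2 + s\<^sup>2)"
  shows "normal_density 0 1 \<xi> * normal_density 0 s (x - \<tau> * \<xi>) = normal_density 0 v x * normal_density 0 w (\<xi> - b * x)"
proof -
  have p: "\<tau>\<^sup>2 + s\<^sup>2 > 0" using s by (simp add: add_nonneg_pos)
  have v2: "v\<^sup>2 = \<tau>\<^sup>2 + s\<^sup>2" and w2: "w\<^sup>2 = s\<^sup>2 / (\<tau>\<^sup>2 + s\<^sup>2)"
    using p by (auto simp: v_def w_def power_divide)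
  have e: "\<xi>\<^sup>2 + (x - \<tau> * \<xi>)\<^sup>2 / s\<^sup>2 = x\<^sup>2 / v\<^sup>2 + (\<xi> - b * x)\<^sup>2 / w\<^sup>2"
  proof -
    define D where "D = \<tau>\<^sup>2 + s\<^sup>2"
    have D: "D > 0" using p by (simp add: D_def)
    have bb: "b = \<tau> / D" by (simp add: b_def D_def)
    have "x\<^sup>2 / v\<^sup>2 + (\<xi> - b * x)\<^sup>2 / w\<^sup>2 = x\<^sup>2 / D + (\<xi> - \<tau> / D * x)\<^sup>2 * D / s\<^sup>2"
      by (simp add: v2 w2 bb flip: D_def)
    also have "\<xi> - \<tau> / D * x = (D * \<xi> - \<tau> * x) / D"
      using D by (simp add: field_simps)
    also have "x\<^sup>2 / D + ((D * \<xi> - \<tau> * x) / D)\<^sup>2 * D / s\<^sup>2 = x\<^sup>2 / D + (D * \<xi> - \<tau> * x)\<^sup>2 / (D * s\<^sup>2)"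
      using D by (simp add: power_divide power2_eq_square)
    also have "\<dots> = (x\<^sup>2 * s\<^sup>2 + (D * \<xi> - \<tau> * x)\<^sup>2) / (D * s\<^sup>2)"
      using D s by (simp add: field_simps)
    also have "x\<^sup>2 * s\<^sup>2 + (D * \<xi> - \<tau> * x)\<^sup>2 = D * (\<xi>\<^sup>2 * s\<^sup>2 + (x - \<tau> * \<xi>)\<^sup>2)"
      unfolding D_def by (simp add: power2_eq_square algebra_simps)
    also have "\<dots> / (D * s\<^sup>2) = \<xi>\<^sup>2 + (x - \<tau> * \<xi>)\<^sup>2 / s\<^sup>2"
      using D s by (simp add: field_simps)
    finally show ?thesis ..
  qed
  have "normal_density 0 1 \<xi> * normal_density 0 s (x - \<tau> * \<xi>)
     = 1 / (sqrt (2 * pi * 1\<^sup>2) * sqrt (2 * pi * s\<^sup>2)) * exp (- (\<xi>\<^sup>2 / 1\<^sup>2 + (x - \<tau> * \<xi>)\<^sup>2 / s\<^sup>2) / 2)"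
    by (rule normal_density_mult)
  also have "sqrt (2 * pi * 1\<^sup>2) * sqrt (2 * pi * s\<^sup>2) = sqrt (2 * pi * v\<^sup>2) * sqrt (2 * pi * w\<^sup>2)"
    using p by (simp add: v2 w2 flip: real_sqrt_mult)
  also have "\<xi>\<^sup>2 / 1\<^sup>2 + (x - \<tau> * \<xi>)\<^sup>2 / s\<^sup>2 = x\<^sup>2 / v\<^sup>2 + (\<xi> - b * x)\<^sup>2 / w\<^sup>2"
    using e by simp
  also have "1 / (sqrt (2 * pi * v\<^sup>2) * sqrt (2 * pi * w\<^sup>2)) * exp (- (x\<^sup>2 / v\<^sup>2 + (\<xi> - b * x)\<^sup>2 / w\<^sup>2) / 2)
     = normal_density 0 v x * normal_density 0 w (\<xi> - b * x)"
    by (rule normal_density_mult[symmetric])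
  finally show ?thesis .
qed

text \<open>Posterior risk of the guess \<open>c\<close>: posterior variance plus a squared bias,
  which is dropped.\<close>

lemma nn_integral_normal_shift_ge:
  assumes w: "w > 0"
  shows "(\<integral>\<^sup>+\<xi>. ennreal (normal_density 0 w (\<xi> - a) * (c - \<tau> * \<xi>)\<^sup>2) \<partial>lborel) \<ge> ennreal (\<tau>\<^sup>2 * w\<^sup>2)"
proof -
  have "(\<integral>\<^sup>+\<xi>. ennreal (normal_density 0 w (\<xi> - a) * (c - \<tau> * \<xi>)\<^sup>2) \<partial>lborel)
     = (\<integral>\<^sup>+\<xi>. ennreal (normal_density 0 w \<xi> * (c - \<tau> * (a + \<xi>))\<^sup>2) \<partial>lborel)"
    by (subst nn_integral_real_affine[where t=a and c=1]) auto
  also have "\<dots> = (\<integral>\<^sup>+\<xi>. ennreal (((- \<tau>) * \<xi> + (c - \<tau> * a))\<^sup>2) \<partial>gauss w)"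
    unfolding gauss_def
    by (subst nn_integral_density) (auto intro!: nn_integral_cong simp: ennreal_mult' algebra_simps)
  also have "\<dots> = ennreal (\<tau>\<^sup>2 * w\<^sup>2 + (c - \<tau> * a)\<^sup>2)"
    by (subst nn_gauss_lin_sq[OF w]) simp
  finally show ?thesis by (simp add: ennreal_leI)
qed

text \<open>Writing the prior as \<tau> times a standard normal variable lets \<tau> = 0 through
  without a degenerate density. This case occurs, since the least favourable sequence of an
  ellipsoid vanishes at high frequencies.\<close>

lemma bayes_risk_1d:
  assumes s: "s > 0" and h[measurable]: "h \<in> borel_measurable borel"
  shows "ennreal (\<tau>\<^sup>2 * s\<^sup>2 / (\<tau>\<^sup>2 + s\<^sup>2)) \<le>
    (\<integral>\<^sup>+\<xi>. \<integral>\<^sup>+z. ennreal ((h (\<tau> * \<xi> + z) - \<tau> * \<xi>)\<^sup>2) \<partial>gauss s \<partial>gauss 1)"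
proof -
  define v where "v = sqrt (\<tau>\<^sup>2 + s\<^sup>2)"
  define w where "w = s / sqrt (\<tau>\<^sup>2 + s\<^sup>2)"
  define b where "b = \<tau> / (\<tau>\<^sup>2 + s\<^sup>2)"
  have p: "\<tau>\<^sup>2 + s\<^sup>2 > 0" using s by (simp add: add_nonneg_pos)
  have v: "v > 0" and w: "w > 0" using s p by (auto simp: v_def w_def)
  have "(\<integral>\<^sup>+\<xi>. \<integral>\<^sup>+z. ennreal ((h (\<tau> * \<xi> + z) - \<tau> * \<xi>)\<^sup>2) \<partial>gauss s \<partial>gauss 1)
    = (\<integral>\<^sup>+\<xi>. ennreal (normal_density 0 1 \<xi>) * (\<integral>\<^sup>+z. ennreal (normal_density 0 s z) * ennreal ((h (\<tau> * \<xi> + z) - \<tau> * \<xi>)\<^sup>2) \<partial>lborel) \<partial>lborel)"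
    unfolding gauss_def by (simp add: nn_integral_density)
  also have "\<dots> = (\<integral>\<^sup>+\<xi>. ennreal (normal_density 0 1 \<xi>) * (\<integral>\<^sup>+x. ennreal (normal_density 0 s (x - \<tau> * \<xi>)) * ennreal ((h x - \<tau> * \<xi>)\<^sup>2) \<partial>lborel) \<partial>lborel)"
  proof (rule nn_integral_cong, rule arg_cong2[where f="(*)"], rule refl)
    fix \<xi> :: real
    show "(\<integral>\<^sup>+z. ennreal (normal_density 0 s z) * ennreal ((h (\<tau> * \<xi> + z) - \<tau> * \<xi>)\<^sup>2) \<partial>lborel)
      = (\<integral>\<^sup>+x. ennreal (normal_density 0 s (x - \<tau> * \<xi>)) * ennreal ((h x - \<tau> * \<xi>)\<^sup>2) \<partial>lborel)"
      by (subst (2) nn_integral_real_affine[where t="\<tau> * \<xi>" and c=1]) (auto simp: add.commute)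
  qed
  also have "\<dots> = (\<integral>\<^sup>+\<xi>. \<integral>\<^sup>+x. ennreal (normal_density 0 v x) * ennreal (normal_density 0 w (\<xi> - b * x) * (h x - \<tau> * \<xi>)\<^sup>2) \<partial>lborel \<partial>lborel)"
    by (subst nn_integral_cmult[symmetric]) (auto intro!: nn_integral_cong simp: ennreal_mult'[symmetric] mult.assoc[symmetric]
        gauss_product_density[OF s] v_def w_def b_def)
  also have "\<dots> = (\<integral>\<^sup>+x. \<integral>\<^sup>+\<xi>. ennreal (normal_density 0 v x) * ennreal (normal_density 0 w (\<xi> - b * x) * (h x - \<tau> * \<xi>)\<^sup>2) \<partial>lborel \<partial>lborel)"
    by (rule lborel_pair.Fubini') measurable
  also have "\<dots> = (\<integral>\<^sup>+x. ennreal (normal_density 0 v x) * (\<integral>\<^sup>+\<xi>. ennreal (normal_density 0 w (\<xi> - b * x) * (h x - \<tau> * \<xi>)\<^sup>2) \<partial>lborel) \<partial>lborel)"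
    by (subst nn_integral_cmult) auto
  also have "\<dots> \<ge> (\<integral>\<^sup>+x. ennreal (normal_density 0 v x) * ennreal (\<tau>\<^sup>2 * w\<^sup>2) \<partial>lborel)"
    by (intro nn_integral_mono mult_left_mono nn_integral_normal_shift_ge w) simp
  also have "(\<integral>\<^sup>+x. ennreal (normal_density 0 v x) * ennreal (\<tau>\<^sup>2 * w\<^sup>2) \<partial>lborel) = ennreal (\<tau>\<^sup>2 * w\<^sup>2)"
  proof -
    interpret prob_space "gauss v" by (rule prob_gauss[OF v])
    have "(\<integral>\<^sup>+x. ennreal (normal_density 0 v x) * ennreal (\<tau>\<^sup>2 * w\<^sup>2) \<partial>lborel) = (\<integral>\<^sup>+x. ennreal (\<tau>\<^sup>2 * w\<^sup>2) \<partial>gauss v)"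
      unfolding gauss_def by (subst nn_integral_density) auto
    also have "\<dots> = ennreal (\<tau>\<^sup>2 * w\<^sup>2)" using emeasure_space_1 by simp
    finally show ?thesis .
  qed
  also have "\<tau>\<^sup>2 * w\<^sup>2 = \<tau>\<^sup>2 * s\<^sup>2 / (\<tau>\<^sup>2 + s\<^sup>2)" using p by (simp add: w_def power_divide)
  finally show ?thesis .
qed

text \<open>With all other coordinates of prior and noise frozen, \<open>h\<close> is an estimator
  of one real parameter and \<open>bayes_risk_1d\<close> applies. The remainder moves coordinate
  \<open>j\<close> of both measures to the inside by Fubini.\<close>

lemma bayes_risk_coordinate:
  assumes s: "s > 0" and j: "j < n" and h[measurable]: "h \<in> borel_measurable (PiM {..<n} (\<lambda>_. borel))"
  shows "ennreal ((\<tau> j)\<^sup>2 * s\<^sup>2 / ((\<tau> j)\<^sup>2 + s\<^sup>2)) \<le>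
    (\<integral>\<^sup>+\<xi>. \<integral>\<^sup>+z. ennreal ((h (restrict (\<lambda>i. \<tau> i * \<xi> i + z i) {..<n}) - \<tau> j * \<xi> j)\<^sup>2) \<partial>noise s n \<partial>noise 1 n)"
proof -
  define J where "J = {..<n} - {j}"
  have I: "{..<n} = insert j J" and J: "finite J" "j \<notin> J" using j by (auto simp: J_def)
  interpret g1: prob_space "gauss 1" by (rule prob_gauss) simp
  interpret gs: prob_space "gauss s" by (rule prob_gauss[OF s])
  interpret p1: product_sigma_finite "\<lambda>_::nat. gauss 1" by standard
  interpret ps: product_sigma_finite "\<lambda>_::nat. gauss s" by standard
  interpret P1: prob_space "PiM J (\<lambda>_. gauss 1)" by (intro prob_space_PiM g1.prob_space_axioms)
  interpret Ps: prob_space "PiM J (\<lambda>_. gauss s)" by (intro prob_space_PiM gs.prob_space_axioms)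
  interpret pair_sigma_finite "gauss 1" "PiM J (\<lambda>_. gauss s)" ..
  let ?pl = "\<lambda>\<xi> z. restrict (\<lambda>i. \<tau> i * \<xi> i + z i) (insert j J)"
  let ?F = "\<lambda>\<xi> z. ennreal ((h (?pl \<xi> z) - \<tau> j * \<xi> j)\<^sup>2)"
  have h'[measurable]: "h \<in> borel_measurable (PiM (insert j J) (\<lambda>_. borel))" using h by (simp add: I)
  have upd[measurable]: "(\<lambda>u. w(j := u)) \<in> measurable borel (PiM (insert j J) (\<lambda>_. borel :: real measure))"
    if "w \<in> extensional (insert j J)" for w :: "nat \<Rightarrow> real"
    using that by (intro measurable_PiM_single') (auto simp: space_PiM PiE_def extensional_def)
  have inner: "ennreal ((\<tau> j)\<^sup>2 * s\<^sup>2 / ((\<tau> j)\<^sup>2 + s\<^sup>2)) \<le> (\<integral>\<^sup>+x. \<integral>\<^sup>+y. ?F (\<xi>(j := x)) (z(j := y)) \<partial>gauss s \<partial>gauss 1)" for \<xi> z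
  proof -
    have e: "?pl (\<xi>(j := x)) (z(j := y)) = (?pl \<xi> z)(j := \<tau> j * x + y)" for x y
      by (auto simp: fun_eq_iff)
    have "(\<lambda>u. h ((?pl \<xi> z)(j := u))) \<in> borel_measurable borel"
      using measurable_compose[OF upd h', of "?pl \<xi> z"] by simp
    from bayes_risk_1d[OF s this, of "\<tau> j"] show ?thesis unfolding e by simp
  qed
  have "ennreal ((\<tau> j)\<^sup>2 * s\<^sup>2 / ((\<tau> j)\<^sup>2 + s\<^sup>2)) =
    (\<integral>\<^sup>+\<xi>. \<integral>\<^sup>+z. ennreal ((\<tau> j)\<^sup>2 * s\<^sup>2 / ((\<tau> j)\<^sup>2 + s\<^sup>2)) \<partial>PiM J (\<lambda>_. gauss s) \<partial>PiM J (\<lambda>_. gauss 1))"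
    by (simp add: P1.emeasure_space_1 Ps.emeasure_space_1)
  also have "\<dots> \<le> (\<integral>\<^sup>+\<xi>. \<integral>\<^sup>+z. \<integral>\<^sup>+x. \<integral>\<^sup>+y. ?F (\<xi>(j := x)) (z(j := y)) \<partial>gauss s \<partial>gauss 1 \<partial>PiM J (\<lambda>_. gauss s) \<partial>PiM J (\<lambda>_. gauss 1))"
    by (intro nn_integral_mono inner)
  also have "\<dots> = (\<integral>\<^sup>+\<xi>. \<integral>\<^sup>+x. \<integral>\<^sup>+z. \<integral>\<^sup>+y. ?F (\<xi>(j := x)) (z(j := y)) \<partial>gauss s \<partial>PiM J (\<lambda>_. gauss s) \<partial>gauss 1 \<partial>PiM J (\<lambda>_. gauss 1))"
  proof (rule nn_integral_cong)
    fix \<xi> assume "\<xi> \<in> space (PiM J (\<lambda>_. gauss 1))"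
    show "(\<integral>\<^sup>+z. \<integral>\<^sup>+x. \<integral>\<^sup>+y. ?F (\<xi>(j := x)) (z(j := y)) \<partial>gauss s \<partial>gauss 1 \<partial>PiM J (\<lambda>_. gauss s))
       = (\<integral>\<^sup>+x. \<integral>\<^sup>+z. \<integral>\<^sup>+y. ?F (\<xi>(j := x)) (z(j := y)) \<partial>gauss s \<partial>PiM J (\<lambda>_. gauss s) \<partial>gauss 1)"
    proof (rule Fubini')
      have "(\<lambda>p. ?pl (\<xi>(j := fst (fst p))) ((snd (fst p))(j := snd p))) \<in> measurable ((gauss 1 \<Otimes>\<^sub>M PiM J (\<lambda>_. gauss s)) \<Otimes>\<^sub>M gauss s) (PiM (insert j J) (\<lambda>_. borel))"
      proof (rule measurable_restrict)
        fix i assume i: "i \<in> insert j J"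
        show "(\<lambda>p. \<tau> i * (\<xi>(j := fst (fst p))) i + ((snd (fst p))(j := snd p)) i) \<in> measurable ((gauss 1 \<Otimes>\<^sub>M PiM J (\<lambda>_. gauss s)) \<Otimes>\<^sub>M gauss s) borel"
        proof (cases "i = j")
          case True
          then show ?thesis by simp
        next
          case False
          then have "i \<in> J" using i by simp
          then have [measurable]: "(\<lambda>p. snd (fst p) i) \<in> measurable ((gauss 1 \<Otimes>\<^sub>M PiM J (\<lambda>_. gauss s)) \<Otimes>\<^sub>M gauss s) borel"
            by (intro measurable_compose[OF measurable_compose[OF measurable_fst measurable_snd]]) measurable
          show ?thesis using False by simp
        qed
      qed
      from measurable_compose[OF this h']
      have m: "(\<lambda>p. h (?pl (\<xi>(j := fst (fst p))) ((snd (fst p))(j := snd p)))) \<in> borel_measurable ((gauss 1 \<Otimes>\<^sub>M PiM J (\<lambda>_. gauss s)) \<Otimes>\<^sub>M gauss s)" .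
      have m': "(\<lambda>p. \<tau> j * fst (fst p)) \<in> borel_measurable ((gauss 1 \<Otimes>\<^sub>M PiM J (\<lambda>_. gauss s)) \<Otimes>\<^sub>M gauss s)"
        by measurable
      have G: "(\<lambda>p. ennreal ((h (?pl (\<xi>(j := fst (fst p))) ((snd (fst p))(j := snd p))) - \<tau> j * fst (fst p))\<^sup>2)) \<in> borel_measurable ((gauss 1 \<Otimes>\<^sub>M PiM J (\<lambda>_. gauss s)) \<Otimes>\<^sub>M gauss s)"
        by (intro measurable_compose[OF _ measurable_ennreal] borel_measurable_power borel_measurable_diff m m')
      show "case_prod (\<lambda>x z. \<integral>\<^sup>+y. ?F (\<xi>(j := x)) (z(j := y)) \<partial>gauss s) \<in> borel_measurable (gauss 1 \<Otimes>\<^sub>M PiM J (\<lambda>_. gauss s))"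
        using gs.borel_measurable_nn_integral_fst[OF G] by (simp only: split_beta' fst_conv snd_conv fun_upd_same)
    qed
  qed
  also have "\<dots> = (\<integral>\<^sup>+\<xi>. \<integral>\<^sup>+x. \<integral>\<^sup>+z. ?F (\<xi>(j := x)) z \<partial>noise s n \<partial>gauss 1 \<partial>PiM J (\<lambda>_. gauss 1))"
  proof (rule nn_integral_cong, rule nn_integral_cong)
    fix \<xi> x
    have "(\<lambda>z. ?pl (\<xi>(j := x)) z) \<in> measurable (PiM (insert j J) (\<lambda>_. gauss s)) (PiM (insert j J) (\<lambda>_. borel))"
      by measurable
    from measurable_compose[OF this h']
    have m: "(\<lambda>z. h (?pl (\<xi>(j := x)) z)) \<in> borel_measurable (PiM (insert j J) (\<lambda>_. gauss s))" .
    have "?F (\<xi>(j := x)) \<in> borel_measurable (PiM (insert j J) (\<lambda>_. gauss s))"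
      by (intro measurable_compose[OF _ measurable_ennreal] borel_measurable_power borel_measurable_diff m borel_measurable_const)
    from ps.product_nn_integral_insert[OF J this]
    show "(\<integral>\<^sup>+z. \<integral>\<^sup>+y. ?F (\<xi>(j := x)) (z(j := y)) \<partial>gauss s \<partial>PiM J (\<lambda>_. gauss s)) = (\<integral>\<^sup>+z. ?F (\<xi>(j := x)) z \<partial>noise s n)"
      unfolding noise_gauss I ..
  qed
  also have "\<dots> = (\<integral>\<^sup>+\<xi>. \<integral>\<^sup>+z. ?F \<xi> z \<partial>noise s n \<partial>noise 1 n)"
  proof -
    interpret prob_space "noise s n" by (rule prob_noise[OF s])
    have c: "(\<lambda>p. \<tau> i * fst p i + snd p i) \<in> borel_measurable (PiM (insert j J) (\<lambda>_. gauss 1) \<Otimes>\<^sub>M noise s n)" if "i \<in> insert j J" for i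
    proof -
      have "(\<lambda>x. x i) \<in> borel_measurable (PiM (insert j J) (\<lambda>_. gauss 1))" using that by measurable
      moreover have "(\<lambda>x. x i) \<in> borel_measurable (noise s n)" using that unfolding noise_gauss I by measurable
      ultimately show ?thesis
        by (intro borel_measurable_add borel_measurable_times borel_measurable_const measurable_compose[OF measurable_fst] measurable_compose[OF measurable_snd])
    qed
    then have "(\<lambda>p. ?pl (fst p) (snd p)) \<in> measurable (PiM (insert j J) (\<lambda>_. gauss 1) \<Otimes>\<^sub>M noise s n) (PiM (insert j J) (\<lambda>_. borel))"
      by (rule measurable_restrict)
    from measurable_compose[OF this h']
    have m: "(\<lambda>p. h (?pl (fst p) (snd p))) \<in> borel_measurable (PiM (insert j J) (\<lambda>_. gauss 1) \<Otimes>\<^sub>M noise s n)" .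
    have m': "(\<lambda>p. \<tau> j * fst p j) \<in> borel_measurable (PiM (insert j J) (\<lambda>_. gauss 1) \<Otimes>\<^sub>M noise s n)"
      by (intro borel_measurable_times borel_measurable_const measurable_compose[OF measurable_fst]) measurable
    have "(\<lambda>p. ennreal ((h (?pl (fst p) (snd p)) - \<tau> j * fst p j)\<^sup>2)) \<in> borel_measurable (PiM (insert j J) (\<lambda>_. gauss 1) \<Otimes>\<^sub>M noise s n)"
      by (intro measurable_compose[OF _ measurable_ennreal] borel_measurable_power borel_measurable_diff m m')
    from borel_measurable_nn_integral_fst[OF this]
    have "(\<lambda>\<xi>. \<integral>\<^sup>+z. ?F \<xi> z \<partial>noise s n) \<in> borel_measurable (PiM (insert j J) (\<lambda>_. gauss 1))"
      by (simp only: fst_conv snd_conv)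
    from p1.product_nn_integral_insert[OF J this] show ?thesis
      unfolding noise_gauss[of 1] I ..
  qed
  finally show ?thesis by (simp add: I)
qed

text \<open>Tilting the standard normal density by \<open>exp (x * z\<^sup>2)\<close> gives
  \<open>r\<close> times the normal density of standard deviation \<open>r\<close>, so the moment
  equals \<open>r = 1 / sqrt (1 - 2 * x)\<close>. The range x \<le> 1/4 is that of the bound
  \<open>ln (1 - y) \<ge> - y - 2 * y\<^sup>2\<close> at \<open>y = 2 * x\<close>.\<close>

lemma exp_sq_moment:
  assumes x: "0 \<le> x" "x \<le> 1/4"
  shows "(\<integral>\<^sup>+z. ennreal (exp (x * z\<^sup>2)) \<partial>gauss 1) \<le> ennreal (exp (x + 4 * x\<^sup>2))"
proof -
  define r where "r = 1 / sqrt (1 - 2 * x)"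
  have q: "1 - 2 * x > 0" using x by simp
  have r: "r > 0" using q by (simp add: r_def)
  have r2: "r\<^sup>2 = 1 / (1 - 2 * x)" using q by (simp add: r_def power_divide)
  have d: "normal_density 0 1 z * exp (x * z\<^sup>2) = r * normal_density 0 r z" for z
  proof -
    have "sqrt (2 * pi * r\<^sup>2) = r * sqrt (2 * pi)" using r by (simp add: real_sqrt_mult)
    moreover have "- z\<^sup>2 / (2 * r\<^sup>2) = - z\<^sup>2 / 2 + x * z\<^sup>2" using q by (simp add: r2 field_simps)
    ultimately show ?thesis using r by (simp add: normal_density_def exp_add[symmetric])
  qed
  interpret prob_space "gauss r" by (rule prob_gauss[OF r])
  have "(\<integral>\<^sup>+z. ennreal (exp (x * z\<^sup>2)) \<partial>gauss 1) = (\<integral>\<^sup>+z. ennreal (normal_density 0 1 z * exp (x * z\<^sup>2)) \<partial>lborel)"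
    unfolding gauss_def by (subst nn_integral_density) (auto simp: ennreal_mult')
  also have "\<dots> = (\<integral>\<^sup>+z. ennreal r \<partial>gauss r)"
    unfolding d gauss_def by (subst nn_integral_density) (use r in \<open>auto simp: ennreal_mult' mult.commute\<close>)
  also have "\<dots> = ennreal r" using emeasure_space_1 by simp
  also have "\<dots> \<le> ennreal (exp (x + 4 * x\<^sup>2))"
  proof (rule ennreal_leI, rule power2_le_imp_le)
    have "- (2 * x) - 2 * (2 * x)\<^sup>2 \<le> ln (1 - 2 * x)" using x ln_one_minus_pos_lower_bound[of "2 * x"] by simp
    then have "exp (- (2 * x) - 2 * (2 * x)\<^sup>2) \<le> 1 - 2 * x" using q by (metis exp_le_cancel_iff exp_ln)
    then have "1 / (1 - 2 * x) \<le> 1 / exp (- (2 * x) - 2 * (2 * x)\<^sup>2)" using q by (intro divide_left_mono) auto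
    also have "\<dots> = exp (2 * x + 2 * (2 * x)\<^sup>2)" by (simp add: exp_minus[symmetric] divide_inverse)
    also have "\<dots> = (exp (x + 4 * x\<^sup>2))\<^sup>2" by (simp add: power2_eq_square exp_add[symmetric])
    finally show "r\<^sup>2 \<le> (exp (x + 4 * x\<^sup>2))\<^sup>2" by (simp add: r2)
  qed simp
  finally show ?thesis .
qed

lemma exp_quadratic_form_moment:
  assumes x: "\<And>j. j < n \<Longrightarrow> 0 \<le> x j" "\<And>j. j < n \<Longrightarrow> x j \<le> 1/4"
  shows "(\<integral>\<^sup>+\<xi>. ennreal (exp (\<Sum>j<n. x j * (\<xi> j)\<^sup>2)) \<partial>noise 1 n) \<le> ennreal (exp (\<Sum>j<n. x j + 4 * (x j)\<^sup>2))"
proof -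
  interpret g1: prob_space "gauss 1" by (rule prob_gauss) simp
  interpret p1: product_sigma_finite "\<lambda>_::nat. gauss 1" by standard
  have "(\<integral>\<^sup>+\<xi>. ennreal (exp (\<Sum>j<n. x j * (\<xi> j)\<^sup>2)) \<partial>noise 1 n) = (\<integral>\<^sup>+\<xi>. (\<Prod>j<n. ennreal (exp (x j * (\<xi> j)\<^sup>2))) \<partial>noise 1 n)"
    by (simp add: exp_sum prod_ennreal)
  also have "\<dots> = (\<Prod>j<n. \<integral>\<^sup>+z. ennreal (exp (x j * z\<^sup>2)) \<partial>gauss 1)"
    unfolding noise_gauss by (intro p1.product_nn_integral_prod) auto
  also have "\<dots> \<le> (\<Prod>j<n. ennreal (exp (x j + 4 * (x j)\<^sup>2)))"
    using x by (intro prod_mono_ennreal exp_sq_moment) auto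
  also have "\<dots> = ennreal (exp (\<Sum>j<n. x j + 4 * (x j)\<^sup>2))"
    by (simp add: exp_sum prod_ennreal)
  finally show ?thesis .
qed

section \<open>Blockwise shrinkage and the averaging criterion\<close>

text \<open>The case \<open>b = 0\<close> is that of a block without signal. The quotient is then 0
  by convention, and the assumption that \<open>a\<close> vanishes as well saves the bound.\<close>

lemma amgm_weighted:
  fixes a b x \<delta> :: real
  assumes "b \<ge> 0" "b = 0 \<Longrightarrow> a = 0" "\<delta> > 0"
  shows "\<bar>2 * x * a\<bar> \<le> \<delta> * (x\<^sup>2 * b) + a\<^sup>2 / b / \<delta>"
proof (cases "b = 0")
  case True
  then show ?thesis using assms by simp
next
  case False
  then have b: "b > 0" using assms by simp
  define t where "t = \<delta> * b"
  have t: "t > 0" using b assms by (simp add: t_def)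
  have "0 \<le> (t * x - a)\<^sup>2" "0 \<le> (t * x + a)\<^sup>2" by auto
  then have "2 * x * a * t \<le> t\<^sup>2 * x\<^sup>2 + a\<^sup>2" "- (2 * x * a) * t \<le> t\<^sup>2 * x\<^sup>2 + a\<^sup>2"
    by (auto simp: power2_eq_square algebra_simps)
  then have "\<bar>2 * x * a\<bar> * t \<le> t\<^sup>2 * x\<^sup>2 + a\<^sup>2" by (auto simp: abs_if)
  then have "\<bar>2 * x * a\<bar> \<le> (t\<^sup>2 * x\<^sup>2 + a\<^sup>2) / t" using t by (simp add: pos_le_divide_eq)
  also have "\<dots> = t * x\<^sup>2 + a\<^sup>2 / t" using t by (simp add: add_divide_distrib power2_eq_square)
  finally show ?thesis by (simp add: t_def mult_ac)
qed

text \<open>Block sums of the Gaussian sequence model: block \<open>m\<close> has signal energy \<open>u m\<close> and size \<open>d m\<close>;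
  \<open>T m\<close> and \<open>S m\<close> are the centred noise energy and the signal-noise product on it, and \<open>D\<close> is the
  error of the variance estimate. \<open>risk_obj\<close>, \<open>loss_obj\<close> and \<open>crit_obj\<close> are the risk, the loss and
  the criterion (up to a constant) of the estimator that shrinks block \<open>m\<close> by \<open>g m\<close>.\<close>
locale block_model =
  fixes M :: nat and s2 D :: real and d u T S :: "nat \<Rightarrow> real"
  assumes s2: "s2 > 0"
    and d: "\<And>m. m < M \<Longrightarrow> d m \<ge> 0" and u: "\<And>m. m < M \<Longrightarrow> u m \<ge> 0"
    and T0: "\<And>m. m < M \<Longrightarrow> d m = 0 \<Longrightarrow> T m = 0"
    and S0: "\<And>m. m < M \<Longrightarrow> u m = 0 \<Longrightarrow> S m = 0"
begin

definition "risk_obj g = (\<Sum>m<M. (1 - g m)\<^sup>2 * u m + s2 * (g m)\<^sup>2 * d m)"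
definition "loss_obj g = risk_obj g + (\<Sum>m<M. (g m)\<^sup>2 * T m - 2 * g m * (1 - g m) * S m)"
definition "crit_obj g = loss_obj g + (\<Sum>m<M. 2 * (1 - g m) * S m - 2 * g m * T m + 2 * D * g m * d m)"
text \<open>Collects the remainders \<open>a\<^sup>2 / b\<close> of \<open>amgm_weighted\<close> for
  the three perturbations: noise energy, cross term and variance error.\<close>

definition "fluct = (\<Sum>m<M. (T m)\<^sup>2 / (s2 * d m)) + (\<Sum>m<M. (S m)\<^sup>2 / u m) + (\<Sum>m<M. d m) * D\<^sup>2 / s2"

lemma risk_obj_nonneg: "risk_obj g \<ge> 0"
  unfolding risk_obj_def using s2 d u by (intro sum_nonneg add_nonneg_nonneg mult_nonneg_nonneg) auto

lemma fluct_nonneg: "fluct \<ge> 0"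
  unfolding fluct_def using s2 d u by (intro sum_nonneg add_nonneg_nonneg mult_nonneg_nonneg divide_nonneg_nonneg) auto

text \<open>The variance error is common to all blocks. Spread over them, it takes the form
  \<open>a\<^sup>2 / b\<close> with \<open>a = D * d m\<close> and \<open>b = s2 * d m\<close>, so
  that every block can be estimated on its own.\<close>

lemma fluct_split:
  "fluct / \<delta> = (\<Sum>m<M. (T m)\<^sup>2 / (s2 * d m) / \<delta> + (S m)\<^sup>2 / u m / \<delta> + (D * d m)\<^sup>2 / (s2 * d m) / \<delta>)"
proof -
  have "(D * d m)\<^sup>2 / (s2 * d m) = d m * (D\<^sup>2 / s2)" if "m < M" for m
    using s2 d[OF that] by (cases "d m = 0") (simp_all add: power2_eq_square)
  then have "(\<Sum>m<M. d m) * D\<^sup>2 / s2 = (\<Sum>m<M. (D * d m)\<^sup>2 / (s2 * d m))"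
    by (simp add: sum_distrib_right sum_divide_distrib)
  then show ?thesis
    by (simp add: fluct_def sum.distrib add_divide_distrib sum_divide_distrib)
qed

lemma loss_risk:
  assumes \<delta>: "\<delta> > 0" and g: "\<And>m. m < M \<Longrightarrow> 0 \<le> g m" "\<And>m. m < M \<Longrightarrow> g m \<le> 1"
  shows "\<bar>loss_obj g - risk_obj g\<bar> \<le> \<delta> * risk_obj g + fluct / \<delta>"
proof -
  have "\<bar>loss_obj g - risk_obj g\<bar> \<le> (\<Sum>m<M. \<bar>(g m)\<^sup>2 * T m - 2 * g m * (1 - g m) * S m\<bar>)"
    unfolding loss_obj_def by (simp add: sum_abs)
  also have "\<dots> \<le> (\<Sum>m<M. \<delta> * ((1 - g m)\<^sup>2 * u m + s2 * (g m)\<^sup>2 * d m) +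
      ((T m)\<^sup>2 / (s2 * d m) / \<delta> + (S m)\<^sup>2 / u m / \<delta> + (D * d m)\<^sup>2 / (s2 * d m) / \<delta>))"
  proof (rule sum_mono)
    fix m assume "m \<in> {..<M}"
    then have m: "m < M" by simp
    have 1: "\<bar>2 * (1 - g m) * S m\<bar> \<le> \<delta> * ((1 - g m)\<^sup>2 * u m) + (S m)\<^sup>2 / u m / \<delta>"
      using m u S0 \<delta> by (intro amgm_weighted) auto
    have 2: "\<bar>2 * g m * T m\<bar> \<le> \<delta> * ((g m)\<^sup>2 * (s2 * d m)) + (T m)\<^sup>2 / (s2 * d m) / \<delta>"
      using m d T0 \<delta> s2 by (intro amgm_weighted) (auto simp: mult_nonneg_nonneg)
    \<comment> \<open>Factors in [0,1] allow one power of \<open>g m\<close> to be dropped, which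
      reduces the noise terms of the loss to those that occur in the criterion.\<close>
    have "\<bar>(g m)\<^sup>2 * T m\<bar> \<le> \<bar>g m * T m\<bar>"
    proof -
      have "g m * g m \<le> 1 * g m" using g[OF m] by (intro mult_right_mono) auto
      then have "g m * g m * \<bar>T m\<bar> \<le> g m * \<bar>T m\<bar>" by (intro mult_right_mono) auto
      then show ?thesis using g[OF m] by (simp add: abs_mult power2_eq_square)
    qed
    also have "\<dots> \<le> \<bar>2 * g m * T m\<bar>" by (simp add: abs_mult)
    finally have 3: "\<bar>(g m)\<^sup>2 * T m\<bar> \<le> \<bar>2 * g m * T m\<bar>" .
    have "\<bar>g m * (2 * (1 - g m) * S m)\<bar> \<le> 1 * \<bar>2 * (1 - g m) * S m\<bar>"
      unfolding abs_mult[of "g m"] using g[OF m] by (intro mult_right_mono) auto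
    then have 4: "\<bar>2 * g m * (1 - g m) * S m\<bar> \<le> \<bar>2 * (1 - g m) * S m\<bar>" by (simp add: mult_ac)
    have 5: "0 \<le> (D * d m)\<^sup>2 / (s2 * d m) / \<delta>" using s2 d[OF m] \<delta> by simp
    have "\<bar>(g m)\<^sup>2 * T m - 2 * g m * (1 - g m) * S m\<bar> \<le> \<bar>(g m)\<^sup>2 * T m\<bar> + \<bar>2 * g m * (1 - g m) * S m\<bar>"
      by (rule abs_triangle_ineq4)
    also have "\<dots> \<le> (\<delta> * ((g m)\<^sup>2 * (s2 * d m)) + (T m)\<^sup>2 / (s2 * d m) / \<delta>) + (\<delta> * ((1 - g m)\<^sup>2 * u m) + (S m)\<^sup>2 / u m / \<delta>)"
      using 1 2 3 4 by linarith
    also have "\<dots> \<le> \<delta> * ((1 - g m)\<^sup>2 * u m + s2 * (g m)\<^sup>2 * d m) +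
      ((T m)\<^sup>2 / (s2 * d m) / \<delta> + (S m)\<^sup>2 / u m / \<delta> + (D * d m)\<^sup>2 / (s2 * d m) / \<delta>)"
      using 5 by (simp add: algebra_simps)
    finally show "\<bar>(g m)\<^sup>2 * T m - 2 * g m * (1 - g m) * S m\<bar> \<le> \<dots>" .
  qed
  also have "\<dots> = \<delta> * risk_obj g + fluct / \<delta>"
    unfolding fluct_split risk_obj_def by (subst sum.distrib) (simp only: sum_distrib_left)
  finally show ?thesis .
qed

text \<open>The factor 2 in front of \<delta> arises because the variance part of the risk pays
  twice, for \<open>T\<close> and for \<open>D\<close>. The terms are already linear in the factors,
  so no bounds on \<open>g\<close> are needed.\<close>

lemma crit_loss:
  assumes \<delta>: "\<delta> > 0"
  shows "\<bar>crit_obj g - loss_obj g\<bar> \<le> 2 * \<delta> * risk_obj g + fluct / \<delta>"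
proof -
  have "\<bar>crit_obj g - loss_obj g\<bar> \<le> (\<Sum>m<M. \<bar>2 * (1 - g m) * S m - 2 * g m * T m + 2 * D * g m * d m\<bar>)"
    unfolding crit_obj_def by (simp add: sum_abs)
  also have "\<dots> \<le> (\<Sum>m<M. 2 * \<delta> * ((1 - g m)\<^sup>2 * u m + s2 * (g m)\<^sup>2 * d m) +
      ((T m)\<^sup>2 / (s2 * d m) / \<delta> + (S m)\<^sup>2 / u m / \<delta> + (D * d m)\<^sup>2 / (s2 * d m) / \<delta>))"
  proof (rule sum_mono)
    fix m assume "m \<in> {..<M}"
    then have m: "m < M" by simp
    have 1: "\<bar>2 * (1 - g m) * S m\<bar> \<le> \<delta> * ((1 - g m)\<^sup>2 * u m) + (S m)\<^sup>2 / u m / \<delta>"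
      using m u S0 \<delta> by (intro amgm_weighted) auto
    have 2: "\<bar>2 * g m * T m\<bar> \<le> \<delta> * ((g m)\<^sup>2 * (s2 * d m)) + (T m)\<^sup>2 / (s2 * d m) / \<delta>"
      using m d T0 \<delta> s2 by (intro amgm_weighted) (auto simp: mult_nonneg_nonneg)
    have 3: "\<bar>2 * g m * (D * d m)\<bar> \<le> \<delta> * ((g m)\<^sup>2 * (s2 * d m)) + (D * d m)\<^sup>2 / (s2 * d m) / \<delta>"
      using m d \<delta> s2 by (intro amgm_weighted) (auto simp: mult_nonneg_nonneg)
    have 4: "0 \<le> \<delta> * ((1 - g m)\<^sup>2 * u m)" using \<delta> u[OF m] by simp
    have "\<bar>2 * (1 - g m) * S m - 2 * g m * T m + 2 * D * g m * d m\<bar>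
      \<le> \<bar>2 * (1 - g m) * S m\<bar> + \<bar>2 * g m * T m\<bar> + \<bar>2 * g m * (D * d m)\<bar>"
      by (simp add: mult_ac)
    also have "\<dots> \<le> 2 * \<delta> * ((1 - g m)\<^sup>2 * u m + s2 * (g m)\<^sup>2 * d m) +
      ((T m)\<^sup>2 / (s2 * d m) / \<delta> + (S m)\<^sup>2 / u m / \<delta> + (D * d m)\<^sup>2 / (s2 * d m) / \<delta>)"
      using 1 2 3 4 by (simp add: algebra_simps)
    finally show "\<bar>2 * (1 - g m) * S m - 2 * g m * T m + 2 * D * g m * d m\<bar> \<le> \<dots>" .
  qed
  also have "\<dots> = 2 * \<delta> * risk_obj g + fluct / \<delta>"
    unfolding fluct_split risk_obj_def by (subst sum.distrib) (simp only: sum_distrib_left)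
  finally show ?thesis .
qed

text \<open>The loss of \<open>g\<close> is passed to the criterion at \<open>g\<close>, the
  criterion at \<open>h\<close>, the loss of \<open>h\<close> and the risk of \<open>h\<close>. The
  error on the way contains the risk of \<open>g\<close>, which \<open>loss_risk\<close> turns back
  into the loss of \<open>g\<close>, to be absorbed on the left.\<close>

lemma oracle_inequality:
  assumes \<delta>: "0 < \<delta>" "\<delta> \<le> 1/6"
    and g: "\<And>m. m < M \<Longrightarrow> 0 \<le> g m" "\<And>m. m < M \<Longrightarrow> g m \<le> 1"
    and h: "\<And>m. m < M \<Longrightarrow> 0 \<le> h m" "\<And>m. m < M \<Longrightarrow> h m \<le> 1"
    and le: "crit_obj g \<le> crit_obj h" and L0: "loss_obj g \<ge> 0"
  shows "loss_obj g \<le> (1 + 16 * \<delta>) * risk_obj h + 16 * (fluct / \<delta>)"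
proof -
  define w where "w = fluct / \<delta>"
  have w: "w \<ge> 0" using fluct_nonneg \<delta> by (simp add: w_def)
  define V where "V = risk_obj h"
  define X where "X = risk_obj g"
  define L where "L = loss_obj g"
  have V: "V \<ge> 0" and X: "X \<ge> 0" by (simp_all add: V_def X_def risk_obj_nonneg)
  have a: "\<bar>loss_obj h - V\<bar> \<le> \<delta> * V + w" "\<bar>L - X\<bar> \<le> \<delta> * X + w"
    using loss_risk[OF \<delta>(1), of h] loss_risk[OF \<delta>(1), of g] g h by (auto simp: V_def X_def L_def w_def)
  have b: "\<bar>crit_obj h - loss_obj h\<bar> \<le> 2 * \<delta> * V + w" "\<bar>crit_obj g - L\<bar> \<le> 2 * \<delta> * X + w"
    using crit_loss[OF \<delta>(1), of h] crit_loss[OF \<delta>(1), of g] by (auto simp: V_def X_def L_def w_def)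
  have c: "L \<le> V + 3 * (\<delta> * V) + 3 * w + 2 * (\<delta> * X)"
    using a b le by (simp add: algebra_simps abs_le_iff)
  have "\<delta> * X \<le> (1/6) * X" using \<delta> X by (intro mult_right_mono) auto
  then have "X \<le> 6/5 * (L + w)" using a(2) by (simp add: abs_le_iff)
  then have "\<delta> * X \<le> \<delta> * (6/5 * (L + w))" using \<delta> by (intro mult_left_mono) auto
  moreover have "\<delta> * w \<le> (1/6) * w" using \<delta> w by (intro mult_right_mono) auto
  ultimately have e: "(1 - 12/5 * \<delta>) * L \<le> (1 + 3 * \<delta>) * V + 17/5 * w"
    using c by (simp add: algebra_simps)
  have "\<delta> * \<delta> \<le> (1/6) * \<delta>" using \<delta> by (intro mult_right_mono) auto
  \<comment> \<open>\<open>1 + 4 * \<delta>\<close> replaces the reciprocal of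
    \<open>1 - 12/5 * \<delta>\<close>: the product of the two is at least 1 exactly for \<delta>
    between 0 and 1/6. The final constants 16 are generous.\<close>
  then have "1 * L \<le> (1 + 4 * \<delta>) * (1 - 12/5 * \<delta>) * L"
    using L0 by (intro mult_right_mono) (auto simp: L_def algebra_simps)
  also have "\<dots> \<le> (1 + 4 * \<delta>) * ((1 + 3 * \<delta>) * V + 17/5 * w)"
    unfolding mult.assoc using \<delta> by (intro mult_left_mono e) auto
  also have "\<dots> = ((1 + 4 * \<delta>) * (1 + 3 * \<delta>)) * V + ((1 + 4 * \<delta>) * (17/5)) * w"
    by (simp add: algebra_simps)
  also have "\<dots> \<le> (1 + 16 * \<delta>) * V + 16 * w"
    using \<delta> V w \<open>\<delta> * \<delta> \<le> (1/6) * \<delta>\<close> by (intro add_mono mult_right_mono) (auto simp: algebra_simps)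
  finally show ?thesis by (simp add: L_def V_def w_def)
qed

lemma loss_lower:
  assumes "0 < \<delta>" "\<And>m. m < M \<Longrightarrow> 0 \<le> g m" "\<And>m. m < M \<Longrightarrow> g m \<le> 1"
  shows "(1 - \<delta>) * risk_obj g - fluct / \<delta> \<le> loss_obj g"
  using loss_risk[of \<delta> g] assms by (simp add: abs_le_iff algebra_simps)

end

section \<open>Block decomposition of the sequence model\<close>

definition blk :: "(nat \<Rightarrow> nat) \<Rightarrow> nat \<Rightarrow> nat set" where
  "blk K m = {K m..<K (Suc m)}"

lemma sum_blk:
  fixes h :: "nat \<Rightarrow> real"
  assumes "K 0 = 0" "\<And>m. m < M \<Longrightarrow> K m \<le> K (Suc m)"
  shows "(\<Sum>m<M. \<Sum>j\<in>blk K m. h j) = (\<Sum>j<K M. h j)"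
  using assms(2)
proof (induction M)
  case 0
  then show ?case by (simp add: assms(1))
next
  case (Suc M)
  have "{..<K (Suc M)} = {..<K M} \<union> {K M..<K (Suc M)}" using Suc.prems[of M] by auto
  then have "(\<Sum>j<K (Suc M). h j) = (\<Sum>j<K M. h j) + (\<Sum>j\<in>blk K M. h j)"
    unfolding blk_def by (simp add: sum.union_disjoint ivl_disj_int)
  then show ?case using Suc by simp
qed

text \<open>The terms with \<open>v\<close> cancel, so \<open>v\<close> is a free centring constant;
  it will be the noise variance.\<close>

lemma sequence_loss_block:
  fixes \<mu> z :: "nat \<Rightarrow> real"
  shows "(\<Sum>j\<in>B. (a * (\<mu> j + z j) - \<mu> j)\<^sup>2) =
     (1 - a)\<^sup>2 * (\<Sum>j\<in>B. (\<mu> j)\<^sup>2) + v * a\<^sup>2 * real (card B) +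
     (a\<^sup>2 * (\<Sum>j\<in>B. (z j)\<^sup>2 - v) - 2 * a * (1 - a) * (\<Sum>j\<in>B. \<mu> j * z j))"
  by (induction B rule: infinite_finite_induct) (simp_all add: power2_eq_square algebra_simps)

text \<open>The subtracted noise energy does not depend on the factor \<open>a\<close> and hence not
  on the choice of weights. After its removal criterion and loss differ by centred terms and the
  variance error, all affine in \<open>a\<close>.\<close>

lemma sequence_crit_block:
  fixes \<mu> z :: "nat \<Rightarrow> real"
  shows "(\<Sum>j\<in>B. (1 - a)\<^sup>2 * (\<mu> j + z j)\<^sup>2) + 2 * sh * a * real (card B) - (\<Sum>j\<in>B. (z j)\<^sup>2) =
     (\<Sum>j\<in>B. (a * (\<mu> j + z j) - \<mu> j)\<^sup>2) +
     (2 * (1 - a) * (\<Sum>j\<in>B. \<mu> j * z j) - 2 * a * (\<Sum>j\<in>B. (z j)\<^sup>2 - v) + 2 * (sh - v) * a * real (card B))"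
  by (induction B rule: infinite_finite_induct) (simp_all add: power2_eq_square algebra_simps)

text \<open>\<open>kG\<close> is indexed from 1; the additional cut 0 is the left end of the first
  block, so block \<open>m\<close> lies between models \<open>m\<close> and
  \<open>Suc m\<close>.\<close>

definition cuts :: "real \<Rightarrow> real \<Rightarrow> nat \<Rightarrow> nat \<Rightarrow> nat" where
  "cuts t1 t2 n m = (if m = 0 then 0 else kG t1 t2 n m)"

text \<open>The shrinkage factor on block \<open>m\<close>: the models containing that block are
  those with index at least \<open>Suc m\<close>.\<close>

definition tails :: "nat \<Rightarrow> (nat \<Rightarrow> real) \<Rightarrow> nat \<Rightarrow> real" where
  "tails M w m = (\<Sum>l\<in>{Suc m..M}. w l)"

lemma coord_sum: "coord Phi n (\<lambda>i. \<Sum>m\<in>A. w m * v m i) j = (\<Sum>m\<in>A. w m * coord Phi n (v m) j)"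
proof -
  have "coord Phi n (\<lambda>i. \<Sum>m\<in>A. w m * v m i) j = (\<Sum>l<n. \<Sum>m\<in>A. w m * (Phi j l * v m l))"
    by (simp add: coord_def sum_distrib_left mult_ac)
  also have "\<dots> = (\<Sum>m\<in>A. \<Sum>l<n. w m * (Phi j l * v m l))" by (rule sum.swap)
  finally show ?thesis by (simp add: coord_def sum_distrib_left)
qed

context orthonormal_rows
begin

lemma coord_Pk:
  assumes "k \<le> n" "j < n"
  shows "coord Phi n (Pk Phi n k y) j = (if j < k then coord Phi n y j else 0)"
proof -
  have "Pk Phi n k y = (\<lambda>i. \<Sum>l<n. (if l < k then coord Phi n y l else 0) * Phi l i)"
  proof
    fix i
    have "(\<Sum>l<n. (if l < k then coord Phi n y l else 0) * Phi l i) = (\<Sum>l<k. coord Phi n y l * Phi l i)"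
      using assms(1) by (intro sum.mono_neutral_cong_right) auto
    then show "Pk Phi n k y i = (\<Sum>l<n. (if l < k then coord Phi n y l else 0) * Phi l i)"
      by (simp add: Pk_def coord_def)
  qed
  then show ?thesis using coord_synth[OF assms(2), of "\<lambda>l. if l < k then coord Phi n y l else 0"] by simp
qed

lemma sigmahat2_coord:
  assumes "nat \<lfloor>\<kappa> * real n\<rfloor> \<le> n"
  shows "sigmahat2 Phi n \<kappa> y = (\<Sum>j\<in>{nat \<lfloor>\<kappa> * real n\<rfloor>..<n}. (coord Phi n y j)\<^sup>2) / real (n - nat \<lfloor>\<kappa> * real n\<rfloor>)"
proof -
  let ?m = "nat \<lfloor>\<kappa> * real n\<rfloor>"
  have "sqn n (\<lambda>i. y i - Pk Phi n ?m y i) = (\<Sum>j<n. (coord Phi n y j - (if j < ?m then coord Phi n y j else 0))\<^sup>2)"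
    unfolding parseval coord_diff by (intro sum.cong refl) (simp add: coord_Pk[OF assms])
  also have "\<dots> = (\<Sum>j\<in>{?m..<n}. (coord Phi n y j)\<^sup>2)"
    by (intro sum.mono_neutral_cong_right) auto
  finally show ?thesis by (simp add: sigmahat2_def Let_def)
qed

end

section \<open>Existence of minimising weights and the correspondence of weights and factors\<close>

lemma compact_box_fun:
  fixes a b :: "'a \<Rightarrow> real"
  shows "compact (PiE UNIV (\<lambda>m. {a m..b m}))"
proof -
  have "compactin (product_topology (\<lambda>i. euclidean) UNIV) (PiE UNIV (\<lambda>m. {a m..b m}))"
    by (subst compactin_PiE) auto
  then show ?thesis by (simp add: euclidean_product_topology)
qed

text \<open>Weights are functions on all of \<open>nat\<close> and \<open>simplexG\<close> leaves
  them free outside 1..M, so it is not compact. The minimum is taken over the weights that vanish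
  there, a closed part of a product of intervals.\<close>

lemma CnG_minimiser_exists:
  assumes "1 \<le> MG t1 t2 n"
  shows "\<exists>w. w \<in> simplexG (MG t1 t2 n) \<and>
      (\<forall>v\<in>simplexG (MG t1 t2 n). CnG Phi n \<kappa> t1 t2 w y \<le> CnG Phi n \<kappa> t1 t2 v y)"
proof -
  define M where "M = MG t1 t2 n"
  define B where "B = PiE UNIV (\<lambda>m. {0::real..(if m \<in> {1..M} then 1 else 0)})"
  define S where "S = B \<inter> {w. (\<Sum>m=1..M. w m) = 1}"
  have cont: "continuous_on A (\<lambda>w::nat\<Rightarrow>real. w m)" for A m
    using continuous_on_product_coordinates by (rule continuous_on_subset) auto
  have "closed {w::nat\<Rightarrow>real. (\<Sum>m=1..M. w m) = 1}"
    by (intro closed_Collect_eq continuous_on_sum cont continuous_on_const)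
  then have "compact S" unfolding S_def B_def by (intro compact_Int_closed compact_box_fun)
  moreover have "(\<lambda>m. if m = 1 then 1 else 0) \<in> S"
    using assms by (auto simp: S_def B_def M_def)
  then have "S \<noteq> {}" by auto
  moreover have "continuous_on S (\<lambda>w. CnG Phi n \<kappa> t1 t2 w y)"
    unfolding CnG_def fhatG_def sqn_def divide_inverse
    by (intro continuous_on_add continuous_on_mult continuous_on_sum continuous_on_power
        continuous_on_diff continuous_on_const cont)
  ultimately have "\<exists>w\<in>S. \<forall>v\<in>S. CnG Phi n \<kappa> t1 t2 w y \<le> CnG Phi n \<kappa> t1 t2 v y"
    by (rule continuous_attains_inf)
  then obtain w where w: "w \<in> S" "\<And>v. v \<in> S \<Longrightarrow> CnG Phi n \<kappa> t1 t2 w y \<le> CnG Phi n \<kappa> t1 t2 v y"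
    by blast
  have "CnG Phi n \<kappa> t1 t2 w y \<le> CnG Phi n \<kappa> t1 t2 v y" if v: "v \<in> simplexG M" for v
  proof -
    \<comment> \<open>Cutting \<open>v\<close> off outside 1..M changes neither the criterion nor
      the total weight, so minimality carries over to the whole simplex.\<close>
    define v' where "v' m = (if m \<in> {1..M} then v m else 0)" for m
    have le1: "v m \<le> 1" if m: "m \<in> {1..M}" for m
      using member_le_sum[OF m, of v] v by (auto simp: simplexG_def)
    have "(\<Sum>m=1..M. v' m) = 1" using v by (simp add: v'_def simplexG_def)
    then have "v' \<in> S" using v le1 by (auto simp: S_def B_def v'_def simplexG_def)
    moreover have "CnG Phi n \<kappa> t1 t2 v' y = CnG Phi n \<kappa> t1 t2 v y"
      by (simp add: CnG_def fhatG_def v'_def flip: M_def)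
    ultimately show ?thesis using w(2)[of v'] by simp
  qed
  moreover have "w \<in> simplexG M"
  proof -
    have "w \<in> PiE UNIV (\<lambda>m. {0..(if m \<in> {1..M} then 1 else 0)})" using w(1) unfolding S_def B_def by (rule IntD1)
    then have "w m \<in> {0..(if m \<in> {1..M} then 1 else 0)}" for m by (rule PiE_mem[OF _ UNIV_I])
    then show ?thesis using w(1) by (auto simp: S_def simplexG_def)
  qed
  ultimately show ?thesis unfolding M_def by blast
qed

lemma whatG_minimises:
  assumes "1 \<le> MG t1 t2 n"
  shows "whatG Phi n \<kappa> t1 t2 y \<in> simplexG (MG t1 t2 n)"
    "v \<in> simplexG (MG t1 t2 n) \<Longrightarrow> CnG Phi n \<kappa> t1 t2 (whatG Phi n \<kappa> t1 t2 y) y \<le> CnG Phi n \<kappa> t1 t2 v y"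
  using someI_ex[OF CnG_minimiser_exists[OF assms], of Phi \<kappa> y] unfolding whatG_def by blast+

lemma tails_bounds:
  assumes "w \<in> simplexG M"
  shows "0 \<le> tails M w m" "tails M w m \<le> 1"
proof -
  show "0 \<le> tails M w m" unfolding tails_def using assms by (intro sum_nonneg) (auto simp: simplexG_def)
  have "tails M w m \<le> (\<Sum>l\<in>{1..M}. w l)"
    unfolding tails_def using assms by (intro sum_mono2) (auto simp: simplexG_def)
  then show "tails M w m \<le> 1" using assms by (simp add: simplexG_def)
qed

text \<open>Differencing inverts \<open>tails\<close>. Nonnegative weights correspond to
  nonincreasing nonnegative factors, and total weight one to the factor 1 on block 0.\<close>

lemma weights_with_tails:
  fixes g :: "nat \<Rightarrow> real"
  assumes M: "1 \<le> M" and g0: "g 0 = 1" and pos: "\<And>m. m < M \<Longrightarrow> 0 \<le> g m"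
    and dec: "\<And>m. Suc m < M \<Longrightarrow> g (Suc m) \<le> g m"
  obtains w where "w \<in> simplexG M" "\<And>m. m < M \<Longrightarrow> tails M w m = g m"
proof -
  \<comment> \<open>The jump to 0 at \<open>M\<close> puts the remaining mass
    \<open>g (M - 1)\<close> on the largest model.\<close>
  define h where "h m = (if m < M then g m else 0)" for m
  define w where "w l = h (l - 1) - h l" for l
  have "(\<Sum>l\<in>{Suc m..N}. w l) = h m - h N" if "m \<le> N" for m N
    using that by (induction rule: dec_induct) (auto simp: w_def)
  then have t: "tails M w m = g m" if "m < M" for m
    using that by (simp add: tails_def h_def)
  have "0 \<le> w m" if "m \<in> {1..M}" for m
  proof (cases "m = M")
    case True then show ?thesis using pos[of "M - 1"] M by (simp add: w_def h_def)
  next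
    case False
    then have "m - 1 < M" "m < M" using that by auto
    then show ?thesis using dec[of "m - 1"] that by (simp add: w_def h_def)
  qed
  moreover have "(\<Sum>l=1..M. w l) = 1" using t[of 0] M g0 by (simp add: tails_def)
  ultimately have "w \<in> simplexG M" by (auto simp: simplexG_def)
  then show ?thesis using t that by blast
qed

text \<open>\<open>block_model.fluct\<close> as a function of the signal and noise coefficients
  alone. In this form it can be integrated, and the rotated noise can be replaced by the noise
  itself.\<close>

definition fluctuation :: "(nat \<Rightarrow> nat) \<Rightarrow> nat \<Rightarrow> real \<Rightarrow> nat \<Rightarrow> nat \<Rightarrow> (nat \<Rightarrow> real) \<Rightarrow> (nat \<Rightarrow> real) \<Rightarrow> real" where
  "fluctuation K M \<sigma> n k \<mu> z =
     (\<Sum>m<M. (\<Sum>j\<in>blk K m. (z j)\<^sup>2 - \<sigma>\<^sup>2)\<^sup>2 / (\<sigma>\<^sup>2 * real (card (blk K m)))) +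
     (\<Sum>m<M. (\<Sum>j\<in>blk K m. \<mu> j * z j)\<^sup>2 / (\<Sum>j\<in>blk K m. (\<mu> j)\<^sup>2)) +
     real n * ((\<Sum>j\<in>{k..<n}. (\<mu> j + z j)\<^sup>2) / real (n - k) - \<sigma>\<^sup>2)\<^sup>2 / \<sigma>\<^sup>2"

definition seq_risk :: "real \<Rightarrow> nat \<Rightarrow> (nat \<Rightarrow> real) \<Rightarrow> (nat \<Rightarrow> real) \<Rightarrow> real" where
  "seq_risk \<sigma> n \<gamma> \<mu> = (\<Sum>j<n. (1 - \<gamma> j)\<^sup>2 * (\<mu> j)\<^sup>2 + \<sigma>\<^sup>2 * (\<gamma> j)\<^sup>2)"

text \<open>The grid can degenerate for small \<open>n\<close>: at n = 1 division by zero makes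
  \<open>zetaG\<close> and \<open>k1G\<close> equal to 0. Hence \<open>M1\<close> and
  \<open>K_step\<close> are assumed here and supplied for all large \<open>n\<close> by the section
  on the candidate set.\<close>

locale nested_mma = orthonormal_rows Phi n for Phi n +
  fixes \<sigma> \<kappa> t1 t2 :: real and M :: nat and K :: "nat \<Rightarrow> nat"
  assumes sigma: "\<sigma> > 0" and kappa: "0 < \<kappa>" "\<kappa> < 1" and n1: "n \<ge> 1"
    and M_def: "M = MG t1 t2 n" and K_def: "K = cuts t1 t2 n"
    and M1: "1 \<le> M" and K_step: "\<And>m. m < M \<Longrightarrow> K m < K (Suc m)"
begin

lemma K_0: "K 0 = 0" by (simp add: K_def cuts_def)

lemma K_M: "K M = n" using M1 by (simp add: K_def cuts_def kG_def M_def)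

lemma K_mono: "m \<le> l \<Longrightarrow> l \<le> M \<Longrightarrow> K m \<le> K l"
proof (induction rule: dec_induct)
  case (step k)
  then show ?case using K_step[of k] by simp
qed simp

lemma sum_blocks: "(\<Sum>m<M. \<Sum>j\<in>blk K m. h j) = (\<Sum>j<n. h j)" for h :: "nat \<Rightarrow> real"
  using sum_blk[of K M h, OF K_0] K_step K_M by (simp add: less_imp_le)

lemma blk_less: "m < M \<Longrightarrow> j \<in> blk K m \<Longrightarrow> j < n"
  using K_mono[of "Suc m" M] by (auto simp: blk_def K_M)

lemma coord_fhatG:
  assumes m: "m < M" and j: "j \<in> blk K m"
  shows "coord Phi n (fhatG Phi n t1 t2 w y) j = tails M w m * coord Phi n y j"
proof -
  have K: "K l = kG t1 t2 n l" if "l \<in> {1..M}" for l using that by (simp add: K_def cuts_def)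
  have le: "kG t1 t2 n l \<le> n" if "l \<in> {1..M}" for l
    using K_mono[of l M] that by (simp add: K_M flip: K[OF that])
  have less: "j < kG t1 t2 n l \<longleftrightarrow> Suc m \<le> l" if l: "l \<in> {1..M}" for l
  proof
    assume "j < kG t1 t2 n l"
    then show "Suc m \<le> l" using K_mono[of l m] K[OF l] j m by (force simp: blk_def)
  next
    assume "Suc m \<le> l"
    then show "j < kG t1 t2 n l" using K_mono[of "Suc m" l] K[OF l] j l by (auto simp: blk_def)
  qed
  have "coord Phi n (fhatG Phi n t1 t2 w y) j = (\<Sum>l=1..M. w l * coord Phi n (Pk Phi n (kG t1 t2 n l) y) j)"
    unfolding fhatG_def M_def by (rule coord_sum)
  also have "\<dots> = (\<Sum>l=1..M. w l * (if Suc m \<le> l then coord Phi n y j else 0))"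
    using blk_less[OF m j] by (intro sum.cong refl) (simp add: coord_Pk le less)
  also have "\<dots> = (\<Sum>l\<in>{Suc m..M}. w l * coord Phi n y j)"
    by (intro sum.mono_neutral_cong_right) auto
  finally show ?thesis by (simp add: tails_def sum_distrib_right)
qed

lemma loss_fhatG:
  "sqn n (\<lambda>i. fhatG Phi n t1 t2 w y i - f i) = (\<Sum>m<M. \<Sum>j\<in>blk K m. (tails M w m * coord Phi n y j - coord Phi n f j)\<^sup>2)"
  unfolding parseval coord_diff sum_blocks[symmetric]
  by (intro sum.cong refl) (simp add: coord_fhatG)

lemma resid_fhatG:
  "sqn n (\<lambda>i. y i - fhatG Phi n t1 t2 w y i) = (\<Sum>m<M. \<Sum>j\<in>blk K m. (1 - tails M w m)\<^sup>2 * (coord Phi n y j)\<^sup>2)"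
  unfolding parseval coord_diff sum_blocks[symmetric]
  by (intro sum.cong refl) (simp add: coord_fhatG power2_eq_square algebra_simps)

lemma sum_card_blk: "l \<le> M \<Longrightarrow> (\<Sum>m<l. real (card (blk K m))) = real (K l)"
proof (induction l)
  case (Suc l)
  then show ?case using K_step[of l] by (simp add: blk_def)
qed (simp add: K_0)

text \<open>Summation by parts: model \<open>l\<close> consists of the blocks below
  \<open>l\<close>, so exchanging the sums gathers on block \<open>m\<close> the weights of all
  models containing it.\<close>

lemma size_fhatG: "(\<Sum>m=1..M. real (kG t1 t2 n m) * w m) = (\<Sum>m<M. tails M w m * real (card (blk K m)))"
proof -
  have "(\<Sum>l=1..M. real (kG t1 t2 n l) * w l) = (\<Sum>l=1..M. \<Sum>m<M. if m < l then real (card (blk K m)) * w l else 0)"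
  proof (rule sum.cong[OF refl])
    fix l assume l: "l \<in> {1..M}"
    have "real (kG t1 t2 n l) = real (K l)" using l by (simp add: K_def cuts_def)
    also have "\<dots> = (\<Sum>m<l. real (card (blk K m)))" using l by (simp add: sum_card_blk)
    finally have "real (kG t1 t2 n l) * w l = (\<Sum>m<l. real (card (blk K m)) * w l)" by (simp add: sum_distrib_right)
    also have "\<dots> = (\<Sum>m<M. if m < l then real (card (blk K m)) * w l else 0)"
      using l by (intro sum.mono_neutral_cong_left) auto
    finally show "real (kG t1 t2 n l) * w l = \<dots>" .
  qed
  also have "\<dots> = (\<Sum>m<M. \<Sum>l=1..M. if m < l then real (card (blk K m)) * w l else 0)" by (rule sum.swap)
  also have "\<dots> = (\<Sum>m<M. tails M w m * real (card (blk K m)))"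
  proof (rule sum.cong[OF refl])
    fix m assume "m \<in> {..<M}"
    have "(\<Sum>l=1..M. if m < l then real (card (blk K m)) * w l else 0) = (\<Sum>l\<in>{Suc m..M}. real (card (blk K m)) * w l)"
      by (intro sum.mono_neutral_cong_right) auto
    then show "(\<Sum>l=1..M. if m < l then real (card (blk K m)) * w l else 0) = tails M w m * real (card (blk K m))"
      by (simp add: tails_def sum_distrib_left mult.commute)
  qed
  finally show ?thesis .
qed

lemma m_less_n: "nat \<lfloor>\<kappa> * real n\<rfloor> < n"
proof -
  have "\<kappa> * real n < real n" using kappa n1 by simp
  then have "\<lfloor>\<kappa> * real n\<rfloor> < int n" by (simp add: floor_less_iff)
  then show ?thesis using n1 by linarith
qed

context
  fixes f e :: "nat \<Rightarrow> real"
begin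

definition "err_y = restrict (\<lambda>i. f i + e i) {..<n}"
definition "err_D = sigmahat2 Phi n \<kappa> err_y - \<sigma>\<^sup>2"

interpretation B: block_model M "\<sigma>\<^sup>2" err_D "\<lambda>m. real (card (blk K m))" "\<lambda>m. \<Sum>j\<in>blk K m. (coord Phi n f j)\<^sup>2"
  "\<lambda>m. \<Sum>j\<in>blk K m. (coord Phi n e j)\<^sup>2 - \<sigma>\<^sup>2" "\<lambda>m. \<Sum>j\<in>blk K m. coord Phi n f j * coord Phi n e j"
proof
  fix m assume "(\<Sum>j\<in>blk K m. (coord Phi n f j)\<^sup>2) = 0"
  then have "\<forall>j\<in>blk K m. coord Phi n f j = 0" by (subst (asm) sum_nonneg_eq_0_iff) (auto simp: blk_def)
  then show "(\<Sum>j\<in>blk K m. coord Phi n f j * coord Phi n e j) = 0" by simp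
qed (use sigma in \<open>auto simp: sum_nonneg blk_def\<close>)

lemma coord_err_y: "coord Phi n err_y j = coord Phi n f j + coord Phi n e j"
  by (simp add: err_y_def coord_add)

lemma loss_obj_eq: "B.loss_obj (tails M w) = sqn n (\<lambda>i. fhatG Phi n t1 t2 w err_y i - f i)"
  unfolding loss_fhatG B.loss_obj_def B.risk_obj_def coord_err_y
  by (simp add: sequence_loss_block[where v="\<sigma>\<^sup>2"] sum.distrib)

lemma crit_obj_eq: "B.crit_obj (tails M w) = real n * CnG Phi n \<kappa> t1 t2 w err_y - (\<Sum>j<n. (coord Phi n e j)\<^sup>2)"
proof -
  have "real n * CnG Phi n \<kappa> t1 t2 w err_y = sqn n (\<lambda>i. err_y i - fhatG Phi n t1 t2 w err_y i)
      + 2 * sigmahat2 Phi n \<kappa> err_y * (\<Sum>m=1..M. real (kG t1 t2 n m) * w m)"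
    using n1 by (simp add: CnG_def M_def field_simps)
  also have "\<dots> = (\<Sum>m<M. (\<Sum>j\<in>blk K m. (1 - tails M w m)\<^sup>2 * (coord Phi n f j + coord Phi n e j)\<^sup>2)
      + 2 * sigmahat2 Phi n \<kappa> err_y * tails M w m * real (card (blk K m)))"
    unfolding resid_fhatG size_fhatG coord_err_y by (simp add: sum.distrib sum_distrib_left mult_ac)
  finally have 1: "real n * CnG Phi n \<kappa> t1 t2 w err_y - (\<Sum>j<n. (coord Phi n e j)\<^sup>2) =
      (\<Sum>m<M. (\<Sum>j\<in>blk K m. (1 - tails M w m)\<^sup>2 * (coord Phi n f j + coord Phi n e j)\<^sup>2)
      + 2 * sigmahat2 Phi n \<kappa> err_y * tails M w m * real (card (blk K m)) - (\<Sum>j\<in>blk K m. (coord Phi n e j)\<^sup>2))"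
    unfolding sum_blocks[symmetric] by (simp add: sum_subtractf)
  show ?thesis unfolding 1 sequence_crit_block[where v="\<sigma>\<^sup>2"] B.crit_obj_def loss_obj_eq loss_fhatG coord_err_y
    by (simp add: sum.distrib err_D_def)
qed

lemma fluct_eq: "B.fluct = fluctuation K M \<sigma> n (nat \<lfloor>\<kappa> * real n\<rfloor>) (coord Phi n f) (coord Phi n e)"
  unfolding B.fluct_def fluctuation_def sum_card_blk[OF order_refl] K_M
  by (simp add: err_D_def sigmahat2_coord less_imp_le[OF m_less_n] coord_err_y)

lemma mma_loss_upper:
  assumes \<delta>: "0 < \<delta>" "\<delta> \<le> 1/6" and g0: "g 0 = 1" and g: "\<And>m. m < M \<Longrightarrow> 0 \<le> g m"
    "\<And>m. Suc m < M \<Longrightarrow> g (Suc m) \<le> g m"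
  shows "sqn n (\<lambda>i. mmaG Phi n \<kappa> t1 t2 (restrict (\<lambda>i. f i + e i) {..<n}) i - f i) \<le>
    (1 + 16 * \<delta>) * (\<Sum>m<M. (1 - g m)\<^sup>2 * (\<Sum>j\<in>blk K m. (coord Phi n f j)\<^sup>2) + \<sigma>\<^sup>2 * (g m)\<^sup>2 * real (card (blk K m)))
    + 16 * (fluctuation K M \<sigma> n (nat \<lfloor>\<kappa> * real n\<rfloor>) (coord Phi n f) (coord Phi n e) / \<delta>)"
proof -
  obtain v where v: "v \<in> simplexG M" "\<And>m. m < M \<Longrightarrow> tails M v m = g m"
    using weights_with_tails[where g=g, OF M1 g0 g] by blast
  define w where "w = whatG Phi n \<kappa> t1 t2 err_y"
  have w: "w \<in> simplexG M" "CnG Phi n \<kappa> t1 t2 w err_y \<le> CnG Phi n \<kappa> t1 t2 v err_y"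
    using whatG_minimises[of t1 t2 n] M1 v by (auto simp: w_def M_def)
  have "B.loss_obj (tails M w) \<le> (1 + 16 * \<delta>) * B.risk_obj (tails M v) + 16 * (B.fluct / \<delta>)"
  proof (rule B.oracle_inequality[OF \<delta>])
    show "B.crit_obj (tails M w) \<le> B.crit_obj (tails M v)"
      unfolding crit_obj_eq using w(2) n1 by (simp add: mult_left_mono)
    show "0 \<le> B.loss_obj (tails M w)" unfolding loss_obj_eq by (simp add: sqn_def sum_nonneg)
  qed (use tails_bounds w(1) v(1) in auto)
  moreover have "B.risk_obj (tails M v) = (\<Sum>m<M. (1 - g m)\<^sup>2 * (\<Sum>j\<in>blk K m. (coord Phi n f j)\<^sup>2) + \<sigma>\<^sup>2 * (g m)\<^sup>2 * real (card (blk K m)))"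
    unfolding B.risk_obj_def by (simp add: v(2))
  ultimately show ?thesis unfolding loss_obj_eq fluct_eq mmaG_def by (simp add: w_def err_y_def)
qed

text \<open>The assumption bounds the risk for every sequence of factors, so for each fixed noise
  vector it applies to the factors selected by that noise.\<close>

lemma mma_loss_lower:
  assumes \<delta>: "0 < \<delta>" "\<delta> \<le> 1" and B: "\<And>\<gamma>. b \<le> seq_risk \<sigma> n \<gamma> (coord Phi n f)"
  shows "(1 - \<delta>) * b - fluctuation K M \<sigma> n (nat \<lfloor>\<kappa> * real n\<rfloor>) (coord Phi n f) (coord Phi n e) / \<delta> \<le>
    sqn n (\<lambda>i. mmaG Phi n \<kappa> t1 t2 (restrict (\<lambda>i. f i + e i) {..<n}) i - f i)"
proof -
  define w where "w = whatG Phi n \<kappa> t1 t2 err_y"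
  have w: "w \<in> simplexG M" using whatG_minimises[of t1 t2 n] M1 by (auto simp: w_def M_def)
  \<comment> \<open>Spreads the factor of a block over its coordinates; the description is unique
    because the blocks are disjoint.\<close>
  define \<gamma> where "\<gamma> j = tails M w (THE m. m < M \<and> j \<in> blk K m)" for j
  have \<gamma>: "\<gamma> j = tails M w m" if m: "m < M" "j \<in> blk K m" for j m
  proof -
    have "m' = m" if m': "m' < M" "j \<in> blk K m'" for m'
    proof (cases m m' rule: linorder_cases)
      case less
      then show ?thesis using m m' K_mono[of "Suc m" m'] by (simp add: blk_def)
    next
      case greater
      then show ?thesis using m m' K_mono[of "Suc m'" m] by (simp add: blk_def)
    qed simp
    with m have "(THE m. m < M \<and> j \<in> blk K m) = m" by blast
    then show ?thesis by (simp add: \<gamma>_def)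
  qed
  have "seq_risk \<sigma> n \<gamma> (coord Phi n f) = B.risk_obj (tails M w)"
    unfolding seq_risk_def sum_blocks[symmetric] B.risk_obj_def
    by (intro sum.cong refl) (simp add: \<gamma> sum.distrib sum_distrib_left)
  then have "(1 - \<delta>) * b \<le> (1 - \<delta>) * B.risk_obj (tails M w)"
    using B[of \<gamma>] \<delta> by (intro mult_left_mono) auto
  moreover have "(1 - \<delta>) * B.risk_obj (tails M w) - B.fluct / \<delta> \<le> B.loss_obj (tails M w)"
    using tails_bounds[OF w] \<delta> by (intro B.loss_lower) auto
  ultimately show ?thesis unfolding loss_obj_eq fluct_eq mmaG_def by (simp add: w_def err_y_def)
qed

end

text \<open>Blocking a decreasing shrinkage sequence at the left ends of the blocks does not increase the bias;
  the variance of each block is charged to the preceding block, at the price of the ratio of their sizes.\<close>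
lemma blocked_risk:
  assumes \<gamma>: "\<And>j. \<gamma> j \<le> 1" "\<And>j. 0 \<le> \<gamma> j" "\<And>i j. i \<le> j \<Longrightarrow> \<gamma> j \<le> \<gamma> i"
    and \<rho>: "\<And>m. Suc m < M \<Longrightarrow> real (card (blk K (Suc m))) \<le> \<rho> * real (card (blk K m))" "\<rho> \<ge> 1"
  defines "g \<equiv> \<lambda>m. if m = 0 then 1 else \<gamma> (K m)"
  shows "(\<Sum>m<M. (1 - g m)\<^sup>2 * (\<Sum>j\<in>blk K m. (\<mu> j)\<^sup>2) + \<sigma>\<^sup>2 * (g m)\<^sup>2 * real (card (blk K m)))
    \<le> \<rho> * seq_risk \<sigma> n \<gamma> \<mu> + \<sigma>\<^sup>2 * real (K 1)"
proof -
  obtain N where N: "M = Suc N" using M1 by (cases M) auto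
  have b: "(1 - g m)\<^sup>2 * (\<Sum>j\<in>blk K m. (\<mu> j)\<^sup>2) \<le> (\<Sum>j\<in>blk K m. (1 - \<gamma> j)\<^sup>2 * (\<mu> j)\<^sup>2)" for m
    unfolding sum_distrib_left
  proof (rule sum_mono)
    fix j assume "j \<in> blk K m"
    then have "1 - g m \<le> 1 - \<gamma> j" "0 \<le> 1 - g m" using \<gamma> by (auto simp: g_def blk_def)
    then show "(1 - g m)\<^sup>2 * (\<mu> j)\<^sup>2 \<le> (1 - \<gamma> j)\<^sup>2 * (\<mu> j)\<^sup>2" by (intro mult_right_mono power_mono) auto
  qed
  have bias: "(\<Sum>m<M. (1 - g m)\<^sup>2 * (\<Sum>j\<in>blk K m. (\<mu> j)\<^sup>2)) \<le> (\<Sum>j<n. (1 - \<gamma> j)\<^sup>2 * (\<mu> j)\<^sup>2)"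
    unfolding sum_blocks[symmetric] by (intro sum_mono b)
  have v: "(g (Suc m))\<^sup>2 * real (card (blk K (Suc m))) \<le> \<rho> * (\<Sum>j\<in>blk K m. (\<gamma> j)\<^sup>2)" if m: "Suc m < M" for m
  proof -
    have "(g (Suc m))\<^sup>2 * real (card (blk K (Suc m))) \<le> (\<gamma> (K (Suc m)))\<^sup>2 * (\<rho> * real (card (blk K m)))"
      unfolding g_def using \<rho>(1)[OF m] by (simp add: mult_left_mono)
    also have "\<dots> = \<rho> * (\<Sum>j\<in>blk K m. (\<gamma> (K (Suc m)))\<^sup>2)" by simp
    also have "\<dots> \<le> \<rho> * (\<Sum>j\<in>blk K m. (\<gamma> j)\<^sup>2)"
      using \<rho>(2) \<gamma> by (intro mult_left_mono sum_mono power_mono) (auto simp: blk_def)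
    finally show ?thesis .
  qed
  \<comment> \<open>Block 0 has no predecessor that could be charged; its factor is 1 and it pays
    its whole length \<open>K 1\<close>.\<close>
  have "(\<Sum>m<M. (g m)\<^sup>2 * real (card (blk K m))) = real (card (blk K 0)) + (\<Sum>m<N. (g (Suc m))\<^sup>2 * real (card (blk K (Suc m))))"
    unfolding N by (subst sum.lessThan_Suc_shift) (simp add: g_def)
  also have "\<dots> \<le> real (K 1) + (\<Sum>m<N. \<rho> * (\<Sum>j\<in>blk K m. (\<gamma> j)\<^sup>2))"
    using v by (intro add_mono sum_mono) (auto simp: blk_def N)
  also have "(\<Sum>m<N. \<rho> * (\<Sum>j\<in>blk K m. (\<gamma> j)\<^sup>2)) \<le> (\<Sum>m<M. \<rho> * (\<Sum>j\<in>blk K m. (\<gamma> j)\<^sup>2))"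
    unfolding N using \<rho>(2) by (auto intro!: mult_nonneg_nonneg sum_nonneg)
  also have "(\<Sum>m<M. \<rho> * (\<Sum>j\<in>blk K m. (\<gamma> j)\<^sup>2)) = \<rho> * (\<Sum>j<n. (\<gamma> j)\<^sup>2)"
    by (simp add: sum_distrib_left[symmetric] sum_blocks)
  finally have "\<sigma>\<^sup>2 * (\<Sum>m<M. (g m)\<^sup>2 * real (card (blk K m))) \<le> \<sigma>\<^sup>2 * (real (K 1) + \<rho> * (\<Sum>j<n. (\<gamma> j)\<^sup>2))"
    by (intro mult_left_mono) auto
  moreover have "1 * (\<Sum>j<n. (1 - \<gamma> j)\<^sup>2 * (\<mu> j)\<^sup>2) \<le> \<rho> * (\<Sum>j<n. (1 - \<gamma> j)\<^sup>2 * (\<mu> j)\<^sup>2)"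
    using \<rho>(2) by (intro mult_right_mono sum_nonneg) auto
  ultimately show ?thesis using bias
    by (simp add: seq_risk_def sum.distrib sum_distrib_left algebra_simps)
qed

end

section \<open>Moments of the fluctuation\<close>

lemma nn_integral_sq_div_le:
  assumes X: "(\<lambda>z. X z) \<in> borel_measurable N" and I: "(\<integral>\<^sup>+z. ennreal ((X z)\<^sup>2) \<partial>N) \<le> ennreal v"
    and c: "c \<ge> 0"
  shows "(\<integral>\<^sup>+z. ennreal (c * (X z)\<^sup>2) \<partial>N) \<le> ennreal (c * v)"
proof -
  have "(\<integral>\<^sup>+z. ennreal (c * (X z)\<^sup>2) \<partial>N) = ennreal c * (\<integral>\<^sup>+z. ennreal ((X z)\<^sup>2) \<partial>N)"
    using X c by (subst nn_integral_cmult[symmetric]) (auto simp: ennreal_mult)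
  also have "\<dots> \<le> ennreal c * ennreal v" using I by (rule mult_left_mono) simp
  also have "\<dots> = ennreal (c * v)" using c by (simp add: ennreal_mult')
  finally show ?thesis .
qed

lemma nn_integral_add_le:
  assumes "f \<in> borel_measurable N" "g \<in> borel_measurable N" "\<And>z. 0 \<le> f z" "\<And>z. 0 \<le> g z"
    "(\<integral>\<^sup>+z. ennreal (f z) \<partial>N) \<le> ennreal a" "(\<integral>\<^sup>+z. ennreal (g z) \<partial>N) \<le> ennreal b" "0 \<le> a" "0 \<le> b"
  shows "(\<integral>\<^sup>+z. ennreal (f z + g z) \<partial>N) \<le> ennreal (a + b)"
proof -
  have "(\<integral>\<^sup>+z. ennreal (f z + g z) \<partial>N) = (\<integral>\<^sup>+z. ennreal (f z) \<partial>N) + (\<integral>\<^sup>+z. ennreal (g z) \<partial>N)"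
    using assms(1-4) by (subst nn_integral_add[symmetric]) auto
  also have "\<dots> \<le> ennreal a + ennreal b" by (intro add_mono assms)
  finally show ?thesis using assms(7,8) by simp
qed

lemma nn_integral_sum_le:
  assumes "finite A" "\<And>m. m \<in> A \<Longrightarrow> f m \<in> borel_measurable N" "\<And>m z. m \<in> A \<Longrightarrow> 0 \<le> f m z"
    "\<And>m. m \<in> A \<Longrightarrow> (\<integral>\<^sup>+z. ennreal (f m z) \<partial>N) \<le> ennreal a" "0 \<le> a"
  shows "(\<integral>\<^sup>+z. ennreal (\<Sum>m\<in>A. f m z) \<partial>N) \<le> ennreal (real (card A) * a)"
proof -
  have "(\<integral>\<^sup>+z. ennreal (\<Sum>m\<in>A. f m z) \<partial>N) = (\<integral>\<^sup>+z. (\<Sum>m\<in>A. ennreal (f m z)) \<partial>N)"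
    using assms(3) by (intro nn_integral_cong) simp
  also have "\<dots> = (\<Sum>m\<in>A. \<integral>\<^sup>+z. ennreal (f m z) \<partial>N)"
    using assms(2) by (subst nn_integral_sum) auto
  also have "\<dots> \<le> (\<Sum>m\<in>A. ennreal a)" by (intro sum_mono assms)
  also have "\<dots> = ennreal (real (card A) * a)" using assms(5) by (simp add: ennreal_mult' ennreal_of_nat_eq_real_of_nat)
  finally show ?thesis .
qed

lemma measurable_noise_component:
  "j < n \<Longrightarrow> (\<lambda>z. z j) \<in> borel_measurable (noise \<sigma> n)"
  unfolding noise_gauss by measurable

lemma noise_lin_measurable: "J \<subseteq> {..<n} \<Longrightarrow> (\<lambda>z. \<Sum>j\<in>J. m j * z j) \<in> borel_measurable (noise \<sigma> n)"
  by (intro borel_measurable_sum borel_measurable_times borel_measurable_const measurable_noise_component) auto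

lemma noise_quad_measurable: "J \<subseteq> {..<n} \<Longrightarrow> (\<lambda>z. \<Sum>j\<in>J. (z j)\<^sup>2 - c) \<in> borel_measurable (noise \<sigma> n)"
  by (intro borel_measurable_sum borel_measurable_diff borel_measurable_power borel_measurable_const measurable_noise_component) auto

lemma sum_three_sq_le: "((a::real) + 2 * b + c)\<^sup>2 \<le> 3 * a\<^sup>2 + 12 * b\<^sup>2 + 3 * c\<^sup>2"
proof -
  have "0 \<le> (a - 2 * b)\<^sup>2 + (a - c)\<^sup>2 + (2 * b - c)\<^sup>2" by simp
  then show ?thesis by (simp add: power2_eq_square algebra_simps)
qed

context nested_mma
begin

lemma fluctuation_nonneg: "0 \<le> fluctuation K M \<sigma> n k \<mu> z"
  unfolding fluctuation_def by (intro add_nonneg_nonneg sum_nonneg divide_nonneg_nonneg mult_nonneg_nonneg) auto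

definition "kn = nat \<lfloor>\<kappa> * real n\<rfloor>"

lemma n_kn: "real (n - kn) \<ge> (1 - \<kappa>) * real n" "real (n - kn) > 0"
proof -
  have k: "kn < n" using m_less_n by (simp add: kn_def)
  have "real kn \<le> \<kappa> * real n" unfolding kn_def using kappa n1 by (simp add: of_nat_nat)
  then show "real (n - kn) \<ge> (1 - \<kappa>) * real n" using k by (simp add: algebra_simps)
  show "real (n - kn) > 0" using k by simp
qed

text \<open>The error of the variance estimate, times the number of residual coordinates, is centred
  noise energy plus twice a linear noise term plus the bias \<open>b\<close>. The number of these
  coordinates is at least \<open>(1 - \<kappa>) * n\<close>, so the factor \<open>n\<close> in front
  is compensated for the noise energy and the bias retains \<open>b\<^sup>2 / n\<close>. The
  constant 54 is not sharp.\<close>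

lemma variance_error_moment:
  fixes \<mu> :: "nat \<Rightarrow> real"
  defines "b \<equiv> \<Sum>j\<in>{kn..<n}. (\<mu> j)\<^sup>2"
  shows "(\<integral>\<^sup>+z. ennreal (real n * ((\<Sum>j\<in>{kn..<n}. (\<mu> j + z j)\<^sup>2) / real (n - kn) - \<sigma>\<^sup>2)\<^sup>2 / \<sigma>\<^sup>2) \<partial>noise \<sigma> n)
    \<le> ennreal (54 / ((1 - \<kappa>)\<^sup>2 * \<sigma>\<^sup>2) * (\<sigma> ^ 4 + b\<^sup>2 / real n))"
proof -
  let ?J = "{kn..<n}"
  let ?A = "\<lambda>z. \<Sum>j\<in>?J. (z j)\<^sup>2 - \<sigma>\<^sup>2" and ?B = "\<lambda>z. \<Sum>j\<in>?J. \<mu> j * z j"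
  define N where "N = real (n - kn)"
  define c where "c = 3 * real n / (\<sigma>\<^sup>2 * N\<^sup>2)"
  have N: "N > 0" "N \<ge> (1 - \<kappa>) * real n" "N \<le> real n" using n_kn by (auto simp: N_def)
  have c: "c \<ge> 0" by (simp add: c_def)
  have b: "b \<ge> 0" by (simp add: b_def sum_nonneg)
  interpret prob_space "noise \<sigma> n" by (rule prob_noise[OF sigma])
  have J: "?J \<subseteq> {..<n}" by auto
  have pw: "real n * ((\<Sum>j\<in>?J. (\<mu> j + z j)\<^sup>2) / N - \<sigma>\<^sup>2)\<^sup>2 / \<sigma>\<^sup>2 \<le> c * (?A z)\<^sup>2 + (4 * c) * (?B z)\<^sup>2 + c * b\<^sup>2" for z
  proof -
    have "(\<Sum>j\<in>?J. (\<mu> j + z j)\<^sup>2) = ?A z + 2 * ?B z + b + N * \<sigma>\<^sup>2"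
      unfolding b_def N_def
      by (simp add: sum_subtractf power2_sum sum.distrib sum_distrib_left[symmetric] mult.assoc)
    then have "(\<Sum>j\<in>?J. (\<mu> j + z j)\<^sup>2) / N - \<sigma>\<^sup>2 = (?A z + 2 * ?B z + b) / N"
      using N(1) by (simp add: field_simps)
    then have "real n * ((\<Sum>j\<in>?J. (\<mu> j + z j)\<^sup>2) / N - \<sigma>\<^sup>2)\<^sup>2 / \<sigma>\<^sup>2 = (real n / (\<sigma>\<^sup>2 * N\<^sup>2)) * (?A z + 2 * ?B z + b)\<^sup>2"
      by (simp add: power_divide)
    also have "\<dots> \<le> (real n / (\<sigma>\<^sup>2 * N\<^sup>2)) * (3 * (?A z)\<^sup>2 + 12 * (?B z)\<^sup>2 + 3 * b\<^sup>2)"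
      by (intro mult_left_mono sum_three_sq_le) simp
    also have "\<dots> = c * (?A z)\<^sup>2 + (4 * c) * (?B z)\<^sup>2 + c * b\<^sup>2" by (simp add: c_def algebra_simps)
    finally show ?thesis .
  qed
  have cN: "c * N \<le> 3 / ((1 - \<kappa>) * \<sigma>\<^sup>2)" "c \<le> 3 / ((1 - \<kappa>)\<^sup>2 * \<sigma>\<^sup>2) / real n"
  proof -
    define k' where "k' = 1 - \<kappa>"
    have k': "k' > 0" using kappa by (simp add: k'_def)
    have nn: "real n > 0" using n1 by simp
    have "c * N = (3 / \<sigma>\<^sup>2) * (real n / N)" using N(1) by (simp add: c_def power2_eq_square)
    also have "real n / N \<le> 1 / k'" using N nn k' by (simp add: k'_def[symmetric] field_simps)
    finally show "c * N \<le> 3 / ((1 - \<kappa>) * \<sigma>\<^sup>2)" using sigma by (simp add: k'_def mult_left_mono divide_simps mult_ac)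
    have "c = (3 / \<sigma>\<^sup>2) * (real n / N\<^sup>2)" by (simp add: c_def)
    also have "real n / N\<^sup>2 \<le> real n / (k' * real n)\<^sup>2"
      using N nn k' by (intro divide_left_mono power_mono) (auto simp: k'_def)
    also have "\<dots> = 1 / k'\<^sup>2 / real n" using nn by (simp add: power2_eq_square)
    finally show "c \<le> 3 / ((1 - \<kappa>)\<^sup>2 * \<sigma>\<^sup>2) / real n" using sigma nn k' by (simp add: k'_def[symmetric] mult_left_mono divide_simps mult_ac)
  qed
  have "(\<integral>\<^sup>+z. ennreal (real n * ((\<Sum>j\<in>?J. (\<mu> j + z j)\<^sup>2) / N - \<sigma>\<^sup>2)\<^sup>2 / \<sigma>\<^sup>2) \<partial>noise \<sigma> n)
     \<le> (\<integral>\<^sup>+z. ennreal (c * (?A z)\<^sup>2 + (4 * c) * (?B z)\<^sup>2 + c * b\<^sup>2) \<partial>noise \<sigma> n)"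
    by (intro nn_integral_mono ennreal_leI pw)
  also have "\<dots> \<le> ennreal (c * (2 * \<sigma> ^ 4 * real (card ?J)) + (4 * c) * (\<sigma>\<^sup>2 * b) + c * b\<^sup>2)"
  proof (intro nn_integral_add_le)
    show "(\<integral>\<^sup>+z. ennreal (c * (?A z)\<^sup>2) \<partial>noise \<sigma> n) \<le> ennreal (c * (2 * \<sigma> ^ 4 * real (card ?J)))"
      by (intro nn_integral_sq_div_le noise_quad_measurable J c) (simp add: nn_noise_quad_sq[OF sigma J])
    show "(\<integral>\<^sup>+z. ennreal (4 * c * (?B z)\<^sup>2) \<partial>noise \<sigma> n) \<le> ennreal (4 * c * (\<sigma>\<^sup>2 * b))"
      using c by (intro nn_integral_sq_div_le noise_lin_measurable J) (simp_all add: nn_noise_lin_sq[OF sigma J] b_def)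
    show "(\<integral>\<^sup>+z. ennreal (c * b\<^sup>2) \<partial>noise \<sigma> n) \<le> ennreal (c * b\<^sup>2)" by (simp add: emeasure_space_1)
    show "(\<lambda>z. c * (?A z)\<^sup>2) \<in> borel_measurable (noise \<sigma> n)"
      by (intro borel_measurable_times borel_measurable_power borel_measurable_const noise_quad_measurable J)
    show "(\<lambda>z. 4 * c * (?B z)\<^sup>2) \<in> borel_measurable (noise \<sigma> n)"
      by (intro borel_measurable_times borel_measurable_power borel_measurable_const noise_lin_measurable J)
    show "(\<lambda>z. c * (?A z)\<^sup>2 + 4 * c * (?B z)\<^sup>2) \<in> borel_measurable (noise \<sigma> n)"
      by (intro borel_measurable_add borel_measurable_times borel_measurable_power borel_measurable_const noise_lin_measurable noise_quad_measurable J)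
  qed (use c b in auto)
  also have "\<dots> \<le> ennreal (54 / ((1 - \<kappa>)\<^sup>2 * \<sigma>\<^sup>2) * (\<sigma> ^ 4 + b\<^sup>2 / real n))"
  proof (rule ennreal_leI)
    define k' where "k' = 1 - \<kappa>"
    have k': "k' > 0" "k' \<le> 1" using kappa by (auto simp: k'_def)
    have nn: "real n \<ge> 1" using n1 by simp
    have cardJ: "real (card ?J) \<le> real n" by simp
    define h where "h = 3 / (k'\<^sup>2 * \<sigma>\<^sup>2)"
    have h: "h \<ge> 0" by (simp add: h_def)
    have ch: "c \<le> h / real n" using cN(2) by (simp add: h_def k'_def)
    \<comment> \<open>Absorbs the second moment of the linear term, of order \<open>b\<close>, into
      a constant and \<open>b\<^sup>2\<close>.\<close>
    have sq: "4 * (\<sigma>\<^sup>2 * b) \<le> 4 * \<sigma> ^ 4 + b\<^sup>2"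
    proof -
      have "0 \<le> (2 * \<sigma>\<^sup>2 - b)\<^sup>2" by simp
      then show ?thesis by (simp add: power2_eq_square power4_eq_xxxx algebra_simps)
    qed
    have "c * (2 * \<sigma> ^ 4 * real (card ?J)) + (4 * c) * (\<sigma>\<^sup>2 * b) + c * b\<^sup>2 = c * (2 * \<sigma> ^ 4 * real (card ?J) + 4 * (\<sigma>\<^sup>2 * b) + b\<^sup>2)"
      by (simp add: algebra_simps)
    also have "\<dots> \<le> (h / real n) * (2 * \<sigma> ^ 4 * real n + (4 * \<sigma> ^ 4 + b\<^sup>2) + b\<^sup>2)"
      using ch h nn sq cardJ b by (intro mult_mono add_mono mult_left_mono) auto
    also have "\<dots> = h * (2 * \<sigma> ^ 4 + 4 * \<sigma> ^ 4 * (1 / real n) + 2 * (b\<^sup>2 / real n))"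
      using nn by (simp add: field_simps)
    also have "\<dots> \<le> h * (2 * \<sigma> ^ 4 + 4 * \<sigma> ^ 4 * 1 + 2 * (b\<^sup>2 / real n))"
      using nn h by (intro mult_left_mono add_mono) auto
    also have "\<dots> \<le> h * (18 * (\<sigma> ^ 4 + b\<^sup>2 / real n))"
    proof (intro mult_left_mono h)
      have gen: "2 * x + 4 * x * 1 + 2 * y \<le> 18 * (x + y)" if "0 \<le> x" "0 \<le> y" for x y :: real
        using that by simp
      show "2 * \<sigma> ^ 4 + 4 * \<sigma> ^ 4 * 1 + 2 * (b\<^sup>2 / real n) \<le> 18 * (\<sigma> ^ 4 + b\<^sup>2 / real n)"
        by (rule gen) simp_all
    qed
    finally show "c * (2 * \<sigma> ^ 4 * real (card ?J)) + (4 * c) * (\<sigma>\<^sup>2 * b) + c * b\<^sup>2 \<le> 54 / ((1 - \<kappa>)\<^sup>2 * \<sigma>\<^sup>2) * (\<sigma> ^ 4 + b\<^sup>2 / real n)"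
      by (simp add: h_def k'_def)
  qed
  finally show ?thesis by (simp add: N_def)
qed

lemma blk_subset: "m < M \<Longrightarrow> blk K m \<subseteq> {..<n}" using blk_less by auto

lemma fluctuation_measurable: "fluctuation K M \<sigma> n kn \<mu> \<in> borel_measurable (PiM {..<n} (\<lambda>_. borel))"
proof -
  have "fluctuation K M \<sigma> n kn \<mu> \<in> borel_measurable (noise \<sigma> n)"
    unfolding fluctuation_def using n_kn
    by (intro borel_measurable_add borel_measurable_sum borel_measurable_divide borel_measurable_times borel_measurable_power
        borel_measurable_diff borel_measurable_const measurable_noise_component) (auto dest: blk_less)
  then show ?thesis by (simp cong: measurable_cong_sets add: sets_noise)
qed

text \<open>Each quotient in \<open>fluctuation\<close> is normalised by its own variance up to a
  constant: a block contributes \<open>2 * \<sigma>\<^sup>2\<close> through the noise energy and at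
  most \<open>\<sigma>\<^sup>2\<close> through the cross term, independently of its size.\<close>

lemma fluctuation_moment:
  fixes \<mu> :: "nat \<Rightarrow> real"
  defines "b \<equiv> \<Sum>j\<in>{kn..<n}. (\<mu> j)\<^sup>2"
  shows "(\<integral>\<^sup>+z. ennreal (fluctuation K M \<sigma> n kn \<mu> z) \<partial>noise \<sigma> n)
    \<le> ennreal (3 * \<sigma>\<^sup>2 * real M + 54 / ((1 - \<kappa>)\<^sup>2 * \<sigma>\<^sup>2) * (\<sigma> ^ 4 + b\<^sup>2 / real n))"
proof -
  let ?N = "noise \<sigma> n"
  have T: "(\<integral>\<^sup>+z. ennreal ((\<Sum>j\<in>blk K m. (z j)\<^sup>2 - \<sigma>\<^sup>2)\<^sup>2 / (\<sigma>\<^sup>2 * real (card (blk K m)))) \<partial>?N) \<le> ennreal (2 * \<sigma>\<^sup>2)" if m: "m < M" for m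
  proof -
    have c: "card (blk K m) > 0" using K_step[OF m] by (simp add: blk_def)
    have "(\<integral>\<^sup>+z. ennreal (1 / (\<sigma>\<^sup>2 * real (card (blk K m))) * (\<Sum>j\<in>blk K m. (z j)\<^sup>2 - \<sigma>\<^sup>2)\<^sup>2) \<partial>?N)
      \<le> ennreal (1 / (\<sigma>\<^sup>2 * real (card (blk K m))) * (2 * \<sigma> ^ 4 * real (card (blk K m))))"
      by (intro nn_integral_sq_div_le noise_quad_measurable blk_subset m) (simp_all add: nn_noise_quad_sq[OF sigma blk_subset[OF m]])
    also have "1 / (\<sigma>\<^sup>2 * real (card (blk K m))) * (2 * \<sigma> ^ 4 * real (card (blk K m))) = 2 * \<sigma>\<^sup>2"
      using c sigma by (simp add: power2_eq_square power4_eq_xxxx)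
    finally show ?thesis by simp
  qed
  have S: "(\<integral>\<^sup>+z. ennreal ((\<Sum>j\<in>blk K m. \<mu> j * z j)\<^sup>2 / (\<Sum>j\<in>blk K m. (\<mu> j)\<^sup>2)) \<partial>?N) \<le> ennreal (\<sigma>\<^sup>2)" if m: "m < M" for m
  proof -
    let ?u = "\<Sum>j\<in>blk K m. (\<mu> j)\<^sup>2"
    have u: "?u \<ge> 0" by (simp add: sum_nonneg)
    have "(\<integral>\<^sup>+z. ennreal (1 / ?u * (\<Sum>j\<in>blk K m. \<mu> j * z j)\<^sup>2) \<partial>?N) \<le> ennreal (1 / ?u * (\<sigma>\<^sup>2 * ?u))"
      using u by (intro nn_integral_sq_div_le noise_lin_measurable blk_subset m) (simp_all add: nn_noise_lin_sq[OF sigma blk_subset[OF m]])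
    \<comment> \<open>A block without signal contributes 0, by the convention for division.\<close>
    also have "\<dots> \<le> ennreal (\<sigma>\<^sup>2)" by (intro ennreal_leI) (cases "?u = 0", auto)
    finally show ?thesis by simp
  qed
  have mT: "(\<lambda>z. (\<Sum>j\<in>blk K m. (z j)\<^sup>2 - \<sigma>\<^sup>2)\<^sup>2 / (\<sigma>\<^sup>2 * real (card (blk K m)))) \<in> borel_measurable ?N" if "m < M" for m
    by (intro borel_measurable_divide borel_measurable_power borel_measurable_const noise_quad_measurable blk_subset that)
  have mS: "(\<lambda>z. (\<Sum>j\<in>blk K m. \<mu> j * z j)\<^sup>2 / (\<Sum>j\<in>blk K m. (\<mu> j)\<^sup>2)) \<in> borel_measurable ?N" if "m < M" for m
    by (intro borel_measurable_divide borel_measurable_power borel_measurable_const noise_lin_measurable blk_subset that)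
  have mD: "(\<lambda>z. real n * ((\<Sum>j\<in>{kn..<n}. (\<mu> j + z j)\<^sup>2) / real (n - kn) - \<sigma>\<^sup>2)\<^sup>2 / \<sigma>\<^sup>2) \<in> borel_measurable ?N"
    by (intro borel_measurable_sum borel_measurable_divide borel_measurable_times borel_measurable_power borel_measurable_add
        borel_measurable_diff borel_measurable_const measurable_noise_component) auto
  have "(\<integral>\<^sup>+z. ennreal (fluctuation K M \<sigma> n kn \<mu> z) \<partial>?N)
    \<le> ennreal (real (card {..<M}) * (2 * \<sigma>\<^sup>2) + real (card {..<M}) * \<sigma>\<^sup>2 + 54 / ((1 - \<kappa>)\<^sup>2 * \<sigma>\<^sup>2) * (\<sigma> ^ 4 + b\<^sup>2 / real n))"
    unfolding fluctuation_def b_def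
    by (intro nn_integral_add_le nn_integral_sum_le variance_error_moment borel_measurable_add borel_measurable_sum mD mT mS T S)
      (auto intro!: sum_nonneg add_nonneg_nonneg divide_nonneg_nonneg)
  also have "real (card {..<M}) * (2 * \<sigma>\<^sup>2) + real (card {..<M}) * \<sigma>\<^sup>2 = 3 * \<sigma>\<^sup>2 * real M" by (simp add: algebra_simps)
  finally show ?thesis .
qed

end

section \<open>The grouped candidate set\<close>

lemma cumG_Suc:
  assumes "1 \<le> m"
  shows "cumG t1 t2 n (Suc m) = cumG t1 t2 n m + nat \<lfloor>real (k1G t1 t2 n) * (1 + zetaG t1 t2 n) ^ m\<rfloor>"
  using assms by (simp add: cumG_def)

context
  fixes t1 t2 :: real and n :: nat and \<zeta> :: real
  assumes z_def: "\<zeta> = zetaG t1 t2 n" and z: "0 < \<zeta>" "\<zeta> \<le> 1/2" and n1: "1 \<le> n"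
begin

lemma k1G_bounds: "1 \<le> \<zeta> * real (k1G t1 t2 n)" "real (k1G t1 t2 n) \<le> 1 / \<zeta> + 1" "1 \<le> k1G t1 t2 n"
proof -
  have p: "1 / \<zeta> > 0" using z by simp
  then have c: "real (k1G t1 t2 n) = of_int \<lceil>1 / \<zeta>\<rceil>" by (simp add: k1G_def z_def)
  have "1 / \<zeta> \<le> real (k1G t1 t2 n)" unfolding c by linarith
  then show "1 \<le> \<zeta> * real (k1G t1 t2 n)" using z by (simp add: field_simps)
  then show "1 \<le> k1G t1 t2 n" using z by (cases "k1G t1 t2 n") auto
  show "real (k1G t1 t2 n) \<le> 1 / \<zeta> + 1" unfolding c by linarith
qed

text \<open>The choice of the first size gives \<open>\<zeta> * k1G \<ge> 1\<close>. The floor loses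
  at most 1 and hence at most the fraction \<zeta> of the increment.\<close>

lemma increment_bounds:
  "(1 - \<zeta>) * (real (k1G t1 t2 n) * (1 + \<zeta>) ^ m) \<le> real (nat \<lfloor>real (k1G t1 t2 n) * (1 + \<zeta>) ^ m\<rfloor>)"
  "real (nat \<lfloor>real (k1G t1 t2 n) * (1 + \<zeta>) ^ m\<rfloor>) \<le> real (k1G t1 t2 n) * (1 + \<zeta>) ^ m"
  "1 \<le> nat \<lfloor>real (k1G t1 t2 n) * (1 + \<zeta>) ^ m\<rfloor>"
proof -
  let ?x = "real (k1G t1 t2 n) * (1 + \<zeta>) ^ m"
  have p1: "1 \<le> (1 + \<zeta>) ^ m" using z by (intro one_le_power) simp
  have "1 * 1 \<le> (\<zeta> * real (k1G t1 t2 n)) * (1 + \<zeta>) ^ m"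
    using k1G_bounds(1) p1 by (intro mult_mono) auto
  then have "1 \<le> \<zeta> * ?x" by (simp add: mult.assoc)
  moreover have "1 * 1 \<le> ?x" using k1G_bounds(3) p1 by (intro mult_mono) auto
  moreover have "real (nat \<lfloor>?x\<rfloor>) = of_int \<lfloor>?x\<rfloor>" using \<open>1 * 1 \<le> ?x\<close> by (subst of_nat_nat) auto
  ultimately show "(1 - \<zeta>) * ?x \<le> real (nat \<lfloor>?x\<rfloor>)" "real (nat \<lfloor>?x\<rfloor>) \<le> ?x" "1 \<le> nat \<lfloor>?x\<rfloor>"
    by (simp_all add: algebra_simps le_nat_iff le_floor_iff) linarith
qed

text \<open>This crude growth ensures that the minimum defining \<open>MG\<close> exists:
  \<open>m = n\<close> qualifies.\<close>

lemma cumG_ge: "1 \<le> m \<Longrightarrow> m \<le> cumG t1 t2 n m"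
proof (induction m rule: dec_induct)
  case base
  then show ?case using k1G_bounds(3) by (simp add: cumG_def)
next
  case (step m)
  then show ?case using increment_bounds(3)[of m] by (simp add: cumG_Suc flip: z_def)
qed

lemma MG_props: "1 \<le> MG t1 t2 n" "n \<le> cumG t1 t2 n (MG t1 t2 n)"
  "1 \<le> m \<Longrightarrow> m < MG t1 t2 n \<Longrightarrow> cumG t1 t2 n m < n"
proof -
  have "1 \<le> n \<and> n \<le> cumG t1 t2 n n" using cumG_ge[OF n1] n1 by simp
  from LeastI[of "\<lambda>m. 1 \<le> m \<and> n \<le> cumG t1 t2 n m", OF this]
  show "1 \<le> MG t1 t2 n" "n \<le> cumG t1 t2 n (MG t1 t2 n)" by (auto simp: MG_def)
  show "cumG t1 t2 n m < n" if "1 \<le> m" "m < MG t1 t2 n"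
    using not_less_Least[of m "\<lambda>m. 1 \<le> m \<and> n \<le> cumG t1 t2 n m"] that by (auto simp: MG_def not_le)
qed

lemma cuts_step: "m < MG t1 t2 n \<Longrightarrow> cuts t1 t2 n m < cuts t1 t2 n (Suc m)"
proof -
  assume m: "m < MG t1 t2 n"
  show ?thesis
  proof (cases "m = 0")
    case True
    then show ?thesis using k1G_bounds(3) n1 by (auto simp: cuts_def kG_def cumG_def)
  next
    case False
    then have "cumG t1 t2 n m < cumG t1 t2 n (Suc m)"
      using increment_bounds(3)[of m] cumG_Suc[of m t1 t2 n] unfolding z_def by linarith
    then show ?thesis using False m MG_props(3)[of m] by (auto simp: cuts_def kG_def)
  qed
qed

text \<open>The numerator of the ratio is the geometric growth and the denominator the loss by
  rounding.\<close>

lemma blk_ratio: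
  assumes m: "Suc m < MG t1 t2 n"
  shows "real (card (blk (cuts t1 t2 n) (Suc m))) \<le> (1 + \<zeta>) / (1 - \<zeta>) * real (card (blk (cuts t1 t2 n) m))"
proof -
  let ?k = "real (k1G t1 t2 n)"
  \<comment> \<open>Only an inequality, because the last block is cut off at
    \<open>n\<close>.\<close>
  have "card (blk (cuts t1 t2 n) (Suc m)) \<le> nat \<lfloor>?k * (1 + \<zeta>) ^ Suc m\<rfloor>"
    using m MG_props(2) MG_props(3)[of "Suc m"] cumG_Suc[of "Suc m" t1 t2 n]
    by (auto simp: blk_def cuts_def kG_def simp flip: z_def)
  then have "real (card (blk (cuts t1 t2 n) (Suc m))) \<le> real (nat \<lfloor>?k * (1 + \<zeta>) ^ Suc m\<rfloor>)"
    by (rule of_nat_mono)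
  also have "\<dots> \<le> ?k * (1 + \<zeta>) ^ Suc m" by (rule increment_bounds)
  also have "\<dots> = (1 + \<zeta>) / (1 - \<zeta>) * ((1 - \<zeta>) * (?k * (1 + \<zeta>) ^ m))" using z by (simp add: field_simps)
  also have "\<dots> \<le> (1 + \<zeta>) / (1 - \<zeta>) * real (card (blk (cuts t1 t2 n) m))"
  proof (intro mult_left_mono)
    show "(1 - \<zeta>) * (?k * (1 + \<zeta>) ^ m) \<le> real (card (blk (cuts t1 t2 n) m))"
    proof (cases "m = 0")
      case True
      then have "card (blk (cuts t1 t2 n) m) = k1G t1 t2 n" using m by (simp add: blk_def cuts_def kG_def cumG_def)
      then show ?thesis using z True by (simp add: algebra_simps)
    next
      case False
      then have "card (blk (cuts t1 t2 n) m) = nat \<lfloor>?k * (1 + \<zeta>) ^ m\<rfloor>"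
        using m cumG_Suc[of m t1 t2 n] by (simp add: blk_def cuts_def kG_def flip: z_def)
      then show ?thesis using increment_bounds(1)[of m] by simp
    qed
  qed (use z in auto)
  finally show ?thesis .
qed

lemma cuts_1: "real (cuts t1 t2 n 1) \<le> 1 / \<zeta> + 1"
proof -
  have "cuts t1 t2 n 1 \<le> k1G t1 t2 n" using MG_props(2) by (auto simp: cuts_def kG_def cumG_def)
  then show ?thesis using k1G_bounds(2) by linarith
qed

text \<open>The last increment below \<open>n\<close> has grown geometrically, which bounds its
  exponent by \<open>ln (2 * n) / ln (1 + \<zeta>)\<close>; for \<zeta> \<le> 1/2 the denominator is
  at least \<open>\<zeta> / 2\<close>.\<close>

lemma MG_le: "real (MG t1 t2 n) \<le> 2 + 2 * ln (2 * real n) / \<zeta>"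
proof (cases "MG t1 t2 n \<le> 2")
  case True
  have "0 \<le> 2 * ln (2 * real n) / \<zeta>" using n1 z by simp
  then show ?thesis using True by linarith
next
  case False
  \<comment> \<open>Model \<open>MG - 1\<close>, which is \<open>Suc p\<close>, is the last one
    smaller than \<open>n\<close>, and its increment has exponent \<open>p\<close>.\<close>
  define p where "p = MG t1 t2 n - 2"
  have p: "MG t1 t2 n = Suc (Suc p)" "1 \<le> p" using False by (auto simp: p_def)
  let ?k = "real (k1G t1 t2 n)"
  have "nat \<lfloor>?k * (1 + \<zeta>) ^ p\<rfloor> < n"
    using MG_props(3)[of "Suc p"] cumG_Suc[of p t1 t2 n] p by (simp flip: z_def)
  then have "(1 - \<zeta>) * (?k * (1 + \<zeta>) ^ p) < real n"
    using increment_bounds(1)[of p] by linarith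
  moreover have "(1/2) * (1 * (1 + \<zeta>) ^ p) \<le> (1 - \<zeta>) * (?k * (1 + \<zeta>) ^ p)"
    using z k1G_bounds(3) by (intro mult_mono) auto
  ultimately have "(1 + \<zeta>) ^ p \<le> 2 * real n" by simp
  then have "ln ((1 + \<zeta>) ^ p) \<le> ln (2 * real n)" using z n1 by (subst ln_le_cancel_iff) auto
  then have 1: "real p * ln (1 + \<zeta>) \<le> ln (2 * real n)" using z by (simp add: ln_realpow)
  have "\<zeta> * \<zeta> \<le> (1/2) * \<zeta>" using z by (intro mult_right_mono) auto
  moreover have "\<zeta> - \<zeta> * \<zeta> \<le> ln (1 + \<zeta>)" using ln_one_plus_pos_lower_bound[of \<zeta>] z by (simp add: power2_eq_square)
  ultimately have "\<zeta> / 2 \<le> ln (1 + \<zeta>)" by linarith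
  then have "real p * (\<zeta> / 2) \<le> ln (2 * real n)" using 1 mult_left_mono[of "\<zeta> / 2" "ln (1 + \<zeta>)" "real p"] by linarith
  then have "real p \<le> 2 * ln (2 * real n) / \<zeta>" using z by (simp add: field_simps)
  then show ?thesis using p by simp
qed

end

section \<open>From pointwise bounds on the loss to bounds on the risk\<close>

lemma fluctuation_cong:
  assumes "\<And>j. j < n \<Longrightarrow> z j = z' j" "\<And>j. j < n \<Longrightarrow> \<mu> j = \<mu>' j" "\<And>m j. m < M \<Longrightarrow> j \<in> blk K m \<Longrightarrow> j < n"
  shows "fluctuation K M \<sigma> n k \<mu> z = fluctuation K M \<sigma> n k \<mu>' z'"
  unfolding fluctuation_def using assms by simp

context nested_mma
begin

lemma risk_le_of_loss_le:
  assumes le: "\<And>e. sqn n (\<lambda>i. g (restrict (\<lambda>i. f i + e i) {..<n}) i - f i) \<le> a + c * fluctuation K M \<sigma> n kn \<mu> (coord Phi n e)"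
    and a: "0 \<le> a" and c: "0 \<le> c" and W: "(\<integral>\<^sup>+z. ennreal (fluctuation K M \<sigma> n kn \<mu> z) \<partial>noise \<sigma> n) \<le> ennreal w" "0 \<le> w"
  shows "risk \<sigma> n g f \<le> ennreal ((a + c * w) / real n)"
proof -
  interpret prob_space "noise \<sigma> n" by (rule prob_noise[OF sigma])
  let ?W = "fluctuation K M \<sigma> n kn \<mu>"
  note m = fluctuation_measurable[of \<mu>]
  have m': "?W \<in> borel_measurable (noise \<sigma> n)" using m by (simp cong: measurable_cong_sets add: sets_noise)
  have r: "?W (coord Phi n e) = ?W (rot Phi n e)" for e
    by (rule fluctuation_cong) (auto simp: rot_def dest: blk_less)
  have "risk \<sigma> n g f \<le> (\<integral>\<^sup>+e. ennreal ((a + c * ?W (rot Phi n e)) / real n) \<partial>noise \<sigma> n)"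
    unfolding risk_def r[symmetric] using le by (intro nn_integral_mono ennreal_leI divide_right_mono) auto
  also have "\<dots> = (\<integral>\<^sup>+z. ennreal ((a + c * ?W z) / real n) \<partial>noise \<sigma> n)"
    by (rule nn_integral_noise_rot[OF sigma])
      (intro measurable_compose[OF _ measurable_ennreal] borel_measurable_divide borel_measurable_add borel_measurable_times borel_measurable_const m)
  also have "\<dots> = (\<integral>\<^sup>+z. ennreal (a / real n) + ennreal (c / real n) * ennreal (?W z) \<partial>noise \<sigma> n)"
    using a c fluctuation_nonneg by (intro nn_integral_cong) (simp add: ennreal_plus[symmetric] ennreal_mult[symmetric] add_divide_distrib del: ennreal_plus)
  also have "\<dots> = ennreal (a / real n) + ennreal (c / real n) * (\<integral>\<^sup>+z. ennreal (?W z) \<partial>noise \<sigma> n)"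
    using m' by (subst nn_integral_add) (auto simp: emeasure_space_1 nn_integral_cmult)
  also have "\<dots> \<le> ennreal (a / real n) + ennreal (c / real n) * ennreal w"
    by (intro add_left_mono mult_left_mono W) simp
  also have "\<dots> = ennreal ((a + c * w) / real n)"
    using a c W(2) by (simp add: ennreal_plus[symmetric] ennreal_mult[symmetric] add_divide_distrib del: ennreal_plus)
  finally show ?thesis .
qed

text \<open>\<open>nn_integral_mono\<close> asks for no measurability, so \<open>g\<close> may be
  the estimator whose weights are picked by \<open>SOME\<close>; the measurable minorant is
  transformed by the rotation in its place.\<close>

lemma risk_ge_of_loss_ge:
  assumes ge: "\<And>e. a - c * fluctuation K M \<sigma> n kn \<mu> (coord Phi n e) \<le> sqn n (\<lambda>i. g (restrict (\<lambda>i. f i + e i) {..<n}) i - f i)"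
    and c: "0 \<le> c" and W: "(\<integral>\<^sup>+z. ennreal (fluctuation K M \<sigma> n kn \<mu> z) \<partial>noise \<sigma> n) \<le> ennreal w" "0 \<le> w"
  shows "ennreal ((a - c * w) / real n) \<le> risk \<sigma> n g f"
proof -
  interpret prob_space "noise \<sigma> n" by (rule prob_noise[OF sigma])
  let ?W = "fluctuation K M \<sigma> n kn \<mu>"
  note m = fluctuation_measurable[of \<mu>]
  have m': "?W \<in> borel_measurable (noise \<sigma> n)" using m by (simp cong: measurable_cong_sets add: sets_noise)
  have r: "?W (coord Phi n e) = ?W (rot Phi n e)" for e
    by (rule fluctuation_cong) (auto simp: rot_def dest: blk_less)
  have m2: "(\<lambda>z. ennreal ((a - c * ?W z) / real n)) \<in> borel_measurable (PiM {..<n} (\<lambda>_. borel))"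
    by (intro measurable_compose[OF _ measurable_ennreal] borel_measurable_divide borel_measurable_diff borel_measurable_times borel_measurable_const m)
  have m3: "(\<lambda>z. ennreal ((a - c * ?W z) / real n)) \<in> borel_measurable (noise \<sigma> n)"
    using m2 by (simp cong: measurable_cong_sets add: sets_noise)
  have "ennreal (a / real n) = (\<integral>\<^sup>+z. ennreal (a / real n) \<partial>noise \<sigma> n)" by (simp add: emeasure_space_1)
  \<comment> \<open>\<open>ennreal\<close> truncates negative values to 0, so the minorant is not
    linear in \<open>?W\<close>. The constant is therefore bounded by truncated minorant plus
    fluctuation, and the mean of the latter is subtracted after integration.\<close>
  also have "\<dots> \<le> (\<integral>\<^sup>+z. ennreal ((a - c * ?W z) / real n) + ennreal (c / real n) * ennreal (?W z) \<partial>noise \<sigma> n)"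
  proof (rule nn_integral_mono)
    fix z
    have "a / real n = (a - c * ?W z) / real n + c / real n * ?W z" using n1 by (simp add: field_simps)
    then have "ennreal (a / real n) \<le> ennreal ((a - c * ?W z) / real n) + ennreal (c / real n * ?W z)"
      using c fluctuation_nonneg[of kn \<mu> z] by (cases "0 \<le> (a - c * ?W z) / real n")
        (auto simp: ennreal_plus[symmetric] ennreal_neg intro!: ennreal_leI simp del: ennreal_plus)
    then show "ennreal (a / real n) \<le> ennreal ((a - c * ?W z) / real n) + ennreal (c / real n) * ennreal (?W z)"
      using c by (simp add: ennreal_mult'[symmetric])
  qed
  also have "\<dots> = (\<integral>\<^sup>+z. ennreal ((a - c * ?W z) / real n) \<partial>noise \<sigma> n) + ennreal (c / real n) * (\<integral>\<^sup>+z. ennreal (?W z) \<partial>noise \<sigma> n)"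
    using m' m3 by (subst nn_integral_add) (auto simp: nn_integral_cmult)
  also have "(\<integral>\<^sup>+z. ennreal ((a - c * ?W z) / real n) \<partial>noise \<sigma> n) = (\<integral>\<^sup>+e. ennreal ((a - c * ?W (rot Phi n e)) / real n) \<partial>noise \<sigma> n)"
    by (rule nn_integral_noise_rot[OF sigma m2, symmetric])
  also have "\<dots> \<le> risk \<sigma> n g f"
    unfolding risk_def r[symmetric] using ge by (intro nn_integral_mono ennreal_leI divide_right_mono) auto
  also have "ennreal (c / real n) * (\<integral>\<^sup>+z. ennreal (?W z) \<partial>noise \<sigma> n) \<le> ennreal (c / real n) * ennreal w"
    by (intro mult_left_mono W) simp
  also have "\<dots> = ennreal (c * w / real n)" using c by (simp add: ennreal_mult'[symmetric])
  finally have "ennreal (a / real n) \<le> risk \<sigma> n g f + ennreal (c * w / real n)" by (simp add: add_right_mono)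
  then have "ennreal (a / real n) - ennreal (c * w / real n) \<le> risk \<sigma> n g f"
    by (simp add: ennreal_minus_le_iff add.commute)
  then show ?thesis using c W(2) by (simp add: ennreal_minus diff_divide_distrib)
qed

end

section \<open>Asymptotics at a saddle point\<close>

lemma FTheta_coord:
  assumes "orthonormal_rows Phi n" "f \<in> FTheta Phi n Th"
  obtains \<theta> where "\<theta> \<in> Th" "\<And>j. j < n \<Longrightarrow> coord Phi n f j = sqrt (real n) * \<theta> j"
proof -
  interpret orthonormal_rows Phi n by fact
  obtain \<theta> where \<theta>: "\<theta> \<in> Th" "f = (\<lambda>i. sqrt (real n) * (\<Sum>j<n. \<theta> j * Phi j i))"
    using assms(2) by (auto simp: FTheta_def)
  have "f = (\<lambda>i. \<Sum>l<n. (sqrt (real n) * \<theta> l) * Phi l i)"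
    by (simp add: \<theta>(2) sum_distrib_left mult.assoc)
  then show ?thesis using that \<theta>(1) coord_synth by simp
qed

lemma synth_in_FTheta:
  assumes "orthonormal_rows Phi n" "\<theta> \<in> Th"
  obtains f where "f \<in> FTheta Phi n Th" "\<And>j. j < n \<Longrightarrow> coord Phi n f j = sqrt (real n) * \<theta> j"
proof -
  interpret orthonormal_rows Phi n by fact
  let ?f = "\<lambda>i. sqrt (real n) * (\<Sum>j<n. \<theta> j * Phi j i)"
  have "?f = (\<lambda>i. \<Sum>l<n. (sqrt (real n) * \<theta> l) * Phi l i)"
    by (simp add: sum_distrib_left mult.assoc)
  then have "coord Phi n ?f j = sqrt (real n) * \<theta> j" if "j < n" for j using coord_synth[OF that] by simp
  moreover have "?f \<in> FTheta Phi n Th" using assms(2) by (auto simp: FTheta_def)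
  ultimately show ?thesis using that by blast
qed

lemma seq_risk_cong: "(\<And>j. j < n \<Longrightarrow> \<mu> j = \<mu>' j) \<Longrightarrow> seq_risk \<sigma> n \<gamma> \<mu> = seq_risk \<sigma> n \<gamma> \<mu>'"
  by (simp add: seq_risk_def)

text \<open>The order of limits: for fixed \<delta> the error \<open>E n / \<delta>\<close> vanishes
  as \<open>n\<close> grows, and only the tolerance around 1 decides how small \<delta> is.\<close>

lemma tendsto_one_from_bounds:
  fixes X A E :: "nat \<Rightarrow> real"
  assumes A: "A \<longlonglongrightarrow> 1" and E: "E \<longlonglongrightarrow> 0"
    and lo: "\<And>\<delta>. 0 < \<delta> \<Longrightarrow> \<delta> \<le> 1/6 \<Longrightarrow> eventually (\<lambda>n. (1 - \<delta>) - E n / \<delta> \<le> X n) sequentially"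
    and up: "\<And>\<delta>. 0 < \<delta> \<Longrightarrow> \<delta> \<le> 1/6 \<Longrightarrow> eventually (\<lambda>n. X n \<le> (1 + 16 * \<delta>) * A n + 16 * E n / \<delta>) sequentially"
  shows "X \<longlonglongrightarrow> 1"
proof (rule order_tendstoI)
  fix a :: real assume a: "a < 1"
  define \<delta> where "\<delta> = min (1/6) ((1 - a) / 2)"
  have "\<delta> \<le> (1 - a) / 2" unfolding \<delta>_def by (rule min.cobounded2)
  then have "a < 1 - \<delta>" using a by (simp add: field_simps)
  moreover have "0 < \<delta>" "\<delta> \<le> 1/6" using a by (simp_all add: \<delta>_def)
  ultimately have \<delta>: "0 < \<delta>" "\<delta> \<le> 1/6" "a < 1 - \<delta>" by blast+
  have "(\<lambda>n. (1 - \<delta>) - E n / \<delta>) \<longlonglongrightarrow> (1 - \<delta>) - 0 / \<delta>" using E \<delta> by (intro tendsto_intros) auto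
  then have "eventually (\<lambda>n. a < (1 - \<delta>) - E n / \<delta>) sequentially" using \<delta>(3) by (intro order_tendstoD) auto
  with lo[OF \<delta>(1,2)] show "eventually (\<lambda>n. a < X n) sequentially" by eventually_elim simp
next
  fix a :: real assume a: "1 < a"
  \<comment> \<open>Makes \<open>16 * \<delta>\<close> at most half the distance of \<open>a\<close>
    from 1.\<close>
  define \<delta> where "\<delta> = min (1/6) ((a - 1) / 32)"
  have "\<delta> \<le> (a - 1) / 32" unfolding \<delta>_def by (rule min.cobounded2)
  then have "1 + 16 * \<delta> < a" using a by (simp add: field_simps)
  moreover have "0 < \<delta>" "\<delta> \<le> 1/6" using a by (simp_all add: \<delta>_def)
  ultimately have \<delta>: "0 < \<delta>" "\<delta> \<le> 1/6" "1 + 16 * \<delta> < a" by blast+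
  have "(\<lambda>n. (1 + 16 * \<delta>) * A n + 16 * E n / \<delta>) \<longlonglongrightarrow> (1 + 16 * \<delta>) * 1 + 16 * 0 / \<delta>" using E A \<delta> by (intro tendsto_intros) auto
  then have "eventually (\<lambda>n. (1 + 16 * \<delta>) * A n + 16 * E n / \<delta> < a) sequentially" using \<delta>(3) by (intro order_tendstoD) auto
  with up[OF \<delta>(1,2)] show "eventually (\<lambda>n. X n < a) sequentially" by eventually_elim simp
qed

lemma zetaG_asymp:
  assumes "t1 > 0" "t2 > 0"
  shows "eventually (\<lambda>n. 0 < zetaG t1 t2 n \<and> zetaG t1 t2 n \<le> 1/2) sequentially"
    "(\<lambda>n. (1 + zetaG t1 t2 n) / (1 - zetaG t1 t2 n)) \<longlonglongrightarrow> 1"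
    "\<beta> > 0 \<Longrightarrow> (\<lambda>n. (1 / zetaG t1 t2 n + 1) / real n powr \<beta>) \<longlonglongrightarrow> 0"
    "\<beta> > 0 \<Longrightarrow> (\<lambda>n. (2 + 2 * ln (2 * real n) / zetaG t1 t2 n) / real n powr \<beta>) \<longlonglongrightarrow> 0"
proof -
  have "eventually (\<lambda>n. 0 < zetaG t1 t2 n) sequentially" "eventually (\<lambda>n. zetaG t1 t2 n \<le> 1/2) sequentially"
    unfolding zetaG_def using assms by real_asymp+
  then show "eventually (\<lambda>n. 0 < zetaG t1 t2 n \<and> zetaG t1 t2 n \<le> 1/2) sequentially" by eventually_elim simp
  show "(\<lambda>n. (1 + zetaG t1 t2 n) / (1 - zetaG t1 t2 n)) \<longlonglongrightarrow> 1"
    unfolding zetaG_def using assms by real_asymp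
  show "(\<lambda>n. (1 / zetaG t1 t2 n + 1) / real n powr \<beta>) \<longlonglongrightarrow> 0" if "\<beta> > 0"
    unfolding zetaG_def using assms that by real_asymp
  show "(\<lambda>n. (2 + 2 * ln (2 * real n) / zetaG t1 t2 n) / real n powr \<beta>) \<longlonglongrightarrow> 0" if "\<beta> > 0"
    unfolding zetaG_def using assms that by real_asymp
qed

text \<open>The least favourable sequence \<open>th n\<close> and the monotone weights \<open>\<gamma> n\<close> form a saddle point with
  value \<open>V n\<close>, on the scale of \<open>n\<close> times the risk.\<close>
proposition mma_sup_risk_asymp:
  fixes Phi :: "nat \<Rightarrow> nat \<Rightarrow> nat \<Rightarrow> real" and Th :: "nat \<Rightarrow> (nat \<Rightarrow> real) set"
    and \<gamma> th :: "nat \<Rightarrow> nat \<Rightarrow> real" and V b :: "nat \<Rightarrow> real"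
  assumes onb: "\<And>n. orthonormal_rows (Phi n) n"
    and s: "\<sigma> > 0" and kappa: "0 < \<kappa>" "\<kappa> < 1" and t: "t1 > 0" "t2 > 0"
    and \<gamma>: "\<And>n j. n \<ge> 1 \<Longrightarrow> 0 \<le> \<gamma> n j" "\<And>n j. n \<ge> 1 \<Longrightarrow> \<gamma> n j \<le> 1" "\<And>n i j. n \<ge> 1 \<Longrightarrow> i \<le> j \<Longrightarrow> \<gamma> n j \<le> \<gamma> n i"
    and up: "\<And>n \<theta>. n \<ge> 1 \<Longrightarrow> \<theta> \<in> Th n \<Longrightarrow> seq_risk \<sigma> n (\<gamma> n) (\<lambda>j. sqrt (real n) * \<theta> j) \<le> V n"
    and th: "\<And>n. n \<ge> 1 \<Longrightarrow> th n \<in> Th n"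
    and lo: "\<And>n g. n \<ge> 1 \<Longrightarrow> V n \<le> seq_risk \<sigma> n g (\<lambda>j. sqrt (real n) * th n j)"
    and V: "\<And>n. n \<ge> 1 \<Longrightarrow> c0 * real n powr \<beta> \<le> V n" "c0 > 0" "\<beta> > 0"
    and tail: "\<And>n \<theta>. n \<ge> 1 \<Longrightarrow> \<theta> \<in> Th n \<Longrightarrow> real n * (\<Sum>j\<in>{nat \<lfloor>\<kappa> * real n\<rfloor>..<n}. (\<theta> j)\<^sup>2) \<le> b n"
    and b: "(\<lambda>n. (b n)\<^sup>2 / real n / V n) \<longlonglongrightarrow> 0"
  shows "(\<lambda>n. real n * enn2real (supRiskMMA \<sigma> (Phi n) n \<kappa> t1 t2 (FTheta (Phi n) n (Th n))) / V n) \<longlonglongrightarrow> 1"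
proof (rule tendsto_one_from_bounds)
  define \<zeta> where "\<zeta> = zetaG t1 t2"
  define \<rho> where "\<rho> n = (1 + \<zeta> n) / (1 - \<zeta> n)" for n
  \<comment> \<open>\<open>A n * V n\<close> bounds the risk of the blocked weights:
    \<open>\<rho> n\<close> comes from the ratio of neighbouring blocks, the second summand from the
    unshrunk first block.\<close>
  define A where "A n = \<rho> n + \<sigma>\<^sup>2 * ((1 / \<zeta> n + 1) / V n)" for n
  define Ck where "Ck = 54 / ((1 - \<kappa>)\<^sup>2 * \<sigma>\<^sup>2)"
  define w where "w n = 3 * \<sigma>\<^sup>2 * (2 + 2 * ln (2 * real n) / \<zeta> n) + Ck * (\<sigma> ^ 4 + (b n)\<^sup>2 / real n)" for n
  define E where "E n = w n / V n" for n
  have Vpos: "V n > 0" if "n \<ge> 1" for n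
  proof -
    have "0 < c0 * real n powr \<beta>" using V(2) that by simp
    then show ?thesis using V(1)[OF that] by linarith
  qed
  \<comment> \<open>Whatever is of smaller order than \<open>n powr \<beta>\<close> is negligible
    against the saddle value; this applies to all polylogarithmic terms.\<close>
  have scale: "(\<lambda>n. x n / V n) \<longlonglongrightarrow> 0" if x: "(\<lambda>n. x n / real n powr \<beta>) \<longlonglongrightarrow> 0" for x :: "nat \<Rightarrow> real"
  proof (rule Lim_null_comparison)
    show "eventually (\<lambda>n. norm (x n / V n) \<le> \<bar>x n / real n powr \<beta>\<bar> / c0) sequentially"
      using eventually_ge_at_top[of 1]
    proof eventually_elim
      case (elim n)
      have "\<bar>x n\<bar> / V n \<le> \<bar>x n\<bar> / (c0 * real n powr \<beta>)"
        using V(1,2) elim by (intro divide_left_mono mult_pos_pos Vpos) auto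
      then show ?case using Vpos[OF elim] by (simp add: abs_divide divide_divide_eq_left mult.commute)
    qed
    have "(\<lambda>n. \<bar>x n / real n powr \<beta>\<bar> / c0) \<longlonglongrightarrow> \<bar>0\<bar> / c0" using V(2) by (intro tendsto_intros x) auto
    then show "(\<lambda>n. \<bar>x n / real n powr \<beta>\<bar> / c0) \<longlonglongrightarrow> 0" by simp
  qed
  have "A \<longlonglongrightarrow> 1 + \<sigma>\<^sup>2 * 0" unfolding A_def \<rho>_def \<zeta>_def
    by (intro tendsto_intros zetaG_asymp t scale V(3))
  then show "A \<longlonglongrightarrow> 1" by simp
  have const: "(\<lambda>n. 1 / V n) \<longlonglongrightarrow> 0"
    by (rule scale) (use V(3) in real_asymp)
  have Eeq: "E n = 3 * \<sigma>\<^sup>2 * ((2 + 2 * ln (2 * real n) / \<zeta> n) / V n) + Ck * (\<sigma> ^ 4 * (1 / V n) + (b n)\<^sup>2 / real n / V n)" for n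
    by (simp add: E_def w_def add_divide_distrib algebra_simps)
  have "E \<longlonglongrightarrow> 3 * \<sigma>\<^sup>2 * 0 + Ck * (\<sigma> ^ 4 * 0 + 0)"
    unfolding Eeq \<zeta>_def by (intro tendsto_intros zetaG_asymp t scale V(3) const b)
  then show "E \<longlonglongrightarrow> 0" by simp
  have good: "eventually (\<lambda>n. n \<ge> 1 \<and> 0 < \<zeta> n \<and> \<zeta> n \<le> 1/2) sequentially"
    using zetaG_asymp(1)[OF t] eventually_ge_at_top[of 1] unfolding \<zeta>_def by eventually_elim auto
  let ?S = "\<lambda>n. supRiskMMA \<sigma> (Phi n) n \<kappa> t1 t2 (FTheta (Phi n) n (Th n))"
  have nest: "nested_mma (Phi n) n \<sigma> \<kappa> t1 t2 (MG t1 t2 n) (cuts t1 t2 n)" if n: "n \<ge> 1" and z: "0 < \<zeta> n" "\<zeta> n \<le> 1/2" for n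
  proof -
    interpret orthonormal_rows "Phi n" n by (rule onb)
    show ?thesis
    proof
      show "1 \<le> MG t1 t2 n" using MG_props(1)[OF \<zeta>_def[THEN fun_cong] z n] .
      show "cuts t1 t2 n m < cuts t1 t2 n (Suc m)" if "m < MG t1 t2 n" for m
        using cuts_step[OF \<zeta>_def[THEN fun_cong] z n that] .
    qed (use s kappa n in auto)
  qed
  have W: "(\<integral>\<^sup>+z. ennreal (fluctuation (cuts t1 t2 n) (MG t1 t2 n) \<sigma> n (nat \<lfloor>\<kappa> * real n\<rfloor>) (coord (Phi n) n f) z) \<partial>noise \<sigma> n) \<le> ennreal (w n)" "0 \<le> w n"
    if n: "n \<ge> 1" and z: "0 < \<zeta> n" "\<zeta> n \<le> 1/2" and f: "f \<in> FTheta (Phi n) n (Th n)" for n f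
  proof -
    interpret nested_mma "Phi n" n \<sigma> \<kappa> t1 t2 "MG t1 t2 n" "cuts t1 t2 n" by (rule nest[OF n z])
    obtain \<theta> where \<theta>: "\<theta> \<in> Th n" "\<And>j. j < n \<Longrightarrow> coord (Phi n) n f j = sqrt (real n) * \<theta> j"
      using FTheta_coord[OF onb f] by blast
    define B where "B = (\<Sum>j\<in>{kn..<n}. (coord (Phi n) n f j)\<^sup>2)"
    have "B = real n * (\<Sum>j\<in>{kn..<n}. (\<theta> j)\<^sup>2)"
      unfolding B_def by (simp add: \<theta>(2) power_mult_distrib sum_distrib_left)
    then have "B \<le> b n" using tail[OF n \<theta>(1)] by (simp add: kn_def)
    moreover have "0 \<le> B" by (simp add: B_def sum_nonneg)
    ultimately have "B\<^sup>2 / real n \<le> (b n)\<^sup>2 / real n" by (intro divide_right_mono power_mono) auto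
    moreover have "real (MG t1 t2 n) \<le> 2 + 2 * ln (2 * real n) / \<zeta> n" by (rule MG_le[OF \<zeta>_def[THEN fun_cong] z n])
    moreover have "Ck \<ge> 0" by (simp add: Ck_def)
    ultimately have le: "3 * \<sigma>\<^sup>2 * real (MG t1 t2 n) + Ck * (\<sigma> ^ 4 + B\<^sup>2 / real n) \<le> w n"
      unfolding w_def by (intro add_mono mult_left_mono) auto
    have "(\<integral>\<^sup>+z. ennreal (fluctuation (cuts t1 t2 n) (MG t1 t2 n) \<sigma> n kn (coord (Phi n) n f) z) \<partial>noise \<sigma> n)
       \<le> ennreal (3 * \<sigma>\<^sup>2 * real (MG t1 t2 n) + Ck * (\<sigma> ^ 4 + B\<^sup>2 / real n))"
      unfolding B_def Ck_def by (rule fluctuation_moment)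
    also have "\<dots> \<le> ennreal (w n)" by (intro ennreal_leI le)
    finally show "(\<integral>\<^sup>+z. ennreal (fluctuation (cuts t1 t2 n) (MG t1 t2 n) \<sigma> n (nat \<lfloor>\<kappa> * real n\<rfloor>) (coord (Phi n) n f) z) \<partial>noise \<sigma> n) \<le> ennreal (w n)"
      by (simp add: kn_def)
    have "0 \<le> 3 * \<sigma>\<^sup>2 * real (MG t1 t2 n) + Ck * (\<sigma> ^ 4 + B\<^sup>2 / real n)" using \<open>Ck \<ge> 0\<close> by (intro add_nonneg_nonneg mult_nonneg_nonneg) auto
    then show "0 \<le> w n" using le by linarith
  qed
  have upper: "?S n \<le> ennreal (((1 + 16 * \<delta>) * (A n * V n) + 16 / \<delta> * w n) / real n)"
    and upper_nonneg: "0 \<le> ((1 + 16 * \<delta>) * (A n * V n) + 16 / \<delta> * w n) / real n"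
    if \<delta>: "0 < \<delta>" "\<delta> \<le> 1/6" and n: "n \<ge> 1" and z: "0 < \<zeta> n" "\<zeta> n \<le> 1/2" for n \<delta>
  proof -
    interpret nested_mma "Phi n" n \<sigma> \<kappa> t1 t2 "MG t1 t2 n" "cuts t1 t2 n" by (rule nest[OF n z])
    have \<rho>1: "\<rho> n \<ge> 1" using z by (simp add: \<rho>_def)
    have AV: "A n * V n = \<rho> n * V n + \<sigma>\<^sup>2 * (1 / \<zeta> n + 1)" using Vpos[OF n] by (simp add: A_def field_simps)
    have AV0: "0 \<le> A n * V n" unfolding AV using \<rho>1 Vpos[OF n] z by (intro add_nonneg_nonneg mult_nonneg_nonneg) auto
    have r: "risk \<sigma> n (mmaG (Phi n) n \<kappa> t1 t2) f \<le> ennreal (((1 + 16 * \<delta>) * (A n * V n) + 16 / \<delta> * w n) / real n)"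
      if f: "f \<in> FTheta (Phi n) n (Th n)" for f
    proof (rule risk_le_of_loss_le)
      obtain \<theta> where \<theta>: "\<theta> \<in> Th n" "\<And>j. j < n \<Longrightarrow> coord (Phi n) n f j = sqrt (real n) * \<theta> j"
        using FTheta_coord[OF onb f] by blast
      define g where "g m = (if m = 0 then 1 else \<gamma> n (cuts t1 t2 n m))" for m
      define Q where "Q = (\<Sum>m<MG t1 t2 n. (1 - g m)\<^sup>2 * (\<Sum>j\<in>blk (cuts t1 t2 n) m. (coord (Phi n) n f j)\<^sup>2) + \<sigma>\<^sup>2 * (g m)\<^sup>2 * real (card (blk (cuts t1 t2 n) m)))"
      have "Q \<le> \<rho> n * seq_risk \<sigma> n (\<gamma> n) (coord (Phi n) n f) + \<sigma>\<^sup>2 * real (cuts t1 t2 n 1)"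
        unfolding Q_def g_def
        using \<gamma> n \<rho>1 blk_ratio[OF \<zeta>_def[THEN fun_cong] z n] by (intro blocked_risk) (auto simp: \<rho>_def)
      also have "seq_risk \<sigma> n (\<gamma> n) (coord (Phi n) n f) = seq_risk \<sigma> n (\<gamma> n) (\<lambda>j. sqrt (real n) * \<theta> j)"
        by (rule seq_risk_cong) (rule \<theta>(2))
      also have "\<rho> n * \<dots> + \<sigma>\<^sup>2 * real (cuts t1 t2 n 1) \<le> A n * V n"
        unfolding AV using up[OF n \<theta>(1)] \<rho>1 cuts_1[OF \<zeta>_def[THEN fun_cong] z n] by (intro add_mono mult_left_mono) auto
      finally have Q: "Q \<le> A n * V n" .
      fix e
      have "sqn n (\<lambda>i. mmaG (Phi n) n \<kappa> t1 t2 (restrict (\<lambda>i. f i + e i) {..<n}) i - f i)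
        \<le> (1 + 16 * \<delta>) * Q + 16 * (fluctuation (cuts t1 t2 n) (MG t1 t2 n) \<sigma> n (nat \<lfloor>\<kappa> * real n\<rfloor>) (coord (Phi n) n f) (coord (Phi n) n e) / \<delta>)"
        unfolding Q_def
      proof (rule mma_loss_upper[OF \<delta>])
        show "g (Suc m) \<le> g m" if "Suc m < MG t1 t2 n" for m
          using \<gamma> n K_step[of m] that by (auto simp: g_def)
      qed (use \<gamma> n in \<open>auto simp: g_def\<close>)
      also have "\<dots> \<le> (1 + 16 * \<delta>) * (A n * V n) + 16 * (fluctuation (cuts t1 t2 n) (MG t1 t2 n) \<sigma> n (nat \<lfloor>\<kappa> * real n\<rfloor>) (coord (Phi n) n f) (coord (Phi n) n e) / \<delta>)"
        using \<delta> Q by (intro add_right_mono mult_left_mono) auto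
      finally show "sqn n (\<lambda>i. mmaG (Phi n) n \<kappa> t1 t2 (restrict (\<lambda>i. f i + e i) {..<n}) i - f i)
        \<le> (1 + 16 * \<delta>) * (A n * V n) + 16 / \<delta> * fluctuation (cuts t1 t2 n) (MG t1 t2 n) \<sigma> n kn (coord (Phi n) n f) (coord (Phi n) n e)"
        by (simp add: kn_def)
    next
      show "(\<integral>\<^sup>+z. ennreal (fluctuation (cuts t1 t2 n) (MG t1 t2 n) \<sigma> n kn (coord (Phi n) n f) z) \<partial>noise \<sigma> n) \<le> ennreal (w n)" "0 \<le> w n"
        using W[OF n z f] by (simp_all add: kn_def)
      show "0 \<le> (1 + 16 * \<delta>) * (A n * V n)" by (rule mult_nonneg_nonneg[OF _ AV0]) (use \<delta> in simp)
      show "0 \<le> 16 / \<delta>" using \<delta> by simp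
    qed
    show "?S n \<le> ennreal (((1 + 16 * \<delta>) * (A n * V n) + 16 / \<delta> * w n) / real n)"
      unfolding supRiskMMA_def by (rule SUP_least) (rule r)
    obtain f where f: "f \<in> FTheta (Phi n) n (Th n)" using synth_in_FTheta[OF onb th[OF n]] by blast
    show "0 \<le> ((1 + 16 * \<delta>) * (A n * V n) + 16 / \<delta> * w n) / real n"
    proof -
      have "0 \<le> (1 + 16 * \<delta>) * (A n * V n)" by (rule mult_nonneg_nonneg[OF _ AV0]) (use \<delta> in simp)
      moreover have "0 \<le> 16 / \<delta> * w n" using \<delta> W(2)[OF n z f] by simp
      ultimately show ?thesis by simp
    qed
  qed
  show "eventually (\<lambda>n. real n * enn2real (?S n) / V n \<le> (1 + 16 * \<delta>) * A n + 16 * E n / \<delta>) sequentially"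
    if \<delta>: "0 < \<delta>" "\<delta> \<le> 1/6" for \<delta>
    using good
  proof eventually_elim
    case (elim n)
    then have n: "n \<ge> 1" and z: "0 < \<zeta> n" "\<zeta> n \<le> 1/2" by auto
    have "enn2real (?S n) \<le> ((1 + 16 * \<delta>) * (A n * V n) + 16 / \<delta> * w n) / real n"
      using upper[OF \<delta> n z] upper_nonneg[OF \<delta> n z] by (intro enn2real_leI)
    then have "real n * enn2real (?S n) \<le> (1 + 16 * \<delta>) * (A n * V n) + 16 / \<delta> * w n"
      using n by (simp add: field_simps)
    then have "real n * enn2real (?S n) / V n \<le> ((1 + 16 * \<delta>) * (A n * V n) + 16 / \<delta> * w n) / V n"
      using Vpos[OF n] by (intro divide_right_mono) auto
    also have "\<dots> = (1 + 16 * \<delta>) * A n + 16 * E n / \<delta>" using Vpos[OF n] \<delta> by (simp add: E_def field_simps)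
    finally show ?case .
  qed
  show "eventually (\<lambda>n. (1 - \<delta>) - E n / \<delta> \<le> real n * enn2real (?S n) / V n) sequentially"
    if \<delta>: "0 < \<delta>" "\<delta> \<le> 1/6" for \<delta>
    using good
  proof eventually_elim
    case (elim n)
    then have n: "n \<ge> 1" and z: "0 < \<zeta> n" "\<zeta> n \<le> 1/2" by auto
    interpret nested_mma "Phi n" n \<sigma> \<kappa> t1 t2 "MG t1 t2 n" "cuts t1 t2 n" by (rule nest[OF n z])
    obtain f where f: "f \<in> FTheta (Phi n) n (Th n)" "\<And>j. j < n \<Longrightarrow> coord (Phi n) n f j = sqrt (real n) * th n j"
      using synth_in_FTheta[OF onb th[OF n]] by blast
    have "ennreal (((1 - \<delta>) * V n - 1 / \<delta> * w n) / real n) \<le> risk \<sigma> n (mmaG (Phi n) n \<kappa> t1 t2) f"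
    proof (rule risk_ge_of_loss_ge)
      fix e
      have "V n \<le> seq_risk \<sigma> n g (coord (Phi n) n f)" for g
        using lo[OF n, of g] seq_risk_cong[of n "coord (Phi n) n f" "\<lambda>j. sqrt (real n) * th n j"] f(2) by metis
      then show "(1 - \<delta>) * V n - 1 / \<delta> * fluctuation (cuts t1 t2 n) (MG t1 t2 n) \<sigma> n kn (coord (Phi n) n f) (coord (Phi n) n e)
         \<le> sqn n (\<lambda>i. mmaG (Phi n) n \<kappa> t1 t2 (restrict (\<lambda>i. f i + e i) {..<n}) i - f i)"
        using mma_loss_lower[of \<delta> "V n" f e] \<delta> by (simp add: kn_def)
      show "(\<integral>\<^sup>+z. ennreal (fluctuation (cuts t1 t2 n) (MG t1 t2 n) \<sigma> n kn (coord (Phi n) n f) z) \<partial>noise \<sigma> n) \<le> ennreal (w n)" "0 \<le> w n"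
        using W[OF n z f(1)] by (simp_all add: kn_def)
    qed (use \<delta> in simp)
    also have "\<dots> \<le> ?S n" unfolding supRiskMMA_def using f(1) by (rule SUP_upper)
    finally have le: "ennreal (((1 - \<delta>) * V n - 1 / \<delta> * w n) / real n) \<le> ?S n" .
    \<comment> \<open>\<open>enn2real\<close> maps infinity to 0, so the lower bound survives it
      only for a finite supremum.\<close>
    have "?S n < top" using upper[OF \<delta> n z] by (rule le_less_trans) simp
    then have "((1 - \<delta>) * V n - 1 / \<delta> * w n) / real n \<le> enn2real (?S n)"
      using le by (cases "0 \<le> ((1 - \<delta>) * V n - 1 / \<delta> * w n) / real n")
        (metis enn2real_ennreal enn2real_mono, metis enn2real_nonneg linorder_le_cases order_trans)
    then have "(1 - \<delta>) * V n - 1 / \<delta> * w n \<le> real n * enn2real (?S n)" using n by (simp add: field_simps)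
    then have "((1 - \<delta>) * V n - 1 / \<delta> * w n) / V n \<le> real n * enn2real (?S n) / V n"
      using Vpos[OF n] by (intro divide_right_mono) auto
    moreover have "((1 - \<delta>) * V n - 1 / \<delta> * w n) / V n = (1 - \<delta>) - E n / \<delta>"
      using Vpos[OF n] \<delta> by (simp add: E_def field_simps)
    ultimately show ?case by simp
  qed
qed

section \<open>Optimal shrinkage of one coordinate and of a sequence\<close>

lemma shrink_risk_ge:
  fixes g x s2 :: real
  assumes "x \<ge> 0" "s2 > 0"
  shows "x * s2 / (x + s2) \<le> (1 - g)\<^sup>2 * x + s2 * g\<^sup>2"
proof -
  have p: "x + s2 > 0" using assms by simp
  have "((1 - g)\<^sup>2 * x + s2 * g\<^sup>2) * (x + s2) = x * s2 + ((x + s2) * g - x)\<^sup>2"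
    by (simp add: power2_eq_square algebra_simps)
  then have "x * s2 \<le> ((1 - g)\<^sup>2 * x + s2 * g\<^sup>2) * (x + s2)" by simp
  then show ?thesis using p by (simp add: pos_divide_le_eq)
qed

lemma shrink_risk_opt:
  fixes x s2 :: real
  assumes "x \<ge> 0" "s2 > 0"
  shows "(1 - x / (x + s2))\<^sup>2 * x + s2 * (x / (x + s2))\<^sup>2 = x * s2 / (x + s2)"
proof -
  have p: "x + s2 > 0" using assms by simp
  have "1 - x / (x + s2) = s2 / (x + s2)" using p by (simp add: field_simps)
  then have "(1 - x / (x + s2))\<^sup>2 * x + s2 * (x / (x + s2))\<^sup>2 = (s2\<^sup>2 * x + s2 * x\<^sup>2) / (x + s2)\<^sup>2"
    by (simp add: power_divide add_divide_distrib)
  also have "s2\<^sup>2 * x + s2 * x\<^sup>2 = x * s2 * (x + s2)" by (simp add: power2_eq_square algebra_simps)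
  finally show ?thesis using p by (simp add: power2_eq_square)
qed

lemma shrink_value_mono:
  fixes x y s2 :: real
  assumes "0 \<le> x" "x \<le> y" "s2 > 0"
  shows "x / (x + s2) \<le> y / (y + s2)"
  using assms by (simp add: frac_le_eq divide_le_0_iff field_simps add_nonneg_pos)

lemma seq_risk_ge:
  assumes "\<sigma> > 0"
  shows "(\<Sum>j<n. (\<mu> j)\<^sup>2 * \<sigma>\<^sup>2 / ((\<mu> j)\<^sup>2 + \<sigma>\<^sup>2)) \<le> seq_risk \<sigma> n g \<mu>"
  unfolding seq_risk_def using assms by (intro sum_mono shrink_risk_ge) auto

text \<open>The first \<open>n powr \<beta>\<close> coordinates, each with signal of the order of the noise, already give
  risk of the order \<open>n powr \<beta>\<close>.\<close>
lemma seq_risk_ge_powr: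
  assumes s: "\<sigma> > 0" and r: "r > 0" and N: "N \<le> n" "x \<le> real N"
    and \<mu>: "\<And>j. j < N \<Longrightarrow> r \<le> (\<mu> j)\<^sup>2"
  shows "r * \<sigma>\<^sup>2 / (r + \<sigma>\<^sup>2) * x \<le> seq_risk \<sigma> n g \<mu>"
proof -
  have "r * \<sigma>\<^sup>2 / (r + \<sigma>\<^sup>2) * x \<le> r * \<sigma>\<^sup>2 / (r + \<sigma>\<^sup>2) * real N"
    using N r s by (intro mult_left_mono) auto
  also have "\<dots> = (\<Sum>j<N. r * \<sigma>\<^sup>2 / (r + \<sigma>\<^sup>2))" by simp
  also have "\<dots> \<le> (\<Sum>j<N. (\<mu> j)\<^sup>2 * \<sigma>\<^sup>2 / ((\<mu> j)\<^sup>2 + \<sigma>\<^sup>2))"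
  proof (rule sum_mono)
    fix j assume "j \<in> {..<N}"
    then have "r / (r + \<sigma>\<^sup>2) \<le> (\<mu> j)\<^sup>2 / ((\<mu> j)\<^sup>2 + \<sigma>\<^sup>2)"
      using \<mu>[of j] r s by (intro shrink_value_mono) auto
    then have "r / (r + \<sigma>\<^sup>2) * \<sigma>\<^sup>2 \<le> (\<mu> j)\<^sup>2 / ((\<mu> j)\<^sup>2 + \<sigma>\<^sup>2) * \<sigma>\<^sup>2" by (intro mult_right_mono) auto
    then show "r * \<sigma>\<^sup>2 / (r + \<sigma>\<^sup>2) \<le> (\<mu> j)\<^sup>2 * \<sigma>\<^sup>2 / ((\<mu> j)\<^sup>2 + \<sigma>\<^sup>2)" by simp
  qed
  also have "\<dots> \<le> (\<Sum>j<n. (\<mu> j)\<^sup>2 * \<sigma>\<^sup>2 / ((\<mu> j)\<^sup>2 + \<sigma>\<^sup>2))"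
    using N by (intro sum_mono2) auto
  also have "\<dots> \<le> seq_risk \<sigma> n g \<mu>" by (rule seq_risk_ge[OF s])
  finally show ?thesis .
qed

text \<open>The effective dimension: the order of the number of coordinates in which the signal can
  match the noise.\<close>

definition cutoff :: "real \<Rightarrow> nat \<Rightarrow> nat" where
  "cutoff \<beta> n = nat \<lceil>real n powr \<beta>\<rceil>"

lemma cutoff_bounds:
  assumes "n \<ge> 1" "0 < \<beta>" "\<beta> \<le> 1"
  shows "real n powr \<beta> \<le> real (cutoff \<beta> n)" "real (cutoff \<beta> n) \<le> 2 * real n powr \<beta>" "cutoff \<beta> n \<le> n" "1 \<le> cutoff \<beta> n"
proof -
  have x1: "1 \<le> real n powr \<beta>" using assms by (intro ge_one_powr_ge_zero) auto
  have xn: "real n powr \<beta> \<le> real n" using powr_mono[of \<beta> 1 "real n"] assms by simp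
  have c: "real (cutoff \<beta> n) = of_int \<lceil>real n powr \<beta>\<rceil>" using x1 by (simp add: cutoff_def)
  show "real n powr \<beta> \<le> real (cutoff \<beta> n)" unfolding c by linarith
  then show "1 \<le> cutoff \<beta> n" using x1 by linarith
  show "real (cutoff \<beta> n) \<le> 2 * real n powr \<beta>" unfolding c using x1 by linarith
  have "\<lceil>real n powr \<beta>\<rceil> \<le> int n" using xn by (simp add: ceiling_le_iff)
  then show "cutoff \<beta> n \<le> n" unfolding cutoff_def nat_le_iff .
qed

lemma tail_negligible:
  fixes V :: "nat \<Rightarrow> real"
  assumes V: "\<And>n. n \<ge> 1 \<Longrightarrow> c0 * real n powr \<beta> \<le> V n" "c0 > 0" and e: "2 * e - 1 < \<beta>"
  shows "(\<lambda>n. (C * real n powr e)\<^sup>2 / real n / V n) \<longlonglongrightarrow> 0"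
proof (rule Lim_null_comparison)
  show "(\<lambda>n. (C * real n powr e)\<^sup>2 / real n / (c0 * real n powr \<beta>)) \<longlonglongrightarrow> 0"
  proof -
    have "(\<lambda>n. C\<^sup>2 / c0 * real n powr (2 * e - 1 - \<beta>)) \<longlonglongrightarrow> C\<^sup>2 / c0 * 0"
      using e by (intro tendsto_mult tendsto_const) real_asymp
    moreover have "eventually (\<lambda>n. C\<^sup>2 / c0 * real n powr (2 * e - 1 - \<beta>) = (C * real n powr e)\<^sup>2 / real n / (c0 * real n powr \<beta>)) sequentially"
      using eventually_ge_at_top[of 1]
    proof eventually_elim
      case (elim n)
      have "real n powr (2 * e - 1 - \<beta>) = (real n powr e * real n powr e) / real n / real n powr \<beta>"
        using elim by (simp add: powr_diff powr_add[symmetric])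
      then show ?case using elim by (simp add: power2_eq_square mult_ac)
    qed
    ultimately show ?thesis by (simp add: filterlim_cong[OF refl refl])
  qed
  show "eventually (\<lambda>n. norm ((C * real n powr e)\<^sup>2 / real n / V n) \<le> (C * real n powr e)\<^sup>2 / real n / (c0 * real n powr \<beta>)) sequentially"
    using eventually_ge_at_top[of 1]
  proof eventually_elim
    case (elim n)
    have p: "0 < c0 * real n powr \<beta>" using elim V(2) by simp
    then have "0 < V n" using V(1)[OF elim] by linarith
    moreover have "(C * real n powr e)\<^sup>2 / real n / V n \<le> (C * real n powr e)\<^sup>2 / real n / (c0 * real n powr \<beta>)"
      by (rule divide_left_mono[OF V(1)[OF elim] _ mult_pos_pos[OF \<open>0 < V n\<close> p]]) simp
    ultimately show ?case by simp
  qed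
qed

lemma thetaOf_coord: "thetaOf Phi n f j = coord Phi n f j / sqrt (real n)"
  by (simp add: thetaOf_def coord_def)

lemma RnA_seq_risk:
  assumes "n \<ge> 1"
  shows "RnA \<sigma> Phi n w f = seq_risk \<sigma> n (\<lambda>j. \<Sum>m\<in>{j..<n}. w m) (coord Phi n f) / real n"
  unfolding RnA_def seq_risk_def sum_divide_distrib thetaOf_coord
  using assms by (intro sum.cong refl) (simp add: power_divide add_divide_distrib)

text \<open>Linear combinations carry no sign constraint, so every sequence \<gamma> is the tail
  sequence of some \<open>w\<close>, obtained by differencing with value 0 at \<open>n\<close>. The
  saddle value is thus attained.\<close>

lemma RL_saddle:
  assumes onb: "orthonormal_rows Phi n" and n: "n \<ge> 1"
    and up: "\<And>\<theta>. \<theta> \<in> Th \<Longrightarrow> seq_risk \<sigma> n \<gamma> (\<lambda>j. sqrt (real n) * \<theta> j) \<le> V"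
    and th: "th \<in> Th"
    and lo: "\<And>g. V \<le> seq_risk \<sigma> n g (\<lambda>j. sqrt (real n) * th j)"
  shows "RL \<sigma> Phi n (FTheta Phi n Th) = ennreal (V / real n)"
proof (rule antisym)
  define h where "h m = (if m < n then \<gamma> m else 0)" for m
  define w where "w m = h m - h (Suc m)" for m
  have "(\<Sum>m\<in>{j..<k}. w m) = h j - h k" if "j \<le> k" for j k
    using that by (induction rule: dec_induct) (auto simp: w_def)
  then have w: "(\<Sum>m\<in>{j..<n}. w m) = \<gamma> j" if "j < n" for j using that by (simp add: h_def)
  have "RL \<sigma> Phi n (FTheta Phi n Th) \<le> (SUP f\<in>FTheta Phi n Th. ennreal (RnA \<sigma> Phi n w f))"
    unfolding RL_def by (rule INF_lower) simp
  also have "\<dots> \<le> ennreal (V / real n)"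
  proof (rule SUP_least)
    fix f assume f: "f \<in> FTheta Phi n Th"
    obtain \<theta> where \<theta>: "\<theta> \<in> Th" "\<And>j. j < n \<Longrightarrow> coord Phi n f j = sqrt (real n) * \<theta> j"
      using FTheta_coord[OF onb f] by blast
    have "seq_risk \<sigma> n (\<lambda>j. \<Sum>m\<in>{j..<n}. w m) (coord Phi n f) = seq_risk \<sigma> n \<gamma> (\<lambda>j. sqrt (real n) * \<theta> j)"
      unfolding seq_risk_def by (intro sum.cong refl) (simp add: w \<theta>(2))
    also have "\<dots> \<le> V" by (rule up[OF \<theta>(1)])
    finally show "ennreal (RnA \<sigma> Phi n w f) \<le> ennreal (V / real n)"
      unfolding RnA_seq_risk[OF n] by (intro ennreal_leI divide_right_mono) auto
  qed
  finally show "RL \<sigma> Phi n (FTheta Phi n Th) \<le> ennreal (V / real n)" .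
  obtain f where f: "f \<in> FTheta Phi n Th" "\<And>j. j < n \<Longrightarrow> coord Phi n f j = sqrt (real n) * th j"
    using synth_in_FTheta[OF onb th] by blast
  show "ennreal (V / real n) \<le> RL \<sigma> Phi n (FTheta Phi n Th)"
    unfolding RL_def
  proof (rule INF_greatest)
    fix w :: "nat \<Rightarrow> real"
    have "V \<le> seq_risk \<sigma> n (\<lambda>j. \<Sum>m\<in>{j..<n}. w m) (\<lambda>j. sqrt (real n) * th j)" by (rule lo)
    also have "\<dots> = seq_risk \<sigma> n (\<lambda>j. \<Sum>m\<in>{j..<n}. w m) (coord Phi n f)"
      by (rule seq_risk_cong) (simp add: f(2))
    finally have "ennreal (V / real n) \<le> ennreal (RnA \<sigma> Phi n w f)"
      unfolding RnA_seq_risk[OF n] by (intro ennreal_leI divide_right_mono) auto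
    also have "\<dots> \<le> (SUP f\<in>FTheta Phi n Th. ennreal (RnA \<sigma> Phi n w f))" using f(1) by (rule SUP_upper)
    finally show "ennreal (V / real n) \<le> \<dots>" .
  qed
qed

text \<open>Index \<open>j\<close> stands for coordinate \<open>j + 1\<close>; this shift absorbs
  the rounding in the floor.\<close>

lemma kappa_index_le:
  assumes "0 < \<kappa>" "nat \<lfloor>\<kappa> * real n\<rfloor> \<le> j"
  shows "\<kappa> * real n \<le> real (j + 1)"
proof -
  have "\<kappa> * real n < of_int \<lfloor>\<kappa> * real n\<rfloor> + 1" by linarith
  also have "of_int \<lfloor>\<kappa> * real n\<rfloor> \<le> real j" using assms by (simp add: nat_le_iff)
  finally show ?thesis by simp
qed

lemma ratio_tendsto_one:
  fixes S T V :: "nat \<Rightarrow> real"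
  assumes "(\<lambda>n. real n * S n / V n) \<longlonglongrightarrow> 1" "(\<lambda>n. real n * T n / V n) \<longlonglongrightarrow> 1" "\<And>n. n \<ge> 1 \<Longrightarrow> V n > 0"
  shows "(\<lambda>n. S n / T n) \<longlonglongrightarrow> 1"
proof -
  have "(\<lambda>n. (real n * S n / V n) / (real n * T n / V n)) \<longlonglongrightarrow> 1 / 1"
    by (intro tendsto_divide assms(1,2)) simp
  moreover have "eventually (\<lambda>n. (real n * S n / V n) / (real n * T n / V n) = S n / T n) sequentially"
    using eventually_ge_at_top[of 1]
  proof eventually_elim
    case (elim n)
    then show ?case using assms(3)[OF elim] by simp
  qed
  ultimately show ?thesis by (simp add: filterlim_cong[OF refl refl])
qed

text \<open>For fixed factors the risk increases with every squared coefficient, so the corner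
  \<open>th\<close> of the hyperrectangle is worst for all factors at once. The optimal factors at
  the corner decrease because \<open>th\<close> does. Signal and noise balance near coordinate
  \<open>n powr (1 / (2 * q))\<close>, whence \<beta>.\<close>

theorem mma_hyperrectangle:
  fixes Phi :: "nat \<Rightarrow> nat \<Rightarrow> nat \<Rightarrow> real"
  assumes onb: "\<And>n. orthonormal_rows (Phi n) n"
    and s: "\<sigma> > 0" and kappa: "0 < \<kappa>" "\<kappa> < 1" and t: "t1 > 0" "t2 > 0"
    and c: "c > 0" and q: "q > 1/2"
  shows "(\<lambda>n. enn2real (supRiskMMA \<sigma> (Phi n) n \<kappa> t1 t2 (FTheta (Phi n) n (Hyp c q n)))
          / enn2real (RL \<sigma> (Phi n) n (FTheta (Phi n) n (Hyp c q n)))) \<longlonglongrightarrow> 1"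
proof -
  define th where "th n j = c * real (j + 1) powr (-q)" for n j :: nat
  define x where "x n j = (sqrt (real n) * th n j)\<^sup>2" for n j
  define \<gamma> where "\<gamma> n j = x n j / (x n j + \<sigma>\<^sup>2)" for n j
  define V where "V n = (\<Sum>j<n. x n j * \<sigma>\<^sup>2 / (x n j + \<sigma>\<^sup>2))" for n
  define \<beta> where "\<beta> = 1 / (2 * q)"
  \<comment> \<open>The value of \<open>n * (th n j)\<^sup>2\<close> at coordinate
    \<open>2 * n powr \<beta>\<close>, which no coordinate below the cutoff exceeds.\<close>
  define r where "r = c\<^sup>2 * 2 powr (- 2 * q)"
  define c0 where "c0 = r * \<sigma>\<^sup>2 / (r + \<sigma>\<^sup>2)"
  define e where "e = 2 - 2 * q"
  define C where "C = c\<^sup>2 * \<kappa> powr (- 2 * q)"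
  have x0: "x n j \<ge> 0" for n j by (simp add: x_def)
  have th0: "th n j > 0" for n j using c by (simp add: th_def)
  have th_dec: "th n j \<le> th n i" if "i \<le> j" for n i j
    unfolding th_def using c q that by (intro mult_left_mono powr_mono2') auto
  have s2: "\<sigma>\<^sup>2 > 0" using s by simp
  have r: "r > 0" using c by (simp add: r_def)
  have \<beta>: "0 < \<beta>" "\<beta> \<le> 1" "2 * q * \<beta> = 1" using q by (auto simp: \<beta>_def field_simps)
  have \<gamma>b: "0 \<le> \<gamma> n j" "\<gamma> n j \<le> 1" for n j using x0[of n j] s2 by (auto simp: \<gamma>_def divide_le_eq_1 add_nonneg_pos)
  have \<gamma>d: "\<gamma> n j \<le> \<gamma> n i" if "i \<le> j" for n i j
    unfolding \<gamma>_def x_def using th_dec[OF that, of n] less_imp_le[OF th0] s2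
    by (intro shrink_value_mono power_mono mult_left_mono) auto
  have th: "th n \<in> Hyp c q n" for n using c by (auto simp: Hyp_def th_def)
  have up: "seq_risk \<sigma> n (\<gamma> n) (\<lambda>j. sqrt (real n) * \<theta> j) \<le> V n" if \<theta>: "\<theta> \<in> Hyp c q n" for n \<theta>
    unfolding seq_risk_def V_def
  proof (rule sum_mono)
    fix j assume "j \<in> {..<n}"
    then have "\<bar>\<theta> j\<bar> \<le> th n j" using \<theta> by (auto simp: Hyp_def th_def)
    then have "(\<theta> j)\<^sup>2 \<le> (th n j)\<^sup>2" by (metis abs_ge_zero power2_abs power_mono)
    then have "(sqrt (real n) * \<theta> j)\<^sup>2 \<le> x n j" by (simp add: x_def power_mult_distrib mult_left_mono)
    then have "(1 - \<gamma> n j)\<^sup>2 * (sqrt (real n) * \<theta> j)\<^sup>2 + \<sigma>\<^sup>2 * (\<gamma> n j)\<^sup>2 \<le> (1 - \<gamma> n j)\<^sup>2 * x n j + \<sigma>\<^sup>2 * (\<gamma> n j)\<^sup>2"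
      by (intro add_right_mono mult_left_mono) auto
    also have "\<dots> = x n j * \<sigma>\<^sup>2 / (x n j + \<sigma>\<^sup>2)" unfolding \<gamma>_def by (rule shrink_risk_opt[OF x0 s2])
    finally show "(1 - \<gamma> n j)\<^sup>2 * (sqrt (real n) * \<theta> j)\<^sup>2 + \<sigma>\<^sup>2 * (\<gamma> n j)\<^sup>2 \<le> x n j * \<sigma>\<^sup>2 / (x n j + \<sigma>\<^sup>2)" .
  qed
  have lo: "V n \<le> seq_risk \<sigma> n g (\<lambda>j. sqrt (real n) * th n j)" for n g
    unfolding V_def x_def by (rule seq_risk_ge[OF s])
  have Vge: "c0 * real n powr \<beta> \<le> V n" if n: "n \<ge> 1" for n
  proof -
    have "r * \<sigma>\<^sup>2 / (r + \<sigma>\<^sup>2) * real n powr \<beta> \<le> seq_risk \<sigma> n (\<gamma> n) (\<lambda>j. sqrt (real n) * th n j)"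
    proof (rule seq_risk_ge_powr[OF s r, of "cutoff \<beta> n"])
      fix j assume j: "j < cutoff \<beta> n"
      have "real (j + 1) \<le> 2 * real n powr \<beta>" using j cutoff_bounds(2)[OF n \<beta>(1,2)] by linarith
      then have "(2 * real n powr \<beta>) powr (- 2 * q) \<le> real (j + 1) powr (- 2 * q)"
        using q by (intro powr_mono2') auto
      moreover have "(2 * real n powr \<beta>) powr (- 2 * q) = 2 powr (- 2 * q) * real n powr (- 1)"
        using n \<beta>(3) by (simp add: powr_mult powr_powr mult.commute)
      ultimately have "real n * (c\<^sup>2 * (2 powr (- 2 * q) * real n powr (- 1))) \<le> real n * (c\<^sup>2 * real (j + 1) powr (- 2 * q))"
        by (intro mult_left_mono) auto
      moreover have "real n * (c\<^sup>2 * (2 powr (- 2 * q) * real n powr (- 1))) = r" using n by (simp add: r_def powr_minus field_simps)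
      moreover have "real n * (c\<^sup>2 * real (j + 1) powr (- 2 * q)) = (sqrt (real n) * th n j)\<^sup>2"
        by (simp add: th_def power_mult_distrib powr_power mult_ac)
      ultimately show "r \<le> (sqrt (real n) * th n j)\<^sup>2" by simp
    qed (use cutoff_bounds[OF n \<beta>(1,2)] in auto)
    also have "\<dots> \<le> V n" by (rule up[OF th])
    finally show ?thesis by (simp add: c0_def)
  qed
  have c0: "c0 > 0" using r s2 by (simp add: c0_def add_pos_pos)
  have Vpos: "V n > 0" if "n \<ge> 1" for n
  proof -
    have "0 < c0 * real n powr \<beta>" using c0 that by simp
    then show ?thesis using Vge[OF that] by linarith
  qed
  have tail: "real n * (\<Sum>j\<in>{nat \<lfloor>\<kappa> * real n\<rfloor>..<n}. (\<theta> j)\<^sup>2) \<le> C * real n powr e" if n: "n \<ge> 1" and \<theta>: "\<theta> \<in> Hyp c q n" for n \<theta>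
  proof -
    have "(\<Sum>j\<in>{nat \<lfloor>\<kappa> * real n\<rfloor>..<n}. (\<theta> j)\<^sup>2) \<le> (\<Sum>j\<in>{nat \<lfloor>\<kappa> * real n\<rfloor>..<n}. c\<^sup>2 * (\<kappa> * real n) powr (- 2 * q))"
    proof (rule sum_mono)
      fix j assume j: "j \<in> {nat \<lfloor>\<kappa> * real n\<rfloor>..<n}"
      then have "\<bar>\<theta> j\<bar> \<le> c * real (j + 1) powr (-q)" using \<theta> by (auto simp: Hyp_def)
      also have "\<dots> \<le> c * (\<kappa> * real n) powr (-q)"
        using j c q n kappa kappa_index_le[OF kappa(1), of n j] by (intro mult_left_mono powr_mono2') auto
      finally have "\<bar>\<theta> j\<bar>\<^sup>2 \<le> (c * (\<kappa> * real n) powr (-q))\<^sup>2" by (intro power_mono) auto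
      then show "(\<theta> j)\<^sup>2 \<le> c\<^sup>2 * (\<kappa> * real n) powr (- 2 * q)"
        using kappa n by (simp add: power_mult_distrib powr_power mult_ac)
    qed
    also have "\<dots> \<le> real n * (c\<^sup>2 * (\<kappa> * real n) powr (- 2 * q))"
      by (simp add: mult_right_mono)
    finally have "real n * (\<Sum>j\<in>{nat \<lfloor>\<kappa> * real n\<rfloor>..<n}. (\<theta> j)\<^sup>2) \<le> real n * (real n * (c\<^sup>2 * (\<kappa> * real n) powr (- 2 * q)))"
      by (intro mult_left_mono) auto
    also have "(\<kappa> * real n) powr (- 2 * q) = \<kappa> powr (- 2 * q) * real n powr (- 2 * q)"
      using kappa by (simp add: powr_mult)
    also have "real n * (real n * (c\<^sup>2 * (\<kappa> powr (- 2 * q) * real n powr (- 2 * q)))) = C * (real n powr 2 * real n powr (- 2 * q))"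
      using n by (simp add: C_def power2_eq_square)
    also have "real n powr 2 * real n powr (- 2 * q) = real n powr e"
      using powr_add[of "real n" 2 "- 2 * q"] by (simp add: e_def)
    finally show ?thesis .
  qed
  \<comment> \<open>Rearranged, this is the condition that the squared bias of the variance estimate
    is negligible.\<close>
  have "(4 * q - 1) * (2 * q - 1) > 0" using q by (intro mult_pos_pos) auto
  then have "(3 - 4 * q) * (2 * q) < 1" by (simp add: algebra_simps)
  then have e: "2 * e - 1 < \<beta>" using q by (simp add: e_def \<beta>_def field_simps)
  have S: "(\<lambda>n. real n * enn2real (supRiskMMA \<sigma> (Phi n) n \<kappa> t1 t2 (FTheta (Phi n) n (Hyp c q n))) / V n) \<longlonglongrightarrow> 1"
    by (rule mma_sup_risk_asymp[where \<gamma>=\<gamma> and th=th and \<beta>=\<beta> and ?c0.0=c0 and b="\<lambda>n. C * real n powr e", OF onb s kappa t])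
      (use \<gamma>b \<gamma>d up th lo Vge c0 \<beta>(1) tail tail_negligible[OF Vge c0 e] in auto)
  have "eventually (\<lambda>n. real n * enn2real (RL \<sigma> (Phi n) n (FTheta (Phi n) n (Hyp c q n))) / V n = 1) sequentially"
    using eventually_ge_at_top[of 1]
  proof eventually_elim
    case (elim n)
    have "RL \<sigma> (Phi n) n (FTheta (Phi n) n (Hyp c q n)) = ennreal (V n / real n)"
      by (rule RL_saddle[OF onb elim up th lo])
    then show ?case using Vpos[OF elim] elim by simp
  qed
  then have "(\<lambda>n. real n * enn2real (RL \<sigma> (Phi n) n (FTheta (Phi n) n (Hyp c q n))) / V n) \<longlonglongrightarrow> 1"
    by (rule tendsto_eventually)
  from ratio_tendsto_one[OF S this Vpos] show ?thesis .
qed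

section \<open>The minimax risk over an ellipsoid\<close>

lemma nn_noise_component:
  assumes s: "\<sigma> > 0" and j: "j < n" and f: "f \<in> borel_measurable borel"
  shows "(\<integral>\<^sup>+z. f (z j) \<partial>noise \<sigma> n) = (\<integral>\<^sup>+x. f x \<partial>gauss \<sigma>)"
proof -
  have d: "distr (noise \<sigma> n) (gauss \<sigma>) (\<lambda>z. z j) = gauss \<sigma>"
    unfolding noise_gauss using j by (intro distr_PiM_component prob_gauss s) auto
  have m: "(\<lambda>z. z j) \<in> measurable (noise \<sigma> n) (gauss \<sigma>)"
    unfolding noise_gauss using j by (intro measurable_component_singleton) simp
  have f': "f \<in> borel_measurable (gauss \<sigma>)" using f by (simp cong: measurable_cong_sets add: sets_gauss)
  have "(\<integral>\<^sup>+x. f x \<partial>gauss \<sigma>) = (\<integral>\<^sup>+x. f x \<partial>distr (noise \<sigma> n) (gauss \<sigma>) (\<lambda>z. z j))" by (simp only: d)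
  also have "\<dots> = (\<integral>\<^sup>+z. f (z j) \<partial>noise \<sigma> n)"
    by (intro nn_integral_distr m) (use f' in simp)
  finally show ?thesis ..
qed

text \<open>Shrinking the coefficients by \<gamma> is a measurable estimator, and by rotation
  invariance its risk is exactly \<open>seq_risk / n\<close>.\<close>

lemma (in orthonormal_rows) RM_le_linear:
  assumes s: "\<sigma> > 0" and n: "n \<ge> 1"
    and up: "\<And>\<theta>. \<theta> \<in> Th \<Longrightarrow> seq_risk \<sigma> n \<gamma> (\<lambda>j. sqrt (real n) * \<theta> j) \<le> V"
  shows "RM \<sigma> n (FTheta Phi n Th) \<le> ennreal (V / real n)"
proof -
  define g where "g y = (\<lambda>i. \<Sum>j<n. (\<gamma> j * coord Phi n y j) * Phi j i)" for y
  have "g \<in> estimators n"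
    unfolding estimators_def g_def
    by (auto intro!: borel_measurable_sum borel_measurable_times borel_measurable_const measurable_coord)
  then have "RM \<sigma> n (FTheta Phi n Th) \<le> (SUP f\<in>FTheta Phi n Th. risk \<sigma> n g f)"
    unfolding RM_def by (rule INF_lower)
  also have "\<dots> \<le> ennreal (V / real n)"
  proof (rule SUP_least)
    fix f assume f: "f \<in> FTheta Phi n Th"
    obtain \<theta> where \<theta>: "\<theta> \<in> Th" "\<And>j. j < n \<Longrightarrow> coord Phi n f j = sqrt (real n) * \<theta> j"
      using FTheta_coord[OF orthonormal_rows_axioms f] by blast
    let ?m = "\<lambda>j. coord Phi n f j"
    let ?q = "\<lambda>j z. (\<gamma> j * z + (\<gamma> j - 1) * ?m j)\<^sup>2 / real n"
    have "risk \<sigma> n g f = (\<integral>\<^sup>+e. (\<Sum>j<n. ennreal (?q j (rot Phi n e j))) \<partial>noise \<sigma> n)"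
      unfolding risk_def
    proof (rule nn_integral_cong)
      fix e
      have "sqn n (\<lambda>i. g (restrict (\<lambda>i. f i + e i) {..<n}) i - f i) = (\<Sum>j<n. (\<gamma> j * (?m j + coord Phi n e j) - ?m j)\<^sup>2)"
        unfolding parseval coord_diff by (intro sum.cong refl) (simp add: g_def coord_synth coord_add)
      also have "\<dots> = (\<Sum>j<n. (\<gamma> j * rot Phi n e j + (\<gamma> j - 1) * ?m j)\<^sup>2)"
        by (intro sum.cong refl) (simp add: rot_def algebra_simps)
      finally show "ennreal (sqn n (\<lambda>i. g (restrict (\<lambda>i. f i + e i) {..<n}) i - f i) / real n) = (\<Sum>j<n. ennreal (?q j (rot Phi n e j)))"
        by (simp add: sum_divide_distrib sum_ennreal)
    qed
    also have "\<dots> = (\<integral>\<^sup>+z. (\<Sum>j<n. ennreal (?q j (z j))) \<partial>noise \<sigma> n)"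
      by (rule nn_integral_noise_rot[OF s, where f="\<lambda>z. \<Sum>j<n. ennreal (?q j (z j))"]) measurable
    also have "\<dots> = (\<Sum>j<n. \<integral>\<^sup>+z. ennreal (?q j (z j)) \<partial>noise \<sigma> n)"
      by (rule nn_integral_sum) measurable
    also have "\<dots> = (\<Sum>j<n. ennreal (((\<gamma> j)\<^sup>2 * \<sigma>\<^sup>2 + ((\<gamma> j - 1) * ?m j)\<^sup>2) / real n))"
    proof (rule sum.cong[OF refl])
      fix j assume j: "j \<in> {..<n}"
      have "(\<integral>\<^sup>+z. ennreal (?q j (z j)) \<partial>noise \<sigma> n) = (\<integral>\<^sup>+x. ennreal (?q j x) \<partial>gauss \<sigma>)"
        using j by (intro nn_noise_component[OF s, where f="\<lambda>x. ennreal (?q j x)"]) auto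
      also have "\<dots> = (\<integral>\<^sup>+x. ennreal (1 / real n) * ennreal ((\<gamma> j * x + (\<gamma> j - 1) * ?m j)\<^sup>2) \<partial>gauss \<sigma>)"
        by (intro nn_integral_cong) (simp add: ennreal_mult'[symmetric])
      also have "\<dots> = ennreal (1 / real n) * (\<integral>\<^sup>+x. ennreal ((\<gamma> j * x + (\<gamma> j - 1) * ?m j)\<^sup>2) \<partial>gauss \<sigma>)"
        by (rule nn_integral_cmult) measurable
      also have "\<dots> = ennreal (((\<gamma> j)\<^sup>2 * \<sigma>\<^sup>2 + ((\<gamma> j - 1) * ?m j)\<^sup>2) / real n)"
        unfolding nn_gauss_lin_sq[OF s] by (simp add: ennreal_mult'[symmetric] del: ennreal_plus)
      finally show "(\<integral>\<^sup>+z. ennreal (?q j (z j)) \<partial>noise \<sigma> n) = \<dots>" .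
    qed
    also have "\<dots> = ennreal (seq_risk \<sigma> n \<gamma> ?m / real n)"
      unfolding seq_risk_def sum_divide_distrib
      by (subst sum_ennreal) (auto intro!: arg_cong[where f=ennreal] sum.cong simp: power_mult_distrib power2_commute[of "\<gamma> _" 1] mult.commute add.commute)
    also have "seq_risk \<sigma> n \<gamma> ?m = seq_risk \<sigma> n \<gamma> (\<lambda>j. sqrt (real n) * \<theta> j)" by (rule seq_risk_cong) (rule \<theta>(2))
    also have "ennreal (\<dots> / real n) \<le> ennreal (V / real n)"
      using up[OF \<theta>(1)] by (intro ennreal_leI divide_right_mono) auto
    finally show "risk \<sigma> n g f \<le> ennreal (V / real n)" .
  qed
  finally show ?thesis .
qed

text \<open>Clipping to the range of the coefficients over the ellipsoid never increases the loss
  there. It keeps the loss bounded outside, where the supremum over the class gives no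
  control.\<close>

definition clip :: "real \<Rightarrow> real \<Rightarrow> real" where
  "clip L x = max (- L) (min L x)"

lemma clip_bound: "L \<ge> 0 \<Longrightarrow> \<bar>clip L x\<bar> \<le> L"
  by (auto simp: clip_def)

lemma clip_closer: "\<bar>m\<bar> \<le> L \<Longrightarrow> (clip L x - m)\<^sup>2 \<le> (x - m)\<^sup>2"
  by (intro iffD1[OF abs_le_square_iff]) (auto simp: clip_def)

context orthonormal_rows
begin

text \<open>The estimator carried to the sequence model: it is fed the vector with coefficients
  \<open>x\<close>, and coefficient \<open>j\<close> of its answer is clipped.\<close>

definition clipped :: "real \<Rightarrow> ((nat \<Rightarrow> real) \<Rightarrow> nat \<Rightarrow> real) \<Rightarrow> nat \<Rightarrow> (nat \<Rightarrow> real) \<Rightarrow> real" where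
  "clipped L g j x = clip L (\<Sum>i<n. Phi j i * g (restrict (\<lambda>i. \<Sum>l<n. x l * Phi l i) {..<n}) i)"

lemma clipped_measurable:
  assumes "g \<in> estimators n"
  shows "clipped L g j \<in> borel_measurable (PiM {..<n} (\<lambda>_. borel))"
proof -
  have m: "(\<lambda>x. restrict (\<lambda>i. \<Sum>l<n. x l * Phi l i) {..<n}) \<in> measurable (PiM {..<n} (\<lambda>_. borel)) (PiM {..<n} (\<lambda>_. borel :: real measure))"
    by measurable
  have "(\<lambda>x. g (restrict (\<lambda>i. \<Sum>l<n. x l * Phi l i) {..<n}) i) \<in> borel_measurable (PiM {..<n} (\<lambda>_. borel))" if "i < n" for i
    using assms that by (intro measurable_compose[OF m]) (auto simp: estimators_def)
  then have "(\<lambda>x. \<Sum>i<n. Phi j i * g (restrict (\<lambda>i. \<Sum>l<n. x l * Phi l i) {..<n}) i) \<in> borel_measurable (PiM {..<n} (\<lambda>_. borel))"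
    by (intro borel_measurable_sum borel_measurable_times borel_measurable_const) auto
  then show ?thesis unfolding clipped_def clip_def
    by (intro borel_measurable_max borel_measurable_min borel_measurable_const)
qed

lemma clipped_risk_le:
  assumes s: "\<sigma> > 0" and n: "n \<ge> 1" and g: "g \<in> estimators n"
    and \<mu>: "\<And>j. j < n \<Longrightarrow> coord Phi n f j = \<mu> j" "\<And>j. j < n \<Longrightarrow> \<bar>\<mu> j\<bar> \<le> L"
  shows "(\<integral>\<^sup>+z. ennreal (\<Sum>j<n. (clipped L g j (restrict (\<lambda>i. \<mu> i + z i) {..<n}) - \<mu> j)\<^sup>2) \<partial>noise \<sigma> n) \<le> ennreal (real n) * risk \<sigma> n g f"
proof -
  let ?H = "\<lambda>z. ennreal ((\<Sum>j<n. (clipped L g j (restrict (\<lambda>i. \<mu> i + z i) {..<n}) - \<mu> j)\<^sup>2) / real n)"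
  have m1: "(\<lambda>z. clipped L g j (restrict (\<lambda>i. \<mu> i + z i) {..<n})) \<in> borel_measurable (PiM {..<n} (\<lambda>_. borel))" for j
    by (rule measurable_compose[OF _ clipped_measurable[OF g]]) measurable
  have m: "?H \<in> borel_measurable (PiM {..<n} (\<lambda>_. borel))"
    by (intro measurable_compose[OF _ measurable_ennreal] borel_measurable_divide borel_measurable_sum borel_measurable_power borel_measurable_diff borel_measurable_const m1)
  have m': "?H \<in> borel_measurable (noise \<sigma> n)" using m by (simp cong: measurable_cong_sets add: sets_noise)
  have "(\<integral>\<^sup>+z. ?H z \<partial>noise \<sigma> n) = (\<integral>\<^sup>+e. ?H (rot Phi n e) \<partial>noise \<sigma> n)"
    by (rule nn_integral_noise_rot[OF s m, symmetric])
  also have "\<dots> \<le> risk \<sigma> n g f"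
    unfolding risk_def
  proof (intro nn_integral_mono ennreal_leI divide_right_mono)
    fix e :: "nat \<Rightarrow> real"
    let ?y = "restrict (\<lambda>i. f i + e i) {..<n}"
    let ?x = "restrict (\<lambda>i. \<mu> i + rot Phi n e i) {..<n}"
    have "restrict (\<lambda>i. \<Sum>l<n. ?x l * Phi l i) {..<n} = ?y"
    proof (rule restrict_ext)
      fix i assume i: "i \<in> {..<n}"
      have "(\<Sum>l<n. ?x l * Phi l i) = (\<Sum>l<n. coord Phi n (\<lambda>i. f i + e i) l * Phi l i)"
        by (intro sum.cong refl) (simp add: rot_def coord_add \<mu>(1))
      also have "\<dots> = f i + e i" using i by (intro synth_coord) auto
      finally show "(\<Sum>l<n. ?x l * Phi l i) = f i + e i" .
    qed
    then have c: "clipped L g j ?x = clip L (coord Phi n (g ?y) j)" for j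
      by (simp add: clipped_def coord_def)
    have "(\<Sum>j<n. (clipped L g j ?x - \<mu> j)\<^sup>2) \<le> (\<Sum>j<n. (coord Phi n (g ?y) j - \<mu> j)\<^sup>2)"
      unfolding c using \<mu>(2) by (intro sum_mono clip_closer) auto
    also have "\<dots> = sqn n (\<lambda>i. g ?y i - f i)"
      unfolding parseval coord_diff by (simp add: \<mu>(1))
    finally show "(\<Sum>j<n. (clipped L g j ?x - \<mu> j)\<^sup>2) \<le> sqn n (\<lambda>i. g ?y i - f i)" .
  qed simp
  finally have le: "(\<integral>\<^sup>+z. ?H z \<partial>noise \<sigma> n) \<le> risk \<sigma> n g f" .
  have "(\<integral>\<^sup>+z. ennreal (\<Sum>j<n. (clipped L g j (restrict (\<lambda>i. \<mu> i + z i) {..<n}) - \<mu> j)\<^sup>2) \<partial>noise \<sigma> n) = (\<integral>\<^sup>+z. ennreal (real n) * ?H z \<partial>noise \<sigma> n)"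
    using n by (intro nn_integral_cong) (simp add: ennreal_mult'[symmetric])
  also have "\<dots> = ennreal (real n) * (\<integral>\<^sup>+z. ?H z \<partial>noise \<sigma> n)" by (rule nn_integral_cmult[OF m'])
  also have "\<dots> \<le> ennreal (real n) * risk \<sigma> n g f" by (intro mult_left_mono le) simp
  finally show ?thesis .
qed

end

text \<open>The Gaussian prior \<open>\<mu> j = \<tau> j * \<xi> j\<close> has the required Bayes risk; outside the ellipsoid the clipped
  estimator loses at most \<open>2 * (n * L\<^sup>2 + sqn n \<mu>)\<close>, which is dominated by an exponential moment of the
  quadratic form \<open>Q\<close> defining the ellipsoid.\<close>
lemma (in orthonormal_rows) bayes_lower_bound:
  fixes \<alpha> R :: real
  assumes s: "\<sigma> > 0" and n: "n \<ge> 1" and \<alpha>: "\<alpha> \<ge> 0" and R: "R \<ge> 0" and l: "\<nu> > 0"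
    and x: "\<And>j. j < n \<Longrightarrow> \<nu> * (real (j + 1) powr (2 * \<alpha>) * (\<tau> j)\<^sup>2 / real n) \<le> 1/4"
    and g: "g \<in> estimators n"
  defines "a \<equiv> \<lambda>j. real (j + 1) powr (2 * \<alpha>) * (\<tau> j)\<^sup>2 / real n"
  shows "ennreal (\<Sum>j<n. (\<tau> j)\<^sup>2 * \<sigma>\<^sup>2 / ((\<tau> j)\<^sup>2 + \<sigma>\<^sup>2)) \<le>
     ennreal (real n) * (SUP f\<in>FTheta Phi n (Ell \<alpha> R n). risk \<sigma> n g f) +
     ennreal (2 * real n * (real n * R + R + 1 / \<nu>) * exp (- \<nu> * R + (\<Sum>j<n. \<nu> * a j + 4 * (\<nu> * a j)\<^sup>2)))"
proof -
  \<comment> \<open>All weights of the ellipsoid are at least 1, so every squared coefficient of a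
    member of the class is at most \<open>n * R\<close>.\<close>
  define L where "L = sqrt (real n * R)"
  have L: "L \<ge> 0" "L\<^sup>2 = real n * R" using R by (auto simp: L_def)
  define S where "S = (SUP f\<in>FTheta Phi n (Ell \<alpha> R n). risk \<sigma> n g f)"
  define Q where "Q \<xi> = (\<Sum>j<n. a j * (\<xi> j)\<^sup>2)" for \<xi> :: "nat \<Rightarrow> real"
  let ?h = "\<lambda>\<xi> z j. clipped L g j (restrict (\<lambda>i. \<tau> i * \<xi> i + z i) {..<n})"
  define D where "D = 2 * real n * (real n * R + R + 1 / \<nu>)"
  have D: "D \<ge> 0" using R l by (simp add: D_def)
  interpret N: prob_space "noise \<sigma> n" by (rule prob_noise[OF s])
  interpret N1: prob_space "noise 1 n" by (rule prob_noise) simp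
  have a0: "a j \<ge> 0" for j by (simp add: a_def)
  have Q0: "Q \<xi> \<ge> 0" for \<xi> by (simp add: Q_def a0 sum_nonneg)
  have inner: "(\<integral>\<^sup>+z. ennreal (\<Sum>j<n. (?h \<xi> z j - \<tau> j * \<xi> j)\<^sup>2) \<partial>noise \<sigma> n) \<le> ennreal (real n) * S + ennreal (D * exp (\<nu> * (Q \<xi> - R)))" for \<xi>
  proof (cases "Q \<xi> \<le> R")
    case True
    define \<theta> where "\<theta> j = \<tau> j * \<xi> j / sqrt (real n)" for j
    have aq: "a j * (\<xi> j)\<^sup>2 = real (j + 1) powr (2 * \<alpha>) * (\<theta> j)\<^sup>2" for j
      using n by (simp add: a_def \<theta>_def power_mult_distrib power_divide)
    then have \<theta>: "\<theta> \<in> Ell \<alpha> R n" using True by (simp add: Ell_def Q_def)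
    obtain f where f: "f \<in> FTheta Phi n (Ell \<alpha> R n)" "\<And>j. j < n \<Longrightarrow> coord Phi n f j = sqrt (real n) * \<theta> j"
      using synth_in_FTheta[OF orthonormal_rows_axioms \<theta>] by blast
    have f2: "coord Phi n f j = \<tau> j * \<xi> j" if "j < n" for j using f(2)[OF that] n by (simp add: \<theta>_def)
    have bd: "\<bar>\<tau> j * \<xi> j\<bar> \<le> L" if j: "j < n" for j
    proof -
      have "1 * (\<theta> j)\<^sup>2 \<le> real (j + 1) powr (2 * \<alpha>) * (\<theta> j)\<^sup>2"
        using \<alpha> by (intro mult_right_mono ge_one_powr_ge_zero) auto
      also have "\<dots> \<le> Q \<xi>" unfolding aq[symmetric] Q_def
        using j a0 by (intro member_le_sum) auto
      finally have "(\<theta> j)\<^sup>2 \<le> R" using True by simp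
      then have "real n * (\<theta> j)\<^sup>2 \<le> L\<^sup>2" unfolding L by (intro mult_left_mono) auto
      then have "(\<tau> j * \<xi> j)\<^sup>2 \<le> L\<^sup>2" using n by (simp add: \<theta>_def power_divide)
      then show ?thesis using L(1) by (metis abs_le_square_iff abs_of_nonneg)
    qed
    have "(\<integral>\<^sup>+z. ennreal (\<Sum>j<n. (?h \<xi> z j - \<tau> j * \<xi> j)\<^sup>2) \<partial>noise \<sigma> n) \<le> ennreal (real n) * risk \<sigma> n g f"
      by (rule clipped_risk_le[OF s n g f2 bd])
    also have "\<dots> \<le> ennreal (real n) * S" unfolding S_def by (intro mult_left_mono SUP_upper f(1)) simp
    also have "\<dots> \<le> ennreal (real n) * S + ennreal (D * exp (\<nu> * (Q \<xi> - R)))" by simp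
    finally show ?thesis .
  next
    case False
    have "(\<Sum>j<n. (?h \<xi> z j - \<tau> j * \<xi> j)\<^sup>2) \<le> D * exp (\<nu> * (Q \<xi> - R))" for z
    proof -
      have "(\<Sum>j<n. (?h \<xi> z j - \<tau> j * \<xi> j)\<^sup>2) \<le> (\<Sum>j<n. 2 * (real n * R) + 2 * real n * (a j * (\<xi> j)\<^sup>2))"
      proof (rule sum_mono)
        fix j assume "j \<in> {..<n}"
        have "\<bar>?h \<xi> z j\<bar>\<^sup>2 \<le> L\<^sup>2" unfolding clipped_def by (intro power_mono clip_bound L) simp
        then have 1: "(?h \<xi> z j)\<^sup>2 \<le> real n * R" by (simp add: L)
        have "1 * (\<tau> j * \<xi> j)\<^sup>2 \<le> real (j + 1) powr (2 * \<alpha>) * (\<tau> j * \<xi> j)\<^sup>2"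
          using \<alpha> by (intro mult_right_mono ge_one_powr_ge_zero) auto
        also have "\<dots> = real n * (a j * (\<xi> j)\<^sup>2)" using n by (simp add: a_def power_mult_distrib)
        finally have 2: "(\<tau> j * \<xi> j)\<^sup>2 \<le> real n * (a j * (\<xi> j)\<^sup>2)" by simp
        have "(p - q)\<^sup>2 \<le> 2 * p\<^sup>2 + 2 * q\<^sup>2" for p q :: real
        proof -
          have "0 \<le> (p + q)\<^sup>2" by simp
          then show ?thesis by (simp add: power2_eq_square algebra_simps)
        qed
        from this[of "?h \<xi> z j" "\<tau> j * \<xi> j"] 1 2
        show "(?h \<xi> z j - \<tau> j * \<xi> j)\<^sup>2 \<le> 2 * (real n * R) + 2 * real n * (a j * (\<xi> j)\<^sup>2)" by linarith
      qed
      also have "\<dots> = 2 * real n * (real n * R + Q \<xi>)"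
        by (simp add: sum.distrib Q_def sum_distrib_left algebra_simps)
      \<comment> \<open>Outside the ellipsoid the exponential is at least 1 and at least
        \<open>\<nu> * (Q \<xi> - R)\<close>: the first bound pays for the constants, the second for
        the excess of \<open>Q \<xi>\<close> and produces \<open>1 / \<nu>\<close>.\<close>
      also have "\<dots> \<le> 2 * real n * ((real n * R + R + 1 / \<nu>) * exp (\<nu> * (Q \<xi> - R)))"
      proof (intro mult_left_mono)
        define E where "E = exp (\<nu> * (Q \<xi> - R))"
        have "0 \<le> \<nu> * (Q \<xi> - R)" using False l by simp
        then have E1: "1 \<le> E" by (simp add: E_def)
        have "\<nu> * (Q \<xi> - R) \<le> E" unfolding E_def using exp_ge_add_one_self[of "\<nu> * (Q \<xi> - R)"] by linarith
        then have "Q \<xi> - R \<le> 1 / \<nu> * E" using l by (simp add: field_simps)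
        moreover have "(real n * R + R) * 1 \<le> (real n * R + R) * E" using E1 R by (intro mult_left_mono) auto
        ultimately show "real n * R + Q \<xi> \<le> (real n * R + R + 1 / \<nu>) * exp (\<nu> * (Q \<xi> - R))"
          by (simp add: E_def[symmetric] distrib_right)
      qed simp
      finally show ?thesis by (simp add: D_def mult.assoc)
    qed
    then have "(\<integral>\<^sup>+z. ennreal (\<Sum>j<n. (?h \<xi> z j - \<tau> j * \<xi> j)\<^sup>2) \<partial>noise \<sigma> n) \<le> (\<integral>\<^sup>+z. ennreal (D * exp (\<nu> * (Q \<xi> - R))) \<partial>noise \<sigma> n)"
      by (intro nn_integral_mono ennreal_leI)
    also have "\<dots> = ennreal (D * exp (\<nu> * (Q \<xi> - R)))" by (simp add: N.emeasure_space_1)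
    also have "\<dots> \<le> ennreal (real n) * S + ennreal (D * exp (\<nu> * (Q \<xi> - R)))" by simp
    finally show ?thesis .
  qed
  have mz: "(\<lambda>z. ennreal ((?h \<xi> z j - \<tau> j * \<xi> j)\<^sup>2)) \<in> borel_measurable (noise \<sigma> n)" for \<xi> j
  proof -
    have "(\<lambda>z. restrict (\<lambda>i. \<tau> i * \<xi> i + z i) {..<n}) \<in> measurable (noise \<sigma> n) (PiM {..<n} (\<lambda>_. borel))"
      by measurable
    from measurable_compose[OF this clipped_measurable[OF g, of L j]]
    show ?thesis by (intro measurable_compose[OF _ measurable_ennreal] borel_measurable_power borel_measurable_diff borel_measurable_const)
  qed
  have m\<xi>: "(\<lambda>\<xi>. \<integral>\<^sup>+z. ennreal ((?h \<xi> z j - \<tau> j * \<xi> j)\<^sup>2) \<partial>noise \<sigma> n) \<in> borel_measurable (noise 1 n)" if j: "j < n" for j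
  proof -
    have c: "(\<lambda>p. \<tau> i * fst p i + snd p i) \<in> borel_measurable (noise 1 n \<Otimes>\<^sub>M noise \<sigma> n)" if "i \<in> {..<n}" for i
      using that by (intro borel_measurable_add borel_measurable_times borel_measurable_const
          measurable_compose[OF measurable_fst] measurable_compose[OF measurable_snd] measurable_noise_component) auto
    have "(\<lambda>p. restrict (\<lambda>i. \<tau> i * fst p i + snd p i) {..<n}) \<in> measurable (noise 1 n \<Otimes>\<^sub>M noise \<sigma> n) (PiM {..<n} (\<lambda>_. borel))"
      by (rule measurable_restrict) (rule c)
    from measurable_compose[OF this clipped_measurable[OF g, of L j]]
    have m: "(\<lambda>p. ?h (fst p) (snd p) j) \<in> borel_measurable (noise 1 n \<Otimes>\<^sub>M noise \<sigma> n)" .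
    have m': "(\<lambda>p. \<tau> j * fst p j) \<in> borel_measurable (noise 1 n \<Otimes>\<^sub>M noise \<sigma> n)"
      using j by (intro borel_measurable_times borel_measurable_const measurable_compose[OF measurable_fst] measurable_noise_component)
    have "(\<lambda>p. ennreal ((?h (fst p) (snd p) j - \<tau> j * fst p j)\<^sup>2)) \<in> borel_measurable (noise 1 n \<Otimes>\<^sub>M noise \<sigma> n)"
      by (intro measurable_compose[OF _ measurable_ennreal] borel_measurable_power borel_measurable_diff m m')
    from N.borel_measurable_nn_integral_fst[OF this] show ?thesis by (simp only: fst_conv snd_conv)
  qed
  have mQ: "(\<lambda>\<xi>. ennreal (exp (\<Sum>j<n. (\<nu> * a j) * (\<xi> j)\<^sup>2))) \<in> borel_measurable (noise 1 n)"
    by (intro measurable_compose[OF _ measurable_ennreal] measurable_compose[OF _ borel_measurable_exp] borel_measurable_sum borel_measurable_times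
        borel_measurable_power borel_measurable_const measurable_noise_component) auto
  have eQ: "ennreal (D * exp (\<nu> * (Q \<xi> - R))) = ennreal (D * exp (- \<nu> * R)) * ennreal (exp (\<Sum>j<n. (\<nu> * a j) * (\<xi> j)\<^sup>2))" for \<xi>
  proof -
    have "\<nu> * (Q \<xi> - R) = - \<nu> * R + (\<Sum>j<n. (\<nu> * a j) * (\<xi> j)\<^sup>2)" by (simp add: Q_def sum_distrib_left algebra_simps)
    then show ?thesis using D by (simp only: exp_add) (simp add: ennreal_mult'[symmetric] mult.assoc)
  qed
  have "ennreal (\<Sum>j<n. (\<tau> j)\<^sup>2 * \<sigma>\<^sup>2 / ((\<tau> j)\<^sup>2 + \<sigma>\<^sup>2)) = (\<Sum>j<n. ennreal ((\<tau> j)\<^sup>2 * \<sigma>\<^sup>2 / ((\<tau> j)\<^sup>2 + \<sigma>\<^sup>2)))"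
    by (rule sum_ennreal[symmetric]) simp
  also have "\<dots> \<le> (\<Sum>j<n. \<integral>\<^sup>+\<xi>. \<integral>\<^sup>+z. ennreal ((?h \<xi> z j - \<tau> j * \<xi> j)\<^sup>2) \<partial>noise \<sigma> n \<partial>noise 1 n)"
    by (intro sum_mono bayes_risk_coordinate s clipped_measurable[OF g]) simp
  also have "\<dots> = (\<integral>\<^sup>+\<xi>. (\<Sum>j<n. \<integral>\<^sup>+z. ennreal ((?h \<xi> z j - \<tau> j * \<xi> j)\<^sup>2) \<partial>noise \<sigma> n) \<partial>noise 1 n)"
    by (rule nn_integral_sum[symmetric]) (rule m\<xi>, simp)
  also have "\<dots> = (\<integral>\<^sup>+\<xi>. (\<integral>\<^sup>+z. ennreal (\<Sum>j<n. (?h \<xi> z j - \<tau> j * \<xi> j)\<^sup>2) \<partial>noise \<sigma> n) \<partial>noise 1 n)"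
  proof (rule nn_integral_cong)
    fix \<xi>
    have "(\<Sum>j<n. \<integral>\<^sup>+z. ennreal ((?h \<xi> z j - \<tau> j * \<xi> j)\<^sup>2) \<partial>noise \<sigma> n) = (\<integral>\<^sup>+z. (\<Sum>j<n. ennreal ((?h \<xi> z j - \<tau> j * \<xi> j)\<^sup>2)) \<partial>noise \<sigma> n)"
      by (rule nn_integral_sum[symmetric]) (rule mz)
    also have "\<dots> = (\<integral>\<^sup>+z. ennreal (\<Sum>j<n. (?h \<xi> z j - \<tau> j * \<xi> j)\<^sup>2) \<partial>noise \<sigma> n)"
      by (rule nn_integral_cong) (rule sum_ennreal, simp)
    finally show "(\<Sum>j<n. \<integral>\<^sup>+z. ennreal ((?h \<xi> z j - \<tau> j * \<xi> j)\<^sup>2) \<partial>noise \<sigma> n) = \<dots>" .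
  qed
  also have "\<dots> \<le> (\<integral>\<^sup>+\<xi>. ennreal (real n) * S + ennreal (D * exp (- \<nu> * R)) * ennreal (exp (\<Sum>j<n. (\<nu> * a j) * (\<xi> j)\<^sup>2)) \<partial>noise 1 n)"
    unfolding eQ[symmetric] by (intro nn_integral_mono inner)
  also have "\<dots> = ennreal (real n) * S + ennreal (D * exp (- \<nu> * R)) * (\<integral>\<^sup>+\<xi>. ennreal (exp (\<Sum>j<n. (\<nu> * a j) * (\<xi> j)\<^sup>2)) \<partial>noise 1 n)"
    using mQ by (subst nn_integral_add) (simp_all add: N1.emeasure_space_1 nn_integral_cmult)
  also have "\<dots> \<le> ennreal (real n) * S + ennreal (D * exp (- \<nu> * R)) * ennreal (exp (\<Sum>j<n. \<nu> * a j + 4 * (\<nu> * a j)\<^sup>2))"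
    using x l a0 by (intro add_left_mono mult_left_mono exp_quadratic_form_moment) (auto simp: a_def)
  also have "ennreal (D * exp (- \<nu> * R)) * ennreal (exp (\<Sum>j<n. \<nu> * a j + 4 * (\<nu> * a j)\<^sup>2))
     = ennreal (D * exp (- \<nu> * R + (\<Sum>j<n. \<nu> * a j + 4 * (\<nu> * a j)\<^sup>2)))"
    unfolding exp_add using D by (simp add: ennreal_mult'[symmetric] mult.assoc)
  finally show ?thesis by (simp add: S_def D_def)
qed

section \<open>Pinsker's saddle point for the ellipsoid\<close>

lemma pinsker_level_exists:
  fixes a :: "nat \<Rightarrow> real"
  assumes s: "\<sigma> > 0" and R: "R > 0" and n: "n \<ge> 1" and a: "a 0 = 1" "\<And>j. a j \<ge> 1"
  shows "\<exists>t\<ge>1. \<sigma>\<^sup>2 / real n * (\<Sum>j<n. a j * max 0 (t - a j)) = R"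
proof -
  define F where "F t = \<sigma>\<^sup>2 / real n * (\<Sum>j<n. a j * max 0 (t - a j))" for t
  have a0: "0 \<le> a j" for j using a(2)[of j] by linarith
  define b where "b = 1 + real n * R / \<sigma>\<^sup>2"
  have b: "b \<ge> 1" using R by (simp add: b_def)
  have "max 0 (1 - a j) = 0" for j using a(2)[of j] by simp
  then have "F 1 = 0" by (simp add: F_def)
  moreover have "F b \<ge> R"
  proof -
    \<comment> \<open>The first term alone reaches the radius, as \<open>b\<close> is chosen to make
      it equal to \<open>n * R / \<sigma>\<^sup>2\<close>; the intermediate value theorem does the
      rest.\<close>
    have "a 0 * max 0 (b - a 0) \<le> (\<Sum>j<n. a j * max 0 (b - a j))"
      using n a0 by (intro member_le_sum) auto
    then have "\<sigma>\<^sup>2 / real n * (real n * R / \<sigma>\<^sup>2) \<le> F b"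
      unfolding F_def using b by (intro mult_left_mono) (auto simp: a(1) b_def)
    then show ?thesis using n s by simp
  qed
  moreover have "continuous_on {1..b} F" unfolding F_def by (intro continuous_intros)
  ultimately have "\<exists>t. 1 \<le> t \<and> t \<le> b \<and> F t = R"
    using R b by (intro IVT') auto
  then show ?thesis by (auto simp: F_def)
qed

text \<open>\<open>t\<close> is the level at which Pinsker's factors reach 0. The equation
  \<open>level\<close> places the least favourable sequence on the boundary of the ellipsoid, see
  \<open>energy_sum\<close>.\<close>

locale pinsker =
  fixes \<sigma> \<alpha> R t :: real and n :: nat
  assumes s: "\<sigma> > 0" and \<alpha>: "\<alpha> > 0" and R: "R > 0" and n: "n \<ge> 1" and t: "t \<ge> 1"
    and level: "\<sigma>\<^sup>2 / real n * (\<Sum>j<n. real (j + 1) powr \<alpha> * max 0 (t - real (j + 1) powr \<alpha>)) = R"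
begin

definition "a j = real (j + 1) powr \<alpha>"
definition "\<gamma> j = max 0 (1 - a j / t)"
text \<open>Solves \<open>x / (x + \<sigma>\<^sup>2) = \<gamma> j\<close> for
  \<open>x = n * (th j)\<^sup>2\<close>: the factors \<gamma> are then optimal for
  \<open>th\<close>, as a saddle point demands.\<close>

definition "th j = sqrt (\<sigma>\<^sup>2 / real n * max 0 (t / a j - 1))"
definition "V = \<sigma>\<^sup>2 * (\<Sum>j<n. \<gamma> j)"

lemma a1: "a j \<ge> 1" using \<alpha> by (auto simp: a_def intro!: ge_one_powr_ge_zero)

lemma a0: "0 \<le> a j" using a1[of j] by linarith

lemma a_sq: "real (j + 1) powr (2 * \<alpha>) = (a j)\<^sup>2"
  by (simp add: a_def powr_power mult.commute)

lemma th_sq: "(th j)\<^sup>2 = \<sigma>\<^sup>2 / real n * max 0 (t / a j - 1)"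
  by (simp add: th_def)

lemma energy: "(a j)\<^sup>2 * (th j)\<^sup>2 = \<sigma>\<^sup>2 / real n * (a j * max 0 (t - a j))"
proof -
  have "a j > 0" using a1[of j] by simp
  then have "(a j)\<^sup>2 * max 0 (t / a j - 1) = a j * max 0 (t - a j)"
    by (simp add: max_def field_simps power2_eq_square)
  then show ?thesis by (simp add: th_sq mult_ac)
qed

lemma energy_sum: "(\<Sum>j<n. (a j)\<^sup>2 * (th j)\<^sup>2) = R"
  unfolding energy using level by (simp add: sum_distrib_left a_def)

text \<open>No single coordinate carries more than a vanishing share of the radius: with
  \<open>level_le\<close> the bound is of order \<open>n powr (- \<beta>)\<close>. This makes the
  quadratic form of the prior concentrate.\<close>

lemma energy_le: "(a j)\<^sup>2 * (th j)\<^sup>2 \<le> \<sigma>\<^sup>2 * t\<^sup>2 / real n"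
proof -
  have "a j * max 0 (t - a j) \<le> t * t"
    using a1[of j] t by (cases "a j \<le> t") (auto simp: max_def intro!: mult_mono)
  then have "\<sigma>\<^sup>2 / real n * (a j * max 0 (t - a j)) \<le> \<sigma>\<^sup>2 / real n * (t * t)" by (intro mult_left_mono) auto
  then show ?thesis unfolding energy by (simp add: power2_eq_square)
qed

lemma th_in_Ell: "th \<in> Ell \<alpha> R n"
  using energy_sum by (simp add: Ell_def a_sq[simplified])

lemma gamma_bounds: "0 \<le> \<gamma> j" "\<gamma> j \<le> 1"
  using a1[of j] t by (auto simp: \<gamma>_def)

lemma gamma_antimono: "i \<le> j \<Longrightarrow> \<gamma> j \<le> \<gamma> i"
proof -
  assume "i \<le> j"
  then have "a i \<le> a j" unfolding a_def using \<alpha> by (intro powr_mono2) auto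
  then have "a i / t \<le> a j / t" using t by (intro divide_right_mono) auto
  then show ?thesis by (auto simp: \<gamma>_def)
qed

lemma signal_value: "(sqrt (real n) * th j)\<^sup>2 * \<sigma>\<^sup>2 / ((sqrt (real n) * th j)\<^sup>2 + \<sigma>\<^sup>2) = \<sigma>\<^sup>2 * \<gamma> j"
proof -
  have p: "a j > 0" "t > 0" using a1[of j] t by auto
  have x: "(sqrt (real n) * th j)\<^sup>2 = \<sigma>\<^sup>2 * max 0 (t / a j - 1)" using n by (simp add: power_mult_distrib th_sq)
  show ?thesis
  proof (cases "a j \<le> t")
    case True
    then have y: "(sqrt (real n) * th j)\<^sup>2 = \<sigma>\<^sup>2 * (t / a j - 1)" "\<gamma> j = 1 - a j / t"
      using p unfolding x by (auto simp: \<gamma>_def max_def field_simps)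
    have "(sqrt (real n) * th j)\<^sup>2 + \<sigma>\<^sup>2 = \<sigma>\<^sup>2 * (t / a j)" unfolding y by (simp add: algebra_simps)
    then have "(sqrt (real n) * th j)\<^sup>2 * \<sigma>\<^sup>2 / ((sqrt (real n) * th j)\<^sup>2 + \<sigma>\<^sup>2) = \<sigma>\<^sup>2 * ((t / a j - 1) / (t / a j))"
      unfolding y(1) using s p by (simp add: field_simps)
    also have "(t / a j - 1) / (t / a j) = 1 - a j / t" using p by (simp add: field_simps)
    finally show ?thesis by (simp add: y(2))
  next
    case False
    then have "max 0 (t / a j - 1) = 0" "\<gamma> j = 0" using p by (auto simp: \<gamma>_def max_def field_simps)
    then show ?thesis unfolding x by simp
  qed
qed

lemma lower: "V \<le> seq_risk \<sigma> n g (\<lambda>j. sqrt (real n) * th j)"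
  using seq_risk_ge[OF s, where \<mu>="\<lambda>j. sqrt (real n) * th j" and n=n and g=g] unfolding signal_value V_def
  by (simp add: sum_distrib_left)

text \<open>Pinsker's factors satisfy \<open>1 - \<gamma> j \<le> a j / t\<close>, so the bias is at
  most a multiple of the quadratic form that defines the ellipsoid and depends on \<theta> only
  through the radius. The level equation turns this bound into \<sigma>^2 times the sum of
  \<open>\<gamma> j - (\<gamma> j)\<^sup>2\<close>, and the variance supplies the missing
  squares.\<close>

lemma upper:
  assumes "\<theta> \<in> Ell \<alpha> R n"
  shows "seq_risk \<sigma> n \<gamma> (\<lambda>j. sqrt (real n) * \<theta> j) \<le> V"
proof -
  have p: "a j > 0 \<and> t > 0" for j using a1[of j] t by auto
  have "(1 - \<gamma> j)\<^sup>2 \<le> (a j / t)\<^sup>2" for j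
    using p[of j] by (intro power_mono) (auto simp: \<gamma>_def max_def)
  then have "(1 - \<gamma> j)\<^sup>2 * (sqrt (real n) * \<theta> j)\<^sup>2 \<le> (a j / t)\<^sup>2 * (sqrt (real n) * \<theta> j)\<^sup>2" for j
    by (intro mult_right_mono) auto
  then have "(\<Sum>j<n. (1 - \<gamma> j)\<^sup>2 * (sqrt (real n) * \<theta> j)\<^sup>2) \<le> (\<Sum>j<n. real n / t\<^sup>2 * (real (j + 1) powr (2 * \<alpha>) * (\<theta> j)\<^sup>2))"
    unfolding a_sq by (intro sum_mono) (simp add: power_mult_distrib power_divide mult_ac)
  also have "\<dots> = real n / t\<^sup>2 * (\<Sum>j<n. real (j + 1) powr (2 * \<alpha>) * (\<theta> j)\<^sup>2)" by (rule sum_distrib_left[symmetric])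
  also have "\<dots> \<le> real n / t\<^sup>2 * R" using assms unfolding Ell_def by (intro mult_left_mono) auto
  also have "\<dots> = real n / t\<^sup>2 * (\<sigma>\<^sup>2 / real n * (\<Sum>j<n. a j * max 0 (t - a j)))" using level by (simp add: a_def)
  also have "\<dots> = \<sigma>\<^sup>2 * (\<Sum>j<n. a j * max 0 (t - a j) / t\<^sup>2)"
    using n by (simp add: sum_divide_distrib[symmetric])
  also have "(\<Sum>j<n. a j * max 0 (t - a j) / t\<^sup>2) = (\<Sum>j<n. \<gamma> j - (\<gamma> j)\<^sup>2)"
  proof (intro sum.cong refl)
    fix j
    show "a j * max 0 (t - a j) / t\<^sup>2 = \<gamma> j - (\<gamma> j)\<^sup>2"
    proof (cases "a j \<le> t")
      case True
      then have g: "\<gamma> j = 1 - a j / t" using p[of j] by (auto simp: \<gamma>_def max_def field_simps)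
      have "a j * max 0 (t - a j) / t\<^sup>2 = (a j / t) * (1 - a j / t)"
        using True p[of j] by (simp add: power2_eq_square field_simps)
      also have "\<dots> = \<gamma> j - (\<gamma> j)\<^sup>2" unfolding g by (simp add: power2_eq_square algebra_simps)
      finally show ?thesis .
    next
      case False
      then have "\<gamma> j = 0" using p[of j] by (auto simp: \<gamma>_def max_def field_simps)
      then show ?thesis using False by (simp add: max_def)
    qed
  qed
  finally have "(\<Sum>j<n. (1 - \<gamma> j)\<^sup>2 * (sqrt (real n) * \<theta> j)\<^sup>2) \<le> \<sigma>\<^sup>2 * (\<Sum>j<n. \<gamma> j - (\<gamma> j)\<^sup>2)" .
  then show ?thesis
    by (simp add: seq_risk_def V_def sum.distrib sum_subtractf sum_distrib_left right_diff_distrib)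
qed

definition "\<beta> = 1 / (2 * \<alpha> + 1)"

lemma beta: "0 < \<beta>" "\<beta> \<le> 1" "(2 * \<alpha> + 1) * \<beta> = 1"
  using \<alpha> by (auto simp: \<beta>_def field_simps)

text \<open>By \<open>upper\<close>, \<open>V\<close> dominates the risk of \<gamma> at every point
  of the ellipsoid, so one convenient point is enough: it is flat on the first \<open>N\<close>
  coordinates, with the height that the radius permits.\<close>

lemma V_ge:
  defines "r \<equiv> R / 2 powr (2 * \<alpha> + 1)"
  shows "r * \<sigma>\<^sup>2 / (r + \<sigma>\<^sup>2) * real n powr \<beta> \<le> V"
proof -
  define N where "N = cutoff \<beta> n"
  note N = cutoff_bounds[OF n beta(1,2), folded N_def]
  define D where "D = real N powr (2 * \<alpha> + 1)"
  define \<theta> where "\<theta> j = (if j < N then sqrt (R / D) else 0)" for j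
  have N0: "real N > 0" using N(4) by simp
  have D: "D > 0" using N0 by (simp add: D_def)
  have "(\<Sum>j<n. real (j + 1) powr (2 * \<alpha>) * (\<theta> j)\<^sup>2) = (\<Sum>j<N. real (j + 1) powr (2 * \<alpha>) * (R / D))"
    using N(3) R D by (intro sum.mono_neutral_cong_right) (auto simp: \<theta>_def)
  also have "\<dots> \<le> (\<Sum>j<N. real N powr (2 * \<alpha>) * (R / D))"
    using \<alpha> R D by (intro sum_mono mult_right_mono powr_mono2) auto
  also have "\<dots> = R"
    using N0 D by (simp add: D_def powr_add)
  finally have \<theta>: "\<theta> \<in> Ell \<alpha> R n" by (simp add: Ell_def)
  have r: "r > 0" using R by (simp add: r_def)
  have "r * \<sigma>\<^sup>2 / (r + \<sigma>\<^sup>2) * real n powr \<beta> \<le> seq_risk \<sigma> n \<gamma> (\<lambda>j. sqrt (real n) * \<theta> j)"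
  proof (rule seq_risk_ge_powr[OF s r N(3) N(1)])
    fix j assume j: "j < N"
    have "D \<le> (2 * real n powr \<beta>) powr (2 * \<alpha> + 1)"
      unfolding D_def using N(2) \<alpha> by (intro powr_mono2) auto
    also have "\<dots> = 2 powr (2 * \<alpha> + 1) * real n"
      using n beta(3) by (simp add: powr_mult powr_powr mult.commute)
    finally have "D \<le> 2 powr (2 * \<alpha> + 1) * real n" .
    then have "r * D \<le> r * (2 powr (2 * \<alpha> + 1) * real n)" using r by (intro mult_left_mono) auto
    also have "\<dots> = real n * R" by (simp add: r_def)
    finally have "r \<le> real n * R / D" using D by (simp add: pos_le_divide_eq)
    then show "r \<le> (sqrt (real n) * \<theta> j)\<^sup>2" using j R D by (simp add: \<theta>_def power_mult_distrib)
  qed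
  also have "\<dots> \<le> V" by (rule upper[OF \<theta>])
  finally show ?thesis .
qed

text \<open>The first \<open>n powr \<beta>\<close> indices alone bound the level: for larger \<open>t\<close> they would exceed the radius.\<close>
lemma level_le: "t \<le> (2 powr \<alpha> + R * 2 powr (1 + \<alpha>) / \<sigma>\<^sup>2) * real n powr (\<alpha> * \<beta>)"
proof (cases "t \<le> 2 powr \<alpha> * real n powr (\<alpha> * \<beta>)")
  case True
  have "0 \<le> R * 2 powr (1 + \<alpha>) / \<sigma>\<^sup>2 * real n powr (\<alpha> * \<beta>)" using R by simp
  then show ?thesis using True by (simp add: distrib_right)
next
  case False
  define N where "N = cutoff \<beta> n"
  note N = cutoff_bounds[OF n beta(1,2), folded N_def]
  define x where "x = real n powr \<beta>"
  have x: "x \<ge> 1" unfolding x_def using n beta by (intro ge_one_powr_ge_zero) auto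
  define y where "y = t - 2 powr \<alpha> * real n powr (\<alpha> * \<beta>)"
  have y: "y > 0" using False by (simp add: y_def)
  have xa: "x powr \<alpha> = real n powr (\<alpha> * \<beta>)" by (simp add: x_def powr_powr mult.commute)
  \<comment> \<open>On the upper half of the first \<open>N\<close> indices, \<open>a j\<close> is
    bounded on both sides by multiples of \<open>x powr \<alpha>\<close>, so all summands have the
    same order.\<close>
  have "(x / 2) * ((x / 2) powr \<alpha> * y) \<le> real (card {N div 2..<N}) * ((x / 2) powr \<alpha> * y)"
  proof (intro mult_right_mono)
    have "x / 2 \<le> real N / 2" using N(1) by (simp add: x_def)
    also have "\<dots> \<le> real (N - N div 2)" by linarith
    finally show "x / 2 \<le> real (card {N div 2..<N})" by simp
  qed (use y in auto)
  also have "\<dots> = (\<Sum>j\<in>{N div 2..<N}. (x / 2) powr \<alpha> * y)" by simp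
  also have "\<dots> \<le> (\<Sum>j\<in>{N div 2..<N}. a j * max 0 (t - a j))"
  proof (rule sum_mono)
    fix j assume j: "j \<in> {N div 2..<N}"
    have "x / 2 \<le> real (j + 1)" using j N(1) unfolding x_def[symmetric] by auto
    then have 1: "(x / 2) powr \<alpha> \<le> a j" unfolding a_def using \<alpha> x by (intro powr_mono2) auto
    have "real (j + 1) \<le> 2 * x" using j N(2) unfolding x_def[symmetric] by auto
    then have "a j \<le> (2 * x) powr \<alpha>" unfolding a_def using \<alpha> by (intro powr_mono2) auto
    also have "\<dots> = 2 powr \<alpha> * real n powr (\<alpha> * \<beta>)" using x by (simp add: powr_mult xa)
    finally have "y \<le> t - a j" by (simp add: y_def)
    then show "(x / 2) powr \<alpha> * y \<le> a j * max 0 (t - a j)"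
      using 1 y a0[of j] by (intro mult_mono) auto
  qed
  also have "\<dots> \<le> (\<Sum>j<n. a j * max 0 (t - a j))"
    using N(3) a0 by (intro sum_mono2) auto
  also have "\<dots> = real n * R / \<sigma>\<^sup>2" using level n s by (simp add: a_def field_simps)
  finally have le: "(x / 2) * (x / 2) powr \<alpha> * y \<le> real n * R / \<sigma>\<^sup>2" by (simp add: mult.assoc)
  have e: "(x / 2) * (x / 2) powr \<alpha> * (2 powr (1 + \<alpha>) * real n powr (\<alpha> * \<beta>)) = real n"
  proof -
    have "(x / 2) * (x / 2) powr \<alpha> * (2 powr (1 + \<alpha>) * real n powr (\<alpha> * \<beta>)) = x * (x powr \<alpha> * x powr \<alpha>)"
      using x by (simp add: powr_divide powr_add xa[symmetric])
    also have "\<dots> = x powr (2 * \<alpha> + 1)" using x by (simp add: powr_add[symmetric] powr_mult_base add.commute)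
    also have "\<dots> = real n" using n beta(3) by (simp add: x_def powr_powr mult.commute)
    finally show ?thesis .
  qed
  have q: "(x / 2) * (x / 2) powr \<alpha> > 0" using x by simp
  have "(x / 2) * (x / 2) powr \<alpha> * y \<le> (x / 2) * (x / 2) powr \<alpha> * (R * 2 powr (1 + \<alpha>) / \<sigma>\<^sup>2 * real n powr (\<alpha> * \<beta>))"
  proof -
    have "(x / 2) * (x / 2) powr \<alpha> * (R * 2 powr (1 + \<alpha>) / \<sigma>\<^sup>2 * real n powr (\<alpha> * \<beta>))
      = (x / 2) * (x / 2) powr \<alpha> * (2 powr (1 + \<alpha>) * real n powr (\<alpha> * \<beta>)) * R / \<sigma>\<^sup>2"
      by (simp add: mult_ac)
    then show ?thesis using le unfolding e by simp
  qed
  then have "y \<le> R * 2 powr (1 + \<alpha>) / \<sigma>\<^sup>2 * real n powr (\<alpha> * \<beta>)" using q by (rule mult_left_le_imp_le)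
  then show ?thesis by (simp add: y_def distrib_right)
qed

text \<open>The choice \<open>\<nu> = \<eta> / (8 * m)\<close> balances the two terms of the exponent in the tail bound.\<close>
lemma RM_ge:
  assumes onb: "orthonormal_rows Phi n" and \<eta>: "0 < \<eta>" "\<eta> < 1" and C: "C > 0" "t \<le> C * real n powr (\<alpha> * \<beta>)"
  defines "K \<equiv> \<sigma>\<^sup>2 * C\<^sup>2"
  shows "ennreal (((1 - \<eta>) * V - 2 * real n * (real n * R + R + 8 * K / \<eta> * real n powr (- \<beta>)) * exp (- (\<eta>\<^sup>2 * R / (16 * K)) * real n powr \<beta>)) / real n)
     \<le> RM \<sigma> n (FTheta Phi n (Ell \<alpha> R n))"
proof -
  interpret O: orthonormal_rows Phi n by (rule onb)
  define m where "m = K * real n powr (- \<beta>)"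
  define \<nu> where "\<nu> = \<eta> / (8 * m)"
  have K: "K > 0" using s C by (simp add: K_def)
  have m: "m > 0" using K n by (simp add: m_def)
  have \<nu>: "\<nu> > 0" using \<eta> m by (simp add: \<nu>_def)
  \<comment> \<open>Shrinking the prior variance by \<open>1 - \<eta>\<close> brings the mean of the
    quadratic form down to \<open>(1 - \<eta>) * R\<close>, strictly inside the radius.\<close>
  define \<tau> where "\<tau> j = sqrt (1 - \<eta>) * (sqrt (real n) * th j)" for j
  define A where "A j = (a j)\<^sup>2 * (th j)\<^sup>2" for j
  have A0: "A j \<ge> 0" for j by (simp add: A_def)
  have Am: "A j \<le> m" for j
  proof -
    have "t\<^sup>2 \<le> (C * real n powr (\<alpha> * \<beta>))\<^sup>2" using C(2) t by (intro power_mono) auto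
    also have "\<dots> = C\<^sup>2 * real n powr (2 * \<alpha> * \<beta>)"
      by (simp add: power_mult_distrib power2_eq_square powr_add[symmetric] mult.assoc)
    finally have "\<sigma>\<^sup>2 * t\<^sup>2 / real n \<le> \<sigma>\<^sup>2 * (C\<^sup>2 * real n powr (2 * \<alpha> * \<beta>)) / real n"
      by (intro divide_right_mono mult_left_mono) auto
    also have "\<dots> = K * (real n powr (2 * \<alpha> * \<beta>) / real n powr 1)" using n by (simp add: K_def)
    also have "real n powr (2 * \<alpha> * \<beta>) / real n powr 1 = real n powr (2 * \<alpha> * \<beta> - 1)" by (rule powr_diff[symmetric])
    also have "2 * \<alpha> * \<beta> - 1 = - \<beta>" using beta(3) by (simp add: algebra_simps)
    finally show ?thesis using energy_le[of j] by (simp add: A_def m_def)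
  qed
  have ta: "real (j + 1) powr (2 * \<alpha>) * (\<tau> j)\<^sup>2 / real n = (1 - \<eta>) * A j" for j
    unfolding a_sq using \<eta> n by (simp add: \<tau>_def A_def power_mult_distrib)
  have \<nu>A: "\<nu> * ((1 - \<eta>) * A j) \<le> \<eta> / 8" for j
  proof -
    have "\<nu> * ((1 - \<eta>) * A j) \<le> \<nu> * (1 * m)" using \<nu> \<eta> Am[of j] A0[of j] by (intro mult_left_mono mult_mono) auto
    also have "\<dots> = \<eta> / 8" using m by (simp add: \<nu>_def)
    finally show ?thesis .
  qed
  have expo: "- \<nu> * R + (\<Sum>j<n. \<nu> * ((1 - \<eta>) * A j) + 4 * (\<nu> * ((1 - \<eta>) * A j))\<^sup>2) \<le> - (\<eta>\<^sup>2 * R / (16 * K)) * real n powr \<beta>"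
  proof -
    \<comment> \<open>The prior leaves the margin \<open>\<eta> * R\<close>. Half of it pays for the
      quadratic term of the exponential moment, and the other half gives the decay.\<close>
    have "(\<Sum>j<n. \<nu> * ((1 - \<eta>) * A j) + 4 * (\<nu> * ((1 - \<eta>) * A j))\<^sup>2) \<le> (\<Sum>j<n. \<nu> * (1 - \<eta> / 2) * A j)"
    proof (rule sum_mono)
      fix j
      let ?y = "\<nu> * ((1 - \<eta>) * A j)"
      have y0: "?y \<ge> 0" using \<nu> \<eta> A0[of j] by simp
      have y1: "?y \<le> \<nu> * A j" using \<nu> \<eta> A0[of j] by (intro mult_left_mono) (auto simp: algebra_simps)
      have "4 * ?y\<^sup>2 = 4 * (?y * ?y)" by (simp add: power2_eq_square)
      also have "\<dots> \<le> 4 * (\<eta> / 8 * (\<nu> * A j))" by (intro mult_left_mono mult_mono[OF \<nu>A y1]) (use y0 \<eta> in auto)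
      finally have "?y + 4 * ?y\<^sup>2 \<le> ?y + \<eta> / 2 * (\<nu> * A j)" by simp
      also have "\<dots> = \<nu> * (1 - \<eta> / 2) * A j" by (simp add: algebra_simps)
      finally show "?y + 4 * ?y\<^sup>2 \<le> \<nu> * (1 - \<eta> / 2) * A j" .
    qed
    also have "\<dots> = \<nu> * (1 - \<eta> / 2) * R" using energy_sum by (simp add: A_def sum_distrib_left[symmetric])
    finally have "- \<nu> * R + (\<Sum>j<n. \<nu> * ((1 - \<eta>) * A j) + 4 * (\<nu> * ((1 - \<eta>) * A j))\<^sup>2) \<le> - (\<nu> * \<eta> * R / 2)"
      by (simp add: algebra_simps)
    also have "- (\<nu> * \<eta> * R / 2) = - (\<eta>\<^sup>2 * R / (16 * K)) * real n powr \<beta>"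
      using K n by (simp add: \<nu>_def m_def powr_minus power2_eq_square field_simps)
    finally show ?thesis .
  qed
  have nu_inv: "1 / \<nu> = 8 * K / \<eta> * real n powr (- \<beta>)" by (simp add: \<nu>_def m_def)
  let ?tail = "2 * real n * (real n * R + R + 8 * K / \<eta> * real n powr (- \<beta>)) * exp (- (\<eta>\<^sup>2 * R / (16 * K)) * real n powr \<beta>)"
  have tail0: "0 \<le> ?tail" using R K \<eta> by (intro mult_nonneg_nonneg add_nonneg_nonneg) auto
  \<comment> \<open>Reducing the signal energy also reduces the denominators, so the Bayes risk
    drops by at most the factor \<open>1 - \<eta>\<close>.\<close>
  have bayes_value: "(1 - \<eta>) * V \<le> (\<Sum>j<n. (\<tau> j)\<^sup>2 * \<sigma>\<^sup>2 / ((\<tau> j)\<^sup>2 + \<sigma>\<^sup>2))"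
    unfolding V_def mult.left_commute[of "1 - \<eta>"] sum_distrib_left
  proof (rule sum_mono)
    fix j
    define x where "x = (sqrt (real n) * th j)\<^sup>2"
    have x0: "x \<ge> 0" by (simp add: x_def)
    have tx: "(\<tau> j)\<^sup>2 = (1 - \<eta>) * x" using \<eta> by (simp add: \<tau>_def x_def power_mult_distrib)
    have "\<sigma>\<^sup>2 * ((1 - \<eta>) * \<gamma> j) = (1 - \<eta>) * (x * \<sigma>\<^sup>2 / (x + \<sigma>\<^sup>2))" using signal_value[of j] by (simp add: x_def[symmetric])
    also have "\<dots> = (1 - \<eta>) * x * \<sigma>\<^sup>2 / (x + \<sigma>\<^sup>2)" by simp
    also have "\<dots> \<le> (1 - \<eta>) * x * \<sigma>\<^sup>2 / ((1 - \<eta>) * x + \<sigma>\<^sup>2)"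
    proof (rule divide_left_mono)
      show "(1 - \<eta>) * x + \<sigma>\<^sup>2 \<le> x + \<sigma>\<^sup>2" using x0 \<eta> by (simp add: algebra_simps)
      show "0 < (x + \<sigma>\<^sup>2) * ((1 - \<eta>) * x + \<sigma>\<^sup>2)" using x0 \<eta> s by (intro mult_pos_pos add_nonneg_pos) auto
    qed (use x0 \<eta> in auto)
    finally show "\<sigma>\<^sup>2 * ((1 - \<eta>) * \<gamma> j) \<le> (\<tau> j)\<^sup>2 * \<sigma>\<^sup>2 / ((\<tau> j)\<^sup>2 + \<sigma>\<^sup>2)" unfolding tx .
  qed
  show ?thesis unfolding RM_def
  proof (rule INF_greatest)
    fix g assume g: "g \<in> estimators n"
    define S where "S = (SUP f\<in>FTheta Phi n (Ell \<alpha> R n). risk \<sigma> n g f)"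
    have "ennreal ((1 - \<eta>) * V) \<le> ennreal (\<Sum>j<n. (\<tau> j)\<^sup>2 * \<sigma>\<^sup>2 / ((\<tau> j)\<^sup>2 + \<sigma>\<^sup>2))" by (rule ennreal_leI[OF bayes_value])
    also have "\<dots> \<le> ennreal (real n) * S + ennreal (2 * real n * (real n * R + R + 1 / \<nu>) *
         exp (- \<nu> * R + (\<Sum>j<n. \<nu> * (real (j + 1) powr (2 * \<alpha>) * (\<tau> j)\<^sup>2 / real n) + 4 * (\<nu> * (real (j + 1) powr (2 * \<alpha>) * (\<tau> j)\<^sup>2 / real n))\<^sup>2)))"
      unfolding S_def
    proof (rule O.bayes_lower_bound[OF s n less_imp_le[OF \<alpha>] less_imp_le[OF R] \<nu> _ g])
      fix j
      show "\<nu> * (real (j + 1) powr (2 * \<alpha>) * (\<tau> j)\<^sup>2 / real n) \<le> 1 / 4"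
        unfolding ta using \<nu>A[of j] \<eta> by linarith
    qed
    also have "\<dots> \<le> ennreal (real n) * S + ennreal ?tail"
      unfolding ta nu_inv using R K \<eta> expo
      by (intro add_left_mono ennreal_leI mult_left_mono) (auto intro!: mult_nonneg_nonneg add_nonneg_nonneg)
    finally have le: "ennreal ((1 - \<eta>) * V) \<le> ennreal (real n) * S + ennreal ?tail" .
    show "ennreal (((1 - \<eta>) * V - ?tail) / real n) \<le> S"
    proof (cases S)
      case (real x)
      then have "ennreal ((1 - \<eta>) * V) \<le> ennreal (real n * x + ?tail)"
        using le tail0 by (simp only: ennreal_mult'[symmetric] ennreal_plus[symmetric] of_nat_0_le_iff mult_nonneg_nonneg)
      then have "(1 - \<eta>) * V \<le> real n * x + ?tail"
        using real tail0 by (subst (asm) ennreal_le_iff) auto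
      then have "((1 - \<eta>) * V - ?tail) / real n \<le> x" using n by (simp add: pos_divide_le_eq mult.commute)
      then show ?thesis unfolding real(2) by (rule ennreal_leI)
    qed simp
  qed
qed

end

text \<open>Pinsker's level depends on \<open>n\<close>, so a saddle point is chosen for each
  \<open>n\<close>. The minimax risk times \<open>n\<close> lies between
  \<open>(1 - \<eta>) * V n - tl \<eta> n\<close> and \<open>V n\<close>; \<eta> stays fixed while
  \<open>n\<close> grows and becomes small only afterwards.\<close>

theorem mma_ellipsoid:
  fixes Phi :: "nat \<Rightarrow> nat \<Rightarrow> nat \<Rightarrow> real"
  assumes onb: "\<And>n. orthonormal_rows (Phi n) n"
    and s: "\<sigma> > 0" and kappa: "0 < \<kappa>" "\<kappa> < 1" and t: "t1 > 0" "t2 > 0"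
    and \<alpha>: "\<alpha> > 0" and R: "R > 0"
  shows "(\<lambda>n. enn2real (supRiskMMA \<sigma> (Phi n) n \<kappa> t1 t2 (FTheta (Phi n) n (Ell \<alpha> R n)))
          / enn2real (RM \<sigma> n (FTheta (Phi n) n (Ell \<alpha> R n)))) \<longlonglongrightarrow> 1"
proof -
  have "\<forall>n. \<exists>T. n \<ge> 1 \<longrightarrow> pinsker \<sigma> \<alpha> R T n"
  proof (intro allI)
    fix n
    show "\<exists>T. n \<ge> 1 \<longrightarrow> pinsker \<sigma> \<alpha> R T n"
    proof (cases "n \<ge> 1")
      case True
      then have "\<exists>T\<ge>1. \<sigma>\<^sup>2 / real n * (\<Sum>j<n. real (j + 1) powr \<alpha> * max 0 (T - real (j + 1) powr \<alpha>)) = R"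
        using \<alpha> by (intro pinsker_level_exists[OF s R]) (auto intro!: ge_one_powr_ge_zero)
      then show ?thesis unfolding pinsker_def using s \<alpha> R True by blast
    qed simp
  qed
  from choice[OF this] obtain T where T: "\<And>n. n \<ge> 1 \<Longrightarrow> pinsker \<sigma> \<alpha> R (T n) n" by blast
  define \<gamma> where "\<gamma> n = pinsker.\<gamma> \<alpha> (T n)" for n
  define th where "th n = pinsker.th \<sigma> \<alpha> (T n) n" for n
  define V where "V n = pinsker.V \<sigma> \<alpha> (T n) n" for n
  define \<beta> where "\<beta> = 1 / (2 * \<alpha> + 1)"
  define r where "r = R / 2 powr (2 * \<alpha> + 1)"
  define c0 where "c0 = r * \<sigma>\<^sup>2 / (r + \<sigma>\<^sup>2)"
  define e where "e = 1 - 2 * \<alpha>"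
  define Ct where "Ct = R * \<kappa> powr (- 2 * \<alpha>)"
  note folds = \<gamma>_def[symmetric] th_def[symmetric] V_def[symmetric]
  have s2: "\<sigma>\<^sup>2 > 0" using s by simp
  have \<beta>: "0 < \<beta>" using \<alpha> by (simp add: \<beta>_def)
  have c0: "c0 > 0" using R s2 by (simp add: c0_def r_def add_pos_pos)
  have \<beta>': "pinsker.\<beta> \<alpha> = \<beta>" using pinsker.\<beta>_def[OF T[OF order_refl]] by (simp add: \<beta>_def)
  have \<gamma>: "0 \<le> \<gamma> n j" "\<gamma> n j \<le> 1" "i \<le> j \<Longrightarrow> \<gamma> n j \<le> \<gamma> n i" if "n \<ge> 1" for n i j
    using pinsker.gamma_bounds[OF T[OF that]] pinsker.gamma_antimono[OF T[OF that]] by (simp_all add: \<gamma>_def)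
  have up: "seq_risk \<sigma> n (\<gamma> n) (\<lambda>j. sqrt (real n) * \<theta> j) \<le> V n" if "n \<ge> 1" "\<theta> \<in> Ell \<alpha> R n" for n \<theta>
    using pinsker.upper[OF T[OF that(1)] that(2)] by (simp add: folds)
  have th: "th n \<in> Ell \<alpha> R n" if "n \<ge> 1" for n
    using pinsker.th_in_Ell[OF T[OF that]] by (simp add: folds)
  have lo: "V n \<le> seq_risk \<sigma> n g (\<lambda>j. sqrt (real n) * th n j)" if "n \<ge> 1" for n g
    using pinsker.lower[OF T[OF that], of g] by (simp add: folds)
  have Vge: "c0 * real n powr \<beta> \<le> V n" if "n \<ge> 1" for n
    using pinsker.V_ge[OF T[OF that]] by (simp add: folds c0_def r_def \<beta>')
  have Vpos: "V n > 0" if "n \<ge> 1" for n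
  proof -
    have "0 < c0 * real n powr \<beta>" using c0 that by simp
    then show ?thesis using Vge[OF that] by linarith
  qed
  have tail: "real n * (\<Sum>j\<in>{nat \<lfloor>\<kappa> * real n\<rfloor>..<n}. (\<theta> j)\<^sup>2) \<le> Ct * real n powr e" if n: "n \<ge> 1" and \<theta>: "\<theta> \<in> Ell \<alpha> R n" for n \<theta>
  proof -
    define p where "p = (\<kappa> * real n) powr (2 * \<alpha>)"
    have p: "p > 0" using kappa n by (simp add: p_def)
    have "p * (\<Sum>j\<in>{nat \<lfloor>\<kappa> * real n\<rfloor>..<n}. (\<theta> j)\<^sup>2) \<le> (\<Sum>j\<in>{nat \<lfloor>\<kappa> * real n\<rfloor>..<n}. real (j + 1) powr (2 * \<alpha>) * (\<theta> j)\<^sup>2)"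
      unfolding sum_distrib_left p_def
    proof (intro sum_mono mult_right_mono powr_mono2)
      fix j assume "j \<in> {nat \<lfloor>\<kappa> * real n\<rfloor>..<n}"
      then show "\<kappa> * real n \<le> real (j + 1)" using kappa_index_le[OF kappa(1)] by simp
    qed (use \<alpha> kappa in auto)
    also have "\<dots> \<le> (\<Sum>j<n. real (j + 1) powr (2 * \<alpha>) * (\<theta> j)\<^sup>2)" by (intro sum_mono2) auto
    also have "\<dots> \<le> R" using \<theta> by (simp add: Ell_def)
    finally have "(\<Sum>j\<in>{nat \<lfloor>\<kappa> * real n\<rfloor>..<n}. (\<theta> j)\<^sup>2) \<le> R / p" using p by (simp add: pos_le_divide_eq mult.commute)
    then have "real n * (\<Sum>j\<in>{nat \<lfloor>\<kappa> * real n\<rfloor>..<n}. (\<theta> j)\<^sup>2) \<le> real n * (R / p)" by (intro mult_left_mono) auto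
    also have "R / p = Ct * real n powr (- 2 * \<alpha>)"
      using kappa n by (simp add: p_def Ct_def powr_mult powr_minus field_simps)
    also have "real n * (Ct * real n powr (- 2 * \<alpha>)) = Ct * (real n powr 1 * real n powr (- 2 * \<alpha>))" using n by simp
    also have "\<dots> = Ct * real n powr e" unfolding powr_add[symmetric] by (simp add: e_def)
    finally show ?thesis .
  qed
  \<comment> \<open>The exponent condition for the squared bias of the variance estimate. The left
    side is \<open>1 - 2 * \<alpha> - 8 * \<alpha>\<^sup>2\<close>, so no smoothness beyond \<alpha>
    > 0 is required.\<close>
  have "(1 - 4 * \<alpha>) * (2 * \<alpha> + 1) < 1" using \<alpha> by (simp add: algebra_simps add_pos_pos)
  then have e: "2 * e - 1 < \<beta>" using \<alpha> by (simp add: e_def \<beta>_def pos_less_divide_eq)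
  have S: "(\<lambda>n. real n * enn2real (supRiskMMA \<sigma> (Phi n) n \<kappa> t1 t2 (FTheta (Phi n) n (Ell \<alpha> R n))) / V n) \<longlonglongrightarrow> 1"
    by (rule mma_sup_risk_asymp[where \<gamma>=\<gamma> and th=th and \<beta>=\<beta> and ?c0.0=c0 and b="\<lambda>n. Ct * real n powr e", OF onb s kappa t])
      (use \<gamma> up th lo Vge c0 \<beta> tail tail_negligible[OF Vge c0 e] in auto)
  let ?RM = "\<lambda>n. RM \<sigma> n (FTheta (Phi n) n (Ell \<alpha> R n))"
  have RM_up: "?RM n \<le> ennreal (V n / real n)" if n: "n \<ge> 1" for n
    by (rule orthonormal_rows.RM_le_linear[OF onb s n up[OF n]])
  define C where "C = 2 powr \<alpha> + R * 2 powr (1 + \<alpha>) / \<sigma>\<^sup>2"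
  have C: "C > 0" using R s by (simp add: C_def add_pos_nonneg)
  define K where "K = \<sigma>\<^sup>2 * C\<^sup>2"
  have K: "K > 0" using s C by (simp add: K_def)
  define tl where "tl \<eta> n = 2 * real n * (real n * R + R + 8 * K / \<eta> * real n powr (- \<beta>)) * exp (- (\<eta>\<^sup>2 * R / (16 * K)) * real n powr \<beta>)" for \<eta> n
  have RM_lo: "ennreal (((1 - \<eta>) * V n - tl \<eta> n) / real n) \<le> ?RM n" if n: "n \<ge> 1" and \<eta>: "0 < \<eta>" "\<eta> < 1" for n \<eta>
    using pinsker.RM_ge[OF T[OF n] onb \<eta> C] pinsker.level_le[OF T[OF n]]
    by (simp only: folds \<beta>' K_def C_def tl_def)
  have tl_lim: "(\<lambda>n. tl \<eta> n / V n) \<longlonglongrightarrow> 0" if \<eta>: "0 < \<eta>" "\<eta> < 1" for \<eta>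
  proof (rule Lim_null_comparison)
    define K1 where "K1 = 8 * K / \<eta>"
    define K2 where "K2 = \<eta>\<^sup>2 * R / (16 * K)"
    have K12: "K1 > 0" "K2 > 0" using K \<eta> R by (auto simp: K1_def K2_def)
    show "(\<lambda>n. 2 * real n * (real n * R + R + K1 * real n powr (- \<beta>)) * exp (- K2 * real n powr \<beta>) / (c0 * real n powr \<beta>)) \<longlonglongrightarrow> 0"
      using K12 R c0 \<beta> by real_asymp
    show "eventually (\<lambda>n. norm (tl \<eta> n / V n) \<le> 2 * real n * (real n * R + R + K1 * real n powr (- \<beta>)) * exp (- K2 * real n powr \<beta>) / (c0 * real n powr \<beta>)) sequentially"
      using eventually_ge_at_top[of 1]
    proof eventually_elim
      case (elim n)
      have p: "0 < c0 * real n powr \<beta>" using c0 elim by simp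
      have tl0: "0 \<le> tl \<eta> n" unfolding tl_def using R K \<eta> by (intro mult_nonneg_nonneg add_nonneg_nonneg) auto
      have "tl \<eta> n / V n \<le> tl \<eta> n / (c0 * real n powr \<beta>)"
        by (rule divide_left_mono[OF Vge[OF elim] tl0 mult_pos_pos[OF Vpos[OF elim] p]])
      moreover have "norm (tl \<eta> n / V n) = tl \<eta> n / V n" using tl0 Vpos[OF elim] by simp
      ultimately show ?case by (simp add: tl_def K1_def K2_def)
    qed
  qed
  have RM_lim: "(\<lambda>n. real n * enn2real (?RM n) / V n) \<longlonglongrightarrow> 1"
  proof (rule order_tendstoI)
    fix x :: real assume x: "x < 1"
    define \<eta> where "\<eta> = min (1/2) ((1 - x) / 2)"
    have "\<eta> \<le> (1 - x) / 2" unfolding \<eta>_def by (rule min.cobounded2)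
    then have x\<eta>: "x < (1 - \<eta>) - 0" using x by (simp add: field_simps)
    have \<eta>: "0 < \<eta>" "\<eta> < 1" using x by (simp_all add: \<eta>_def)
    have "(\<lambda>n. (1 - \<eta>) - tl \<eta> n / V n) \<longlonglongrightarrow> (1 - \<eta>) - 0" by (intro tendsto_intros tl_lim \<eta>)
    then have "eventually (\<lambda>n. x < (1 - \<eta>) - tl \<eta> n / V n) sequentially" using x\<eta> by (rule order_tendstoD)
    then show "eventually (\<lambda>n. x < real n * enn2real (?RM n) / V n) sequentially"
      using eventually_ge_at_top[of 1]
    proof eventually_elim
      case (elim n)
      have fin: "?RM n < top" using RM_up[OF elim(2)] by (rule le_less_trans) simp
      have "((1 - \<eta>) * V n - tl \<eta> n) / real n \<le> enn2real (?RM n)"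
      proof (cases "0 \<le> ((1 - \<eta>) * V n - tl \<eta> n) / real n")
        case True
        then show ?thesis using enn2real_mono[OF RM_lo[OF elim(2) \<eta>] fin] by simp
      next
        case False
        then show ?thesis using enn2real_nonneg[of "?RM n"] by linarith
      qed
      then have "(1 - \<eta>) * V n - tl \<eta> n \<le> real n * enn2real (?RM n)"
        using elim(2) by (simp add: pos_divide_le_eq mult.commute)
      then have "((1 - \<eta>) * V n - tl \<eta> n) / V n \<le> real n * enn2real (?RM n) / V n"
        using Vpos[OF elim(2)] by (intro divide_right_mono) auto
      moreover have "((1 - \<eta>) * V n - tl \<eta> n) / V n = (1 - \<eta>) - tl \<eta> n / V n"
        using Vpos[OF elim(2)] by (simp add: diff_divide_distrib)
      ultimately show ?case using elim(1) by simp
    qed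
  next
    fix x :: real assume x: "1 < x"
    show "eventually (\<lambda>n. real n * enn2real (?RM n) / V n < x) sequentially"
      using eventually_ge_at_top[of 1]
    proof eventually_elim
      case (elim n)
      have "enn2real (?RM n) \<le> V n / real n"
        using RM_up[OF elim] Vpos[OF elim] by (intro enn2real_leI) auto
      then have "real n * enn2real (?RM n) \<le> V n" using elim by (simp add: field_simps)
      then have "real n * enn2real (?RM n) / V n \<le> 1" using Vpos[OF elim] by simp
      then show ?case using x by simp
    qed
  qed
  from ratio_tendsto_one[OF S RM_lim Vpos] show ?thesis .
qed

theorem theorem8:
  fixes \<sigma> \<kappa> t1 t2 :: real
    and X :: "nat \<Rightarrow> nat \<Rightarrow> nat \<Rightarrow> real"
    and \<phi> :: "nat \<Rightarrow> nat \<Rightarrow> nat \<Rightarrow> real"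
  assumes sigma_pos: "\<sigma> > 0"
    and kappa: "0 < \<kappa>" "\<kappa> < 1"
    and t_pos: "t1 > 0" "t2 > 0"
    and full_rank: "\<And>n c. (\<forall>i<n. (\<Sum>j<n. X n i j * c j) = 0) \<Longrightarrow> (\<forall>j<n. c j = 0)"
    and orthonormal: "\<And>n j l. j < n \<Longrightarrow> l < n \<Longrightarrow>
          (\<Sum>i<n. \<phi> n j i * \<phi> n l i) = (if j = l then 1 else 0)"
    and span1: "\<And>n k j. k \<le> n \<Longrightarrow> j < k \<Longrightarrow>
          \<exists>c. \<forall>i<n. \<phi> n j i = (\<Sum>l<k. c l * X n i l)"
    and span2: "\<And>n k j. k \<le> n \<Longrightarrow> j < k \<Longrightarrow>
          \<exists>c. \<forall>i<n. X n i j = (\<Sum>l<k. c l * \<phi> n l i)"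
  shows "(\<forall>\<alpha>>0. \<forall>R>0.
            (\<lambda>n. enn2real (supRiskMMA \<sigma> (\<phi> n) n \<kappa> t1 t2 (FTheta (\<phi> n) n (Ell \<alpha> R n)))
                 / enn2real (RM \<sigma> n (FTheta (\<phi> n) n (Ell \<alpha> R n)))) \<longlonglongrightarrow> 1)
       \<and> (\<forall>c>0. \<forall>q>1/2.
            (\<lambda>n. enn2real (supRiskMMA \<sigma> (\<phi> n) n \<kappa> t1 t2 (FTheta (\<phi> n) n (Hyp c q n)))
                 / enn2real (RL \<sigma> (\<phi> n) n (FTheta (\<phi> n) n (Hyp c q n)))) \<longlonglongrightarrow> 1)"
proof (intro conjI allI impI)
  have onb: "orthonormal_rows (\<phi> n) n" for n
    using orthonormal by unfold_locales
  show "(\<lambda>n. enn2real (supRiskMMA \<sigma> (\<phi> n) n \<kappa> t1 t2 (FTheta (\<phi> n) n (Ell \<alpha> R n)))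
      / enn2real (RM \<sigma> n (FTheta (\<phi> n) n (Ell \<alpha> R n)))) \<longlonglongrightarrow> 1" if "\<alpha> > 0" "R > 0" for \<alpha> R
    by (rule mma_ellipsoid[OF onb sigma_pos kappa t_pos that])
  show "(\<lambda>n. enn2real (supRiskMMA \<sigma> (\<phi> n) n \<kappa> t1 t2 (FTheta (\<phi> n) n (Hyp c q n)))
      / enn2real (RL \<sigma> (\<phi> n) n (FTheta (\<phi> n) n (Hyp c q n)))) \<longlonglongrightarrow> 1" if "c > 0" "q > 1/2" for c q
    by (rule mma_hyperrectangle[OF onb sigma_pos kappa t_pos that])
qed

end
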